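(* Assume $\Phi=(\Phi_1,\dots,\Phi_m)$ is continuous. For any positive real numbers $\bar z,\bar u,\bar w$, there exist positive real numbers $k_{ij}$ ($1\le j\le i\le m$) and $L_i$ ($1\le i\le m$), two class $\mathcal K$ functions $\gamma_1,\gamma_2$ and a class $\mathcal{KL}$ function $\beta$ such that, for all locally bounded time functions $(u,v,w,\hat w)$, every $z\in\mathbb R^m$ and every observer initial condition $(\hat{\mathbf z}_1,\dots,\hat{\mathbf z}_m)\in\mathbb R^1\times\mathbb R^2\times\cdots\times\mathbb R^m$, the cascaded homogeneous observer (see context) admits absolutely continuous solutions $(\hat{\mathbf Z}_1(t),\dots,\hat{\mathbf Z}_m(t))$ defined on $\mathbb R_+$, and for any such solution we have, for all $i\in\{1,\dots,m\}$ and for all $t\ge 0$ such that $|Z(z,s;u,w)|\le\bar z$, $|u(s)|\le\bar u$ and $|\Delta w(s)|\le\bar w$ for all $0\le s\le t$, $$|\hat{\mathbf Z}_i(t)-\mathbf Z_i(t)|\le\max\left\{\beta\Big(\sum_{j=1}^m|\hat{\mathbf z}_j-\mathbf z_j|,\,t\Big),\ \sup_{s\in[0,t]}\gamma_1(|v(s)|),\ \sup_{1\le j\le i-1,\ s\in[0,t]}\gamma_2(|\Delta w_j(s)|)\right\}$$ (the last supremum being absent if $i=1$), where $\mathbf z_j=(z_1,\dots,z_j)$, $\mathbf Z_i(t)=(Z_1(z,t;u,w),\dots,Z_i(z,t;u,w))$ and $\Delta w=\hat w-w$. Moreover, when the bounds $|Z(z,s;u,w)|\le\bar z$ and $|u(s)|\le\bar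 u$ hold for all $s\ge0$ and $v(t)=\Delta w_j(t)=0$ for all $t\ge 0$ and all $j$, there exists $T$ such that $\hat{\mathbf Z}_i(t)=\mathbf Z_i(t)$ for all $t\ge T$ and all $i\in\{1,\dots,m\}$.
   Context: System: $\dot z_i=z_{i+1}+\Phi_i(u,z_1,\dots,z_i)+w_i$ for $1\le i\le m-1$, $\dot z_m=\Phi_m(u,z)+w_m$, with measured output $y=z_1+v\in\mathbb R$. Here $z\in\mathbb R^m$ is the state, $u(t)\in\mathbb R^p$ the input, $w(t)\in\mathbb R^m$ a disturbance on the dynamics, $v(t)\in\mathbb R$ a disturbance on the measurement, $\hat w(t)\in\mathbb R^m$ an approximation of $w$, and $\Phi_i:\mathbb R^p\times\mathbb R^i\to\mathbb R$. All time functions are measurable and locally bounded on $[0,+\infty)$. $Z(z,t;u,w)$ denotes a solution of the system equal to $z$ at time $0$; standing assumption: such solutions are defined for all $t\ge0$. Notation: $\lfloor a\rceil^b=\mathrm{sign}(a)|a|^b$ for $b>0$; $\mathrm S(a)=\{1\}$ if $a>0$, $[-1,1]$ if $a=0$, $\{-1\}$ if $a<0$. Cascaded homogeneous observer: it is made of $m$ blocks; block $i$ has state $\hat{\mathbf z}_i=(\hat z_{i1},\dots,\hat z_{ii})\in\mathbb R^i$ and dynamics $$\dot{\hat z}_{ij}=\hat z_{i(j+1)}+\Phi_j(u,\hat z_{j1},\dots,\hat z_{jj})+\hat w_j-L_i^j\,k_{ij}\,\lfloor\hat z_{i1}-y\rceil^{\frac{i-j}{i}},\quad 1\le j\le i-1,$$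 $$\dot{\hat z}_{ii}\in\hat w_i-L_i^i\,k_{ii}\,\mathrm S(\hat z_{i1}-y).$$ (Block $1$ is $\dot{\hat z}_{11}\in\hat w_1-L_1k_{11}\mathrm S(\hat z_{11}-y)$.) $\hat{\mathbf Z}_i(t)$ denotes the state at time $t$ of block $i$ along a solution with initial condition $(\hat{\mathbf z}_1,\dots,\hat{\mathbf z}_m)$ at time $0$, driven by $u$, $\hat w$ and $y(t)=Z_1(z,t;u,w)+v(t)$. *)

theory Defs
  imports "HOL-Analysis.Analysis"
begin

text \<open>
  Vectors of \<open>\<real>\<^sup>i\<close>, whose dimension \<open>i\<close> varies inside the statement, are functions
  \<open>nat \<Rightarrow> real\<close> of which only the components with index in \<open>{1..i}\<close> matter.  Their Euclidean
  norm is \<open>L2_set x {1..i}\<close>.  Where an argument must genuinely range over \<open>\<real>\<^sup>i\<close> (the maps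
  \<open>\<Phi> i\<close>), the space is \<open>{1..i} \<rightarrow>\<^sub>E UNIV\<close> with the product topology, and \<open>restrict x {1..i}\<close>
  is the point of it with components \<open>x 1, \<dots>, x i\<close>.
\<close>

subsection \<open>Comparison functions\<close>

definition class_K :: "(real \<Rightarrow> real) \<Rightarrow> bool" where
  "class_K \<gamma> \<longleftrightarrow> continuous_on {0..} \<gamma> \<and> strict_mono_on {0..} \<gamma> \<and> \<gamma> 0 = 0"

definition class_KL :: "(real \<Rightarrow> real \<Rightarrow> real) \<Rightarrow> bool" where
  "class_KL \<beta> \<longleftrightarrow>
     continuous_on ({0..} \<times> {0..}) (\<lambda>(r, t). \<beta> r t) \<and>
     (\<forall>t\<ge>0. class_K (\<lambda>r. \<beta> r t)) \<and>
     (\<forall>r\<ge>0. antimono_on {0..} (\<beta> r) \<and> (\<beta> r \<longlongrightarrow> 0) at_top)"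

subsection \<open>Signed powers and the set-valued sign\<close>

definition signed_powr :: "real \<Rightarrow> real \<Rightarrow> real" where
  "signed_powr a b = sgn a * \<bar>a\<bar> powr b"

definition sign_set :: "real \<Rightarrow> real set" where
  "sign_set a = (if a > 0 then {1} else if a < 0 then {-1} else {-1..1})"

subsection \<open>Time functions and absolutely continuous solutions on the half-line\<close>

definition locally_bounded_measurable :: "(real \<Rightarrow> 'a::euclidean_space) \<Rightarrow> bool" where
  "locally_bounded_measurable f \<longleftrightarrow>
     f \<in> borel_measurable (lebesgue_on {0..}) \<and> (\<forall>T\<ge>0. bounded (f ` {0..T}))"

definition abs_continuous_on_interval :: "(real \<Rightarrow> real) \<Rightarrow> real \<Rightarrow> real \<Rightarrow> bool" where
  "abs_continuous_on_interval f c d \<longleftrightarrow>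
     (\<forall>\<epsilon>>0. \<exists>\<delta>>0. \<forall>(n::nat) (a::nat \<Rightarrow> real) (b::nat \<Rightarrow> real).
        (\<forall>l<n. c \<le> a l \<and> a l \<le> b l \<and> b l \<le> d) \<and>
        disjoint_family_on (\<lambda>l. {a l<..<b l}) {..<n} \<and>
        (\<Sum>l<n. b l - a l) < \<delta>
        \<longrightarrow> (\<Sum>l<n. \<bar>f (b l) - f (a l)\<bar>) < \<epsilon>)"

text \<open>\<open>inclusion_solution F x\<close>: on \<open>[0, \<infinity>)\<close>, \<open>x\<close> is locally absolutely continuous and
  \<open>x'(t) \<in> F t\<close> for almost every \<open>t\<close>.\<close>

definition inclusion_solution :: "(real \<Rightarrow> real set) \<Rightarrow> (real \<Rightarrow> real) \<Rightarrow> bool" where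
  "inclusion_solution F x \<longleftrightarrow>
     (\<forall>T\<ge>0. abs_continuous_on_interval x 0 T) \<and>
     (AE t in lebesgue_on {0..}. \<exists>D\<in>F t. (x has_real_derivative D) (at t within {0..}))"

subsection \<open>The triangular system\<close>

definition system_rhs ::
  "nat \<Rightarrow> (nat \<Rightarrow> real^'p \<Rightarrow> (nat \<Rightarrow> real) \<Rightarrow> real) \<Rightarrow> real^'p \<Rightarrow> (nat \<Rightarrow> real)
     \<Rightarrow> (nat \<Rightarrow> real) \<Rightarrow> nat \<Rightarrow> real" where
  "system_rhs m \<Phi> u w z i =
     (if i < m then z (i + 1) else 0) + \<Phi> i u (restrict z {1..i}) + w i"

definition system_solution ::
  "nat \<Rightarrow> (nat \<Rightarrow> real^'p \<Rightarrow> (nat \<Rightarrow> real) \<Rightarrow> real) \<Rightarrow> (real \<Rightarrow> real^'p)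
     \<Rightarrow> (real \<Rightarrow> nat \<Rightarrow> real) \<Rightarrow> (nat \<Rightarrow> real) \<Rightarrow> (real \<Rightarrow> nat \<Rightarrow> real) \<Rightarrow> bool" where
  "system_solution m \<Phi> u w z Z \<longleftrightarrow>
     (\<forall>i\<in>{1..m}. Z 0 i = z i \<and>
        inclusion_solution (\<lambda>t. {system_rhs m \<Phi> (u t) (w t) (Z t) i}) (\<lambda>t. Z t i))"

subsection \<open>The cascaded homogeneous observer\<close>

text \<open>The observer state is a family \<open>zh\<close> with \<open>zh i j\<close>, \<open>1 \<le> j \<le> i \<le> m\<close>, the component \<open>j\<close> of
  block \<open>i\<close>.  For \<open>j < i\<close> the nonlinearity of component \<open>j\<close> is evaluated at the whole state of
  block \<open>j\<close>, not at the first \<open>j\<close> components of block \<open>i\<close>.\<close>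

definition observer_rhs ::
  "(nat \<Rightarrow> real^'p \<Rightarrow> (nat \<Rightarrow> real) \<Rightarrow> real) \<Rightarrow> (nat \<Rightarrow> nat \<Rightarrow> real) \<Rightarrow> (nat \<Rightarrow> real)
     \<Rightarrow> real^'p \<Rightarrow> (nat \<Rightarrow> real) \<Rightarrow> real \<Rightarrow> (nat \<Rightarrow> nat \<Rightarrow> real) \<Rightarrow> nat \<Rightarrow> nat \<Rightarrow> real set" where
  "observer_rhs \<Phi> k L u wh y zh i j =
     (if j < i then
        {zh i (j + 1) + \<Phi> j u (restrict (zh j) {1..j}) + wh j
           - L i ^ j * k i j * signed_powr (zh i 1 - y) ((real i - real j) / real i)}
      else
        (\<lambda>\<sigma>. wh i - L i ^ i * k i i * \<sigma>) ` sign_set (zh i 1 - y))"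

definition observer_solution ::
  "nat \<Rightarrow> (nat \<Rightarrow> real^'p \<Rightarrow> (nat \<Rightarrow> real) \<Rightarrow> real) \<Rightarrow> (nat \<Rightarrow> nat \<Rightarrow> real) \<Rightarrow> (nat \<Rightarrow> real)
     \<Rightarrow> (real \<Rightarrow> real^'p) \<Rightarrow> (real \<Rightarrow> nat \<Rightarrow> real) \<Rightarrow> (real \<Rightarrow> real)
     \<Rightarrow> (nat \<Rightarrow> nat \<Rightarrow> real) \<Rightarrow> (real \<Rightarrow> nat \<Rightarrow> nat \<Rightarrow> real) \<Rightarrow> bool" where
  "observer_solution m \<Phi> k L u wh y zh Zh \<longleftrightarrow>
     (\<forall>i\<in>{1..m}. \<forall>j\<in>{1..i}. Zh 0 i j = zh i j \<and>
        inclusion_solution (\<lambda>t. observer_rhs \<Phi> k L (u t) (wh t) (y t) (Zh t) i j)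
          (\<lambda>t. Zh t i j))"

subsection \<open>The error bound\<close>

text \<open>The supremum over \<open>1 \<le> j \<le> i - 1\<close> is over the empty set when \<open>i = 1\<close>; since \<open>Sup\<close> on
  \<open>real\<close> is unspecified there, it is dropped explicitly.\<close>

definition error_bound ::
  "(real \<Rightarrow> real) \<Rightarrow> (real \<Rightarrow> real) \<Rightarrow> (real \<Rightarrow> real \<Rightarrow> real) \<Rightarrow> (real \<Rightarrow> real)
     \<Rightarrow> (real \<Rightarrow> nat \<Rightarrow> real) \<Rightarrow> real \<Rightarrow> nat \<Rightarrow> real \<Rightarrow> real" where
  "error_bound \<gamma>1 \<gamma>2 \<beta> v \<Delta>w e0 i t =
     (let a = max (\<beta> e0 t) (SUP s\<in>{0..t}. \<gamma>1 \<bar>v s\<bar>) in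
      if i = 1 then a
      else max a (SUP (j, s)\<in>{1..i - 1} \<times> {0..t}. \<gamma>2 \<bar>\<Delta>w s j\<bar>))"

end

theory Submission
  imports Defs "HOL-Complex_Analysis.Great_Picard"
begin

text \<open>The errors of block \<open>i\<close> form a chain of integrators of order \<open>i\<close> with homogeneous injection. Its gains
  are built by recursion on the order, without a Lyapunov function: if the first gain is large, the
  first component settles fast, and from then on its injection term is a noisy measurement of the
  second component, so that the remaining components form a chain of one order less. One contraction
  of a box adapted to the weights, rescaled by homogeneity, yields input-to-state stability with
  settling in finite time. Since component \<open>j\<close> of block \<open>i > j\<close> evaluates \<open>\<Phi>\<^sub>j\<close> at the state of block \<open>j\<close>,
  the disturbance of block \<open>i\<close> is bounded by the errors of the blocks before it, and the cascade is
  treated by induction on \<open>i\<close>.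

  Each block is solved by a limit of Euler polygons. The integrals of the signs chosen along the
  polygons converge. A function with the limiting integrals is obtained as an almost everywhere limit of
  functions whose values and integrals lie between those of the tails of the sequence; hence it is
  the sign of the limiting innovation wherever the latter does not vanish.\<close>

section \<open>Signed powers and mean value estimates\<close>

text \<open>Why the order can be reduced: with \<open>p = n / (n + 1)\<close> one has
  \<open>p * ((n - j) / n) = (n - j) / (n + 1)\<close>, so the injections of the tail are exactly
  those of a chain of order \<open>n\<close> whose innovation is the injection of the first
  component. The obstacle is a circle: a fast first component tracks the second one only while the
  tail moves at bounded speed, and the tail stays bounded only while it is tracked. The circle is
  broken by fixing the speed bound \<open>M1\<close> before the gain \<open>lam\<close>, and by a
  continuation argument with a margin between the boxes of radius \<open>2 * C\<close> and
  \<open>3 * C\<close>. The last component of a block receives a disturbance that never becomes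
  small: \<open>\<Delta>w\<close>, the next state and the nonlinearity that the observer omits. The
  given bounds on state, input and \<open>\<Delta>w\<close> bound it by a constant \<open>D\<close>,
  which the discontinuous term dominates. Settling in finite time matters for the cascade, since a
  block can be restarted once the earlier ones have forgotten their initial errors. It also yields
  the class KL function, an exponential that is at least 1 until the settling time.\<close>

lemma signed_powr_minus: "signed_powr (- a) b = - signed_powr a b"
  by (simp add: signed_powr_def sgn_minus)

lemma abs_signed_powr: "\<bar>signed_powr a b\<bar> = \<bar>sgn a\<bar> * \<bar>a\<bar> powr b"
  by (simp add: signed_powr_def abs_mult)

lemma signed_powr_nonneg: "0 \<le> a \<Longrightarrow> signed_powr a b = a powr b"
  by (cases "a = 0") (simp_all add: signed_powr_def)

lemma signed_powr_mono:
  assumes "0 \<le> b" "x \<le> y"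
  shows "signed_powr x b \<le> signed_powr y b"
proof -
  consider "0 \<le> x" | "x < 0" "0 \<le> y" | "y < 0" using assms by linarith
  then show ?thesis
  proof cases
    case 1 then show ?thesis using assms by (simp add: signed_powr_nonneg powr_mono2)
  next
    case 2
    then have "signed_powr x b \<le> 0" by (simp add: signed_powr_def)
    also have "0 \<le> signed_powr y b" using 2 by (simp add: signed_powr_nonneg)
    finally show ?thesis .
  next
    case 3
    then have "(- y) powr b \<le> (- x) powr b" using assms by (intro powr_mono2) auto
    then show ?thesis using 3 assms by (simp add: signed_powr_def)
  qed
qed

lemma signed_powr_zero_right: "signed_powr a 0 = sgn a"
  by (cases "a = 0") (simp_all add: signed_powr_def)

text \<open>A form without \<open>sgn\<close>: for \<open>b > 0\<close> both summands are visibly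
  continuous.\<close>

lemma signed_powr_eq_powr_minus: "signed_powr a b = (max a 0) powr b - (max (- a) 0) powr b"
  by (cases "a = 0"; cases "a > 0") (auto simp: signed_powr_def max_def)

lemma continuous_on_signed_powr [continuous_intros]:
  assumes "continuous_on S f" "b > 0"
  shows "continuous_on S (\<lambda>x. signed_powr (f x) b)"
  unfolding signed_powr_eq_powr_minus using assms
  by (intro continuous_intros continuous_on_powr') auto

lemma sgn_in_sign_set: "sgn a \<in> sign_set a"
  by (auto simp: sign_set_def sgn_if)

lemma sign_set_abs_le: "\<sigma> \<in> sign_set a \<Longrightarrow> \<bar>\<sigma>\<bar> \<le> 1"
  by (auto simp: sign_set_def split: if_splits)

lemma sign_set_cong_sgn: "sgn a = sgn a' \<Longrightarrow> sign_set a = sign_set a'"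
  by (auto simp: sign_set_def sgn_if split: if_splits)

text \<open>The only consequence of being a solution of \<open>f' \<in> F\<close> that the stability analysis uses:
  bounds on \<open>F\<close> that hold throughout an interval bound the increment of \<open>f\<close> over it.\<close>

definition mv_solution :: "real \<Rightarrow> real \<Rightarrow> (real \<Rightarrow> real set) \<Rightarrow> (real \<Rightarrow> real) \<Rightarrow> bool" where
  "mv_solution a b F f \<longleftrightarrow> continuous_on {a..b} f \<and>
     (\<forall>s t c. a \<le> s \<and> s \<le> t \<and> t \<le> b \<longrightarrow>
        ((\<forall>r\<in>{s<..<t}. \<forall>D\<in>F r. D \<le> c) \<longrightarrow> f t - f s \<le> c * (t - s)) \<and>
        ((\<forall>r\<in>{s<..<t}. \<forall>D\<in>F r. c \<le> D) \<longrightarrow> c * (t - s) \<le> f t - f s))"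

lemma mv_solution_continuous_on: "mv_solution a b F f \<Longrightarrow> continuous_on {a..b} f"
  by (simp add: mv_solution_def)

lemma mv_solution_upper:
  "\<lbrakk>mv_solution a b F f; a \<le> s; s \<le> t; t \<le> b; \<And>r D. \<lbrakk>s < r; r < t; D \<in> F r\<rbrakk> \<Longrightarrow> D \<le> c\<rbrakk>
    \<Longrightarrow> f t - f s \<le> c * (t - s)"
  unfolding mv_solution_def by (blast dest: greaterThanLessThan_iff[THEN iffD1])

lemma mv_solution_lower:
  "\<lbrakk>mv_solution a b F f; a \<le> s; s \<le> t; t \<le> b; \<And>r D. \<lbrakk>s < r; r < t; D \<in> F r\<rbrakk> \<Longrightarrow> c \<le> D\<rbrakk>
    \<Longrightarrow> c * (t - s) \<le> f t - f s"
  unfolding mv_solution_def by (blast dest: greaterThanLessThan_iff[THEN iffD1])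

lemma mv_solution_abs_le:
  assumes "mv_solution a b F f" "a \<le> s" "s \<le> t" "t \<le> b"
    and "\<And>r D. \<lbrakk>s < r; r < t; D \<in> F r\<rbrakk> \<Longrightarrow> \<bar>D\<bar> \<le> c"
  shows "\<bar>f t - f s\<bar> \<le> c * (t - s)"
proof -
  have "f t - f s \<le> c * (t - s)"
    using assms(5) by (intro mv_solution_upper[OF assms(1-4)]) (auto simp: abs_le_iff)
  moreover have "- c * (t - s) \<le> f t - f s"
    using assms(5) by (intro mv_solution_lower[OF assms(1-4)]) (force simp: abs_le_iff)
  ultimately show ?thesis by (simp add: abs_le_iff)
qed

lemma mv_solution_subset:
  assumes "mv_solution a b F f" "a \<le> a'" "b' \<le> b"
    and "\<And>r. \<lbrakk>a' < r; r < b'\<rbrakk> \<Longrightarrow> F r \<subseteq> G r"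
  shows "mv_solution a' b' G f"
  unfolding mv_solution_def
proof (intro conjI allI impI; (elim conjE)?)
  show "continuous_on {a'..b'} f"
    using assms(1-3) by (meson atLeastatMost_subset_iff continuous_on_subset mv_solution_continuous_on)
  show "f t - f s \<le> c * (t - s)"
    if "\<forall>r\<in>{s<..<t}. \<forall>D\<in>G r. D \<le> c" "a' \<le> s" "s \<le> t" "t \<le> b'" for s t c
  proof (rule mv_solution_upper[OF assms(1)])
    show "D \<le> c" if "s < r" "r < t" "D \<in> F r" for r D
      using that \<open>\<forall>r\<in>{s<..<t}. _ r\<close> assms(4)[of r] \<open>a' \<le> s\<close> \<open>t \<le> b'\<close> by auto
  qed (use that assms(2,3) in auto)
  show "c * (t - s) \<le> f t - f s"
    if "\<forall>r\<in>{s<..<t}. \<forall>D\<in>G r. c \<le> D" "a' \<le> s" "s \<le> t" "t \<le> b'" for s t c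
  proof (rule mv_solution_lower[OF assms(1)])
    show "c \<le> D" if "s < r" "r < t" "D \<in> F r" for r D
      using that \<open>\<forall>r\<in>{s<..<t}. _ r\<close> assms(4)[of r] \<open>a' \<le> s\<close> \<open>t \<le> b'\<close> by auto
  qed (use that assms(2,3) in auto)
qed

lemma mv_solution_uminus:
  assumes "mv_solution a b F f"
  shows "mv_solution a b (\<lambda>t. uminus ` F t) (\<lambda>t. - f t)"
  unfolding mv_solution_def
proof (intro conjI allI impI; (elim conjE)?)
  show "continuous_on {a..b} (\<lambda>t. - f t)"
    using assms by (intro continuous_intros mv_solution_continuous_on)
  show "- f t - - f s \<le> c * (t - s)"
    if "\<forall>r\<in>{s<..<t}. \<forall>D\<in>uminus ` F r. D \<le> c" "a \<le> s" "s \<le> t" "t \<le> b" for s t c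
    using mv_solution_lower[OF assms that(2-4), of "-c"] that(1) by fastforce
  show "c * (t - s) \<le> - f t - - f s"
    if "\<forall>r\<in>{s<..<t}. \<forall>D\<in>uminus ` F r. c \<le> D" "a \<le> s" "s \<le> t" "t \<le> b" for s t c
    using mv_solution_upper[OF assms that(2-4), of "-c"] that(1) by fastforce
qed

text \<open>Running time \<open>R\<close> times faster and dividing the value by \<open>q\<close>
  multiplies rates by \<open>R / q\<close>, so a slope \<open>c\<close> of the new function is the
  slope \<open>c * q / R\<close> of the old one.\<close>

lemma mv_solution_rescale:
  assumes "mv_solution (R * a) (R * b) F f" "0 < R" "0 < q"
    and G: "\<And>r D. \<lbrakk>a < r; r < b; D \<in> F (R * r)\<rbrakk> \<Longrightarrow> R / q * D \<in> G r"
  shows "mv_solution a b G (\<lambda>t. f (R * t) / q)"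
  unfolding mv_solution_def
proof (intro conjI allI impI; (elim conjE)?)
  have "continuous_on {a..b} (f \<circ> (\<lambda>t. R * t))"
    using \<open>0 < R\<close> by (intro continuous_on_compose continuous_intros
        continuous_on_subset[OF mv_solution_continuous_on[OF assms(1)]]) auto
  then show "continuous_on {a..b} (\<lambda>t. f (R * t) / q)"
    using \<open>0 < q\<close> by (intro continuous_intros) (auto simp: o_def)
  have scale: "x / q - y / q \<le> c * (t - s) \<longleftrightarrow> x - y \<le> (c * q / R) * (R * t - R * s)"
    "c * (t - s) \<le> x / q - y / q \<longleftrightarrow> (c * q / R) * (R * t - R * s) \<le> x - y" for x y c t s
  proof -
    have "(c * q / R) * (R * t - R * s) = q * (c * (t - s))"
      using \<open>0 < R\<close> by (simp add: field_simps)
    moreover have "x - y = q * (x / q - y / q)" using \<open>0 < q\<close> by (simp add: field_simps)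
    ultimately show "x / q - y / q \<le> c * (t - s) \<longleftrightarrow> x - y \<le> (c * q / R) * (R * t - R * s)"
      "c * (t - s) \<le> x / q - y / q \<longleftrightarrow> (c * q / R) * (R * t - R * s) \<le> x - y"
      using \<open>0 < q\<close> by (simp_all only: mult_le_cancel_left_pos)
  qed
  have in_range: "s < r / R" "r / R < t" if "R * s < r" "r < R * t" for r s t
    using that \<open>0 < R\<close> by (auto simp: field_simps)
  show "f (R * t) / q - f (R * s) / q \<le> c * (t - s)"
    if c: "\<forall>r\<in>{s<..<t}. \<forall>D\<in>G r. D \<le> c"
      and st: "a \<le> s" "s \<le> t" "t \<le> b" for s t c
  proof -
    have "f (R * t) - f (R * s) \<le> (c * q / R) * (R * t - R * s)"
    proof (rule mv_solution_upper[OF assms(1)])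
      fix r D assume r: "R * s < r" "r < R * t" "D \<in> F r"
      then have "R / q * D \<in> G (r / R)"
        using in_range[OF r(1,2)] st \<open>0 < R\<close> by (intro G) auto
      then have "R / q * D \<le> c" using c in_range[OF r(1,2)] by auto
      then show "D \<le> c * q / R" using \<open>0 < R\<close> \<open>0 < q\<close> by (simp add: field_simps)
    qed (use st \<open>0 < R\<close> in auto)
    then show ?thesis using scale(1) by blast
  qed
  show "c * (t - s) \<le> f (R * t) / q - f (R * s) / q"
    if c: "\<forall>r\<in>{s<..<t}. \<forall>D\<in>G r. c \<le> D"
      and st: "a \<le> s" "s \<le> t" "t \<le> b" for s t c
  proof -
    have "(c * q / R) * (R * t - R * s) \<le> f (R * t) - f (R * s)"
    proof (rule mv_solution_lower[OF assms(1)])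
      fix r D assume r: "R * s < r" "r < R * t" "D \<in> F r"
      then have "R / q * D \<in> G (r / R)"
        using in_range[OF r(1,2)] st \<open>0 < R\<close> by (intro G) auto
      then have "c \<le> R / q * D" using c in_range[OF r(1,2)] by auto
      then show "c * q / R \<le> D" using \<open>0 < R\<close> \<open>0 < q\<close> by (simp add: field_simps)
    qed (use st \<open>0 < R\<close> in auto)
    then show ?thesis using scale(2) by blast
  qed
qed

text \<open>If \<open>f\<close> stays above \<open>B\<close>, it falls at rate \<open>c\<close> all
  along. Otherwise consider the last time at which it is at most \<open>B\<close>: from then on it
  is above \<open>B\<close> and cannot rise.\<close>

lemma mv_solution_barrier:
  assumes mv: "mv_solution a b F f" and st: "a \<le> s" "s \<le> t" "t \<le> b" and "0 \<le> c"
    and rate: "\<And>r D. \<lbrakk>s < r; r < t; B < f r; D \<in> F r\<rbrakk> \<Longrightarrow> D \<le> - c"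
  shows "f t \<le> max B (f s - c * (t - s))"
proof (cases "\<exists>r\<in>{s..t}. f r \<le> B")
  case False
  then have "f t - f s \<le> - c * (t - s)"
    using st by (intro mv_solution_upper[OF mv] rate) (auto simp: not_le)
  then show ?thesis by simp
next
  case True
  define S where "S = {s..t} \<inter> f -` {..B}"
  have "continuous_on {s..t} f"
    by (rule continuous_on_subset[OF mv_solution_continuous_on[OF mv]]) (use st in auto)
  then have "closed S"
    unfolding S_def by (rule continuous_closed_preimage) auto
  then have "compact S"
    by (metis S_def compact_Icc compact_Int_closed inf.absorb2 inf_commute inf_le1)
  moreover have "S \<noteq> {}" using True by (auto simp: S_def)
  ultimately obtain u where u: "u \<in> S" "\<And>r. r \<in> S \<Longrightarrow> r \<le> u"
    using compact_attains_sup by metis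
  have "B < f r" if "u < r" "r < t" for r
    using that u(1) u(2)[of r] unfolding S_def by (cases "f r \<le> B") auto
  then have "f t - f u \<le> - c * (t - u)"
    using st u(1) unfolding S_def by (intro mv_solution_upper[OF mv] rate) auto
  also have "\<dots> \<le> 0" using \<open>0 \<le> c\<close> u(1) unfolding S_def
    by (auto intro: mult_nonneg_nonneg)
  finally show ?thesis using u(1) unfolding S_def by auto
qed

section \<open>Homogeneous chains\<close>

text \<open>The innovation \<open>a\<close> is kept separate from the first error: it may differ from \<open>e 1\<close> by the
  measurement noise, and for the tail of a longer chain it is inherited from that chain.\<close>

definition chain_rhs ::
  "nat \<Rightarrow> (nat \<Rightarrow> real) \<Rightarrow> real \<Rightarrow> real \<Rightarrow> (nat \<Rightarrow> real) \<Rightarrow> (nat \<Rightarrow> real) \<Rightarrow> nat \<Rightarrow> real set" where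
  "chain_rhs n k D a d e j =
     (if j < n then {e (Suc j) + d j - k j * signed_powr a ((real n - real j) / real n)}
      else {\<delta> - k j * \<sigma> | \<delta> \<sigma>. \<bar>\<delta>\<bar> \<le> D \<and> \<sigma> \<in> sign_set a})"

definition chain_solution ::
  "nat \<Rightarrow> (nat \<Rightarrow> real) \<Rightarrow> real \<Rightarrow> real \<Rightarrow> real \<Rightarrow> (real \<Rightarrow> real) \<Rightarrow> (real \<Rightarrow> nat \<Rightarrow> real)
     \<Rightarrow> (real \<Rightarrow> nat \<Rightarrow> real) \<Rightarrow> bool" where
  "chain_solution n k D s t a d e \<longleftrightarrow>
     (\<forall>j\<in>{1..n}. mv_solution s t (\<lambda>r. chain_rhs n k D (a r) (d r) (e r) j) (\<lambda>r. e r j))"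

text \<open>The ball of radius \<open>R\<close> for the homogeneous norm that takes the maximum over
  \<open>j\<close> of \<open>(\<bar>x j\<bar> / b j) powr (1 / (n + 1 - j))\<close>.\<close>

definition hbox :: "nat \<Rightarrow> (nat \<Rightarrow> real) \<Rightarrow> real \<Rightarrow> (nat \<Rightarrow> real) \<Rightarrow> bool" where
  "hbox n b R x \<longleftrightarrow> (\<forall>j\<in>{1..n}. \<bar>x j\<bar> \<le> b j * R ^ (Suc n - j))"

text \<open>Measurement noise scales like \<open>e 1\<close>, and \<open>d j\<close> like the rate
  of \<open>e j\<close>, that is like \<open>e (j + 1)\<close>. There is no entry for
  \<open>j = n\<close>: the disturbance of the last component is bounded by \<open>D\<close>, not
  small, and is left to the sign term.\<close>

definition disturbance_le ::
  "nat \<Rightarrow> real \<Rightarrow> real \<Rightarrow> real \<Rightarrow> (nat \<Rightarrow> real) \<Rightarrow> (nat \<Rightarrow> real) \<Rightarrow> bool" where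
  "disturbance_le n \<eta> R a d e \<longleftrightarrow>
     \<bar>a - e 1\<bar> \<le> \<eta> * R ^ n \<and> (\<forall>j\<in>{1..<n}. \<bar>d j\<bar> \<le> \<eta> * R ^ (n - j))"

text \<open>A field of degree -1 makes time scale like \<open>R\<close>, hence the window of length
  \<open>R * T\<close>. Windows for the radii \<open>R\<close>, \<open>R / 2\<close>,
  \<open>R / 4\<close> and so on have total length \<open>2 * R * T\<close>, which is where the
  finite settling time comes from.\<close>

definition contracts ::
  "nat \<Rightarrow> (nat \<Rightarrow> real) \<Rightarrow> real \<Rightarrow> (nat \<Rightarrow> real) \<Rightarrow> real \<Rightarrow> real \<Rightarrow> real \<Rightarrow> real \<Rightarrow> bool" where
  "contracts n k D b T \<eta> C R \<longleftrightarrow>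
     (\<forall>s t a d e. s \<le> t \<and> t \<le> s + R * T \<and> chain_solution n k D s t a d e \<and>
        (\<forall>r\<in>{s..t}. disturbance_le n \<eta> R (a r) (d r) (e r)) \<and> hbox n b R (e s) \<longrightarrow>
        hbox n b (C * R) (e t) \<and> (t = s + R * T \<longrightarrow> hbox n b (R / 2) (e t)))"

lemma chain_solution_subset:
  assumes "chain_solution n k D s t a d e" "s \<le> s'" "t' \<le> t"
  shows "chain_solution n k D s' t' a d e"
  using assms unfolding chain_solution_def by (auto intro: mv_solution_subset)

lemma hbox_mono:
  assumes "hbox n b R x" "0 \<le> R" "R \<le> R'" "\<And>j. j \<in> {1..n} \<Longrightarrow> 0 \<le> b j"
  shows "hbox n b R' x"
  unfolding hbox_def
proof
  fix j assume j: "j \<in> {1..n}"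
  then have "\<bar>x j\<bar> \<le> b j * R ^ (Suc n - j)" using assms(1) by (simp add: hbox_def)
  also have "\<dots> \<le> b j * R' ^ (Suc n - j)"
    using assms j by (intro mult_left_mono power_mono) auto
  finally show "\<bar>x j\<bar> \<le> b j * R' ^ (Suc n - j)" .
qed

section \<open>Homogeneity of chains and of the contraction property\<close>

lemma signed_powr_mult:
  assumes "0 \<le> c"
  shows "signed_powr (c * a) p = c powr p * signed_powr a p"
  using assms by (cases "c = 0") (auto simp: signed_powr_def sgn_mult abs_mult powr_mult)

lemma signed_powr_signed_powr:
  "signed_powr (signed_powr a p) q = signed_powr a (p * q)"
  by (cases "a = 0") (auto simp: signed_powr_def sgn_mult abs_mult powr_powr)

lemma sgn_signed_powr: "sgn (signed_powr a p) = sgn a"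
  by (cases "a = 0") (auto simp: signed_powr_def sgn_mult)

lemma signed_powr_divide_power:
  assumes "0 < R" "j < n"
  shows "signed_powr (a / R ^ n) ((real n - real j) / real n)
    = signed_powr a ((real n - real j) / real n) / R ^ (n - j)"
proof -
  have "(R ^ n) powr ((real n - real j) / real n) = R ^ (n - j)"
    using assms by (simp add: powr_realpow[symmetric] powr_powr of_nat_diff)
  then show ?thesis
    using signed_powr_mult[of "1 / R ^ n" a "(real n - real j) / real n"] \<open>0 < R\<close>
    by (simp add: powr_divide powr_one_eq_one)
qed

text \<open>The homogeneity of the chain: component \<open>j\<close> has weight \<open>n + 1 - j\<close> and the field has
  degree \<open>-1\<close>.\<close>

lemma chain_solution_rescale:
  assumes sol: "chain_solution n k D (R * s) (R * t) a d e" and "0 < R"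
  shows "chain_solution n k D s t (\<lambda>r. a (R * r) / R ^ n) (\<lambda>r j. d (R * r) j / R ^ (n - j))
    (\<lambda>r j. e (R * r) j / R ^ (Suc n - j))"
  unfolding chain_solution_def
proof
  fix j assume j: "j \<in> {1..n}"
  show "mv_solution s t
     (\<lambda>r. chain_rhs n k D (a (R * r) / R ^ n) (\<lambda>j. d (R * r) j / R ^ (n - j))
       (\<lambda>j. e (R * r) j / R ^ (Suc n - j)) j) (\<lambda>r. e (R * r) j / R ^ (Suc n - j))"
  proof (rule mv_solution_rescale)
    show "mv_solution (R * s) (R * t) (\<lambda>r. chain_rhs n k D (a r) (d r) (e r) j) (\<lambda>r. e r j)"
      using sol j by (simp add: chain_solution_def)
    fix r E assume E: "E \<in> chain_rhs n k D (a (R * r)) (d (R * r)) (e (R * r)) j"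
    show "R / R ^ (Suc n - j) * E \<in> chain_rhs n k D (a (R * r) / R ^ n)
        (\<lambda>j. d (R * r) j / R ^ (n - j)) (\<lambda>j. e (R * r) j / R ^ (Suc n - j)) j"
    proof (cases "j < n")
      case True
      then have "Suc n - j = Suc (n - j)" by simp
      then show ?thesis
        using E True signed_powr_divide_power[OF \<open>0 < R\<close> True, of "a (R * r)"] \<open>0 < R\<close>
        by (simp add: chain_rhs_def field_simps)
    next
      case False
      \<comment> \<open>The last component has weight 1, so its rate is scale free: \<open>D\<close>
        is left unchanged, and the sign term sees only the sign of the innovation.\<close>
      then have "Suc n - j = 1" using j by auto
      moreover have "sign_set (a (R * r) / R ^ n) = sign_set (a (R * r))"
        using \<open>0 < R\<close> by (intro sign_set_cong_sgn) (simp add: sgn_divide)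
      ultimately show ?thesis
        using E False \<open>0 < R\<close> by (simp add: chain_rhs_def)
    qed
  qed (use \<open>0 < R\<close> in auto)
qed

lemma contracts_rescale:
  assumes c: "contracts n k D b T \<eta> C 1" and "0 < R" "1 \<le> n"
  shows "contracts n k D b T \<eta> C R"
  unfolding contracts_def
proof (intro allI impI, elim conjE)
  fix s t a d e
  assume st: "s \<le> t" "t \<le> s + R * T" and sol: "chain_solution n k D s t a d e"
    and dist: "\<forall>r\<in>{s..t}. disturbance_le n \<eta> R (a r) (d r) (e r)"
      and init: "hbox n b R (e s)"
  define a' where "a' r = a (R * r) / R ^ n" for r
  define d' where "d' r j = d (R * r) j / R ^ (n - j)" for r j
  define e' where "e' r j = e (R * r) j / R ^ (Suc n - j)" for r j
  have hbox_e': "hbox n b Q (e' (r / R)) \<longleftrightarrow> hbox n b (Q * R) (e r)" for Q r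
    unfolding hbox_def e'_def using \<open>0 < R\<close>
    by (simp add: power_mult_distrib abs_divide field_simps)
  have "chain_solution n k D (s / R) (t / R) a' d' e'"
    unfolding a'_def d'_def e'_def using \<open>0 < R\<close> sol by (intro chain_solution_rescale) auto
  moreover have "\<forall>r\<in>{s / R..t / R}. disturbance_le n \<eta> 1 (a' r) (d' r) (e' r)"
  proof
    fix r assume r: "r \<in> {s / R..t / R}"
    have "R * r \<in> {s..t}"
      using r \<open>0 < R\<close> by (auto simp: field_simps)
    then have *: "disturbance_le n \<eta> R (a (R * r)) (d (R * r)) (e (R * r))" using dist by blast
    have "a' r - e' r 1 = (a (R * r) - e (R * r) 1) / R ^ n"
      by (simp add: a'_def e'_def diff_divide_distrib)
    then have "\<bar>a' r - e' r 1\<bar> \<le> \<eta>"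
      using * \<open>0 < R\<close> by (simp add: disturbance_le_def pos_divide_le_eq)
    then show "disturbance_le n \<eta> 1 (a' r) (d' r) (e' r)"
      using * \<open>0 < R\<close> by (simp add: disturbance_le_def d'_def abs_divide field_simps)
  qed
  moreover have "hbox n b 1 (e' (s / R))" using init by (simp add: hbox_e')
  moreover have "s / R \<le> t / R" "t / R \<le> s / R + 1 * T"
    using st \<open>0 < R\<close> by (auto simp: field_simps)
  ultimately have *: "hbox n b (C * 1) (e' (t / R))"
      "t / R = s / R + 1 * T \<Longrightarrow> hbox n b (1 / 2) (e' (t / R))"
    using c unfolding contracts_def by blast+
  show "hbox n b (C * R) (e t) \<and> (t = s + R * T \<longrightarrow> hbox n b (R / 2) (e t))"
  proof (intro conjI impI)
    show "hbox n b (C * R) (e t)" using *(1) by (simp add: hbox_e')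
    assume "t = s + R * T"
    then have "t / R = s / R + 1 * T" using \<open>0 < R\<close> by (simp add: field_simps)
    then show "hbox n b (R / 2) (e t)" using *(2) hbox_e'[of "1 / 2" t] by simp
  qed
qed

text \<open>The gain \<open>D + 1\<close> beats the disturbance by 1. Outside the noise band of half
  width 1/2 the innovation has the sign of the error, so the error shrinks at rate at least 1 and
  one unit of time is more than enough to get from 1 to 1/2.\<close>

lemma contracts_base:
  assumes "0 \<le> D"
  shows "contracts 1 (\<lambda>_. D + 1) D (\<lambda>_. 1) 1 (1/2) 1 1"
  unfolding contracts_def
proof (intro allI impI, elim conjE)
  fix s t a d e
  assume st: "s \<le> t" "t \<le> s + 1 * 1" and sol: "chain_solution 1 (\<lambda>_. D + 1) D s t a d e"
    and dist: "\<forall>r\<in>{s..t}. disturbance_le 1 (1/2) 1 (a r) (d r) (e r)"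
    and init: "hbox 1 (\<lambda>_. 1) 1 (e s)"
  have mv: "mv_solution s t (\<lambda>r. chain_rhs 1 (\<lambda>_. D + 1) D (a r) (d r) (e r) 1) (\<lambda>r. e r 1)"
    using sol by (simp add: chain_solution_def)
  have a: "\<bar>a r - e r 1\<bar> \<le> 1/2" if "s \<le> r" "r \<le> t" for r
    using dist that by (simp add: disturbance_le_def)
  have "e t 1 \<le> max (1/2) (e s 1 - 1 * (t - s))"
  proof (rule mv_solution_barrier[OF mv])
    fix r E assume r: "s < r" "r < t" "1/2 < e r 1"
      and E: "E \<in> chain_rhs 1 (\<lambda>_. D + 1) D (a r) (d r) (e r) 1"
    have "0 < a r" using a[of r] r by linarith
    then show "E \<le> - 1" using E by (auto simp: chain_rhs_def sign_set_def)
  qed (use st in auto)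
  moreover have "- e t 1 \<le> max (1/2) (- e s 1 - 1 * (t - s))"
  proof (rule mv_solution_barrier[OF mv_solution_uminus[OF mv]])
    fix r E assume r: "s < r" "r < t" "1/2 < - e r 1"
      and E: "E \<in> uminus ` chain_rhs 1 (\<lambda>_. D + 1) D (a r) (d r) (e r) 1"
    have "a r < 0" using a[of r] r by linarith
    then show "E \<le> - 1" using E by (auto simp: chain_rhs_def sign_set_def)
  qed (use st in auto)
  ultimately show "hbox 1 (\<lambda>_. 1) (1 * 1) (e t) \<and>
      (t = s + 1 * 1 \<longrightarrow> hbox 1 (\<lambda>_. 1) (1 / 2) (e t))"
    using init st by (auto simp: hbox_def)
qed

text \<open>Induction along an interval, used as a continuation argument. The infimum of the failing
  points is not itself failing by \<open>closed\<close>, and is not approached by failing points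
  from the right by \<open>opened\<close>.\<close>

lemma real_induct_Icc:
  fixes s t :: real
  assumes "P s"
    and closed: "\<And>u. \<lbrakk>s < u; u \<le> t; \<And>r. \<lbrakk>s \<le> r; r < u\<rbrakk> \<Longrightarrow> P r\<rbrakk> \<Longrightarrow> P u"
    and opened: "\<And>u. \<lbrakk>s \<le> u; u < t; \<And>r. \<lbrakk>s \<le> r; r \<le> u\<rbrakk> \<Longrightarrow> P r\<rbrakk>
      \<Longrightarrow> \<exists>\<delta>>0. \<forall>r. u < r \<and> r < u + \<delta> \<and> r \<le> t \<longrightarrow> P r"
    and "s \<le> u" "u \<le> t"
  shows "P u"
proof (rule ccontr)
  assume "\<not> P u"
  define S where "S = {r. s \<le> r \<and> r \<le> t \<and> \<not> P r}"
  define \<tau> where "\<tau> = Inf S"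
  have "u \<in> S" using \<open>\<not> P u\<close> assms by (simp add: S_def)
  have bdd: "bdd_below S" unfolding S_def by (intro bdd_belowI[of _ s]) auto
  have "s \<le> \<tau>" unfolding \<tau>_def using \<open>u \<in> S\<close>
    by (intro cInf_greatest) (auto simp: S_def)
  have "\<tau> \<le> u" unfolding \<tau>_def using \<open>u \<in> S\<close> bdd by (rule cInf_lower)
  have before: "P r" if "s \<le> r" "r < \<tau>" for r
  proof (rule ccontr)
    assume "\<not> P r"
    then have "r \<in> S" using that \<open>\<tau> \<le> u\<close> \<open>u \<le> t\<close>
      by (simp add: S_def)
    then show False using cInf_lower[OF _ bdd, of r] that by (simp add: \<tau>_def)
  qed
  have "P \<tau>"
  proof (cases "\<tau> = s")
    case False
    then show ?thesis using closed[of \<tau>] before \<open>s \<le> \<tau>\<close> \<open>\<tau> \<le> u\<close> \<open>u \<le> t\<close> by auto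
  qed (use \<open>P s\<close> in simp)
  then have "\<tau> < t"
    using \<open>\<tau> \<le> u\<close> \<open>u \<le> t\<close> \<open>\<not> P u\<close>
    by (cases "\<tau> = t") auto
  have "P r" if "s \<le> r" "r \<le> \<tau>" for r
    using before[of r] \<open>P \<tau>\<close> that by (cases "r = \<tau>") auto
  then obtain \<delta> where \<delta>: "\<delta> > 0" "\<And>r. \<lbrakk>\<tau> < r; r < \<tau> + \<delta>; r \<le> t\<rbrakk> \<Longrightarrow> P r"
    using opened[of \<tau>] \<open>s \<le> \<tau>\<close> \<open>\<tau> < t\<close> by metis
  have "\<tau> + \<delta> \<le> \<tau>" unfolding \<tau>_def
  proof (rule cInf_greatest)
    show "S \<noteq> {}" using \<open>u \<in> S\<close> by blast
    fix r assume r: "r \<in> S"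
    then have "\<tau> \<le> r" using bdd unfolding \<tau>_def by (intro cInf_lower)
    show "Inf S + \<delta> \<le> r"
    proof (rule ccontr)
      assume "\<not> Inf S + \<delta> \<le> r"
      then have "P r"
        using \<delta>(2)[of r] \<open>P \<tau>\<close> \<open>\<tau> \<le> r\<close> r
          by (cases "r = \<tau>") (auto simp: S_def \<tau>_def)
      then show False using r by (simp add: S_def)
    qed
  qed
  then show False using \<open>\<delta> > 0\<close> by simp
qed

text \<open>A chain of order \<open>n + 1\<close> whose first gain \<open>lam\<close> is large: \<open>e 1\<close> settles quickly, after
  which \<open>phi (a r)\<close> is a noisy measurement of \<open>e 2\<close>, so that \<open>e 2, \<dots>, e (n + 1)\<close> form a chain of
  order \<open>n\<close> with innovation exactly \<open>phi (a r)\<close>.\<close>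

locale high_gain_chain =
  fixes n :: nat and k b :: "nat \<Rightarrow> real"
    and D T \<eta> C h M M1 \<epsilon> \<beta> \<eta>1 :: real
    and p lam :: real and phi :: "real \<Rightarrow> real" and \<kappa> b1 :: "nat \<Rightarrow> real"
  assumes p_def: "p = real n / real (Suc n)"
    and lam_def: "lam = (M + 1) / \<beta> powr p"
    and phi_def: "phi = (\<lambda>x. lam * signed_powr x p)"
    and \<kappa>_def: "\<kappa> = (\<lambda>j. if j = 1 then lam
                   else k (j - 1) * lam powr ((real (Suc n) - real j) / real n))"
    and b1_def: "b1 = (\<lambda>j. if j = 1 then 2 * \<beta> else b (j - 1))"
    and n: "1 \<le> n" and b: "\<And>j. j \<in> {1..n} \<Longrightarrow> 0 < b j"
    and T: "0 < T" and C: "1 \<le> C"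
    and contr: "\<And>R. 0 < R \<Longrightarrow> contracts n k D b T \<eta> C R"
    and \<epsilon>: "0 < \<epsilon>" "\<epsilon> \<le> \<eta>" "\<epsilon> \<le> 1 / 2 ^ n"
    and M: "0 \<le> M" "\<And>x j. \<lbrakk>hbox n b (3 * C) x; j \<in> {1..n}\<rbrakk> \<Longrightarrow> \<bar>x j\<bar> \<le> M"
    and M1: "0 \<le> M1" "\<And>a d x j E. \<lbrakk>\<bar>a\<bar> \<le> 3 * (M + 1); \<And>i. i \<in> {1..<n} \<Longrightarrow> \<bar>d i\<bar> \<le> 1;
        hbox n b (3 * C) x; j \<in> {1..n}; E \<in> chain_rhs n k D a d x j\<rbrakk> \<Longrightarrow> \<bar>E\<bar> \<le> M1"
    and h: "0 < h" "M1 * h \<le> \<epsilon> / 8" "\<And>j. j \<in> {1..n} \<Longrightarrow> M1 * h \<le> b j"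
    and \<beta>: "0 < \<beta>" "16 * \<beta> = h * \<epsilon>"
    and \<eta>1: "0 < \<eta>1" "\<eta>1 \<le> \<epsilon> / 8" "\<eta>1 \<le> \<beta> / 2 ^ Suc n"
      "\<And>x y. \<lbrakk>\<bar>x\<bar> \<le> 4 * \<beta>; \<bar>y\<bar> \<le> 4 * \<beta>; \<bar>x - y\<bar> \<le> 3 * \<eta>1\<rbrakk> \<Longrightarrow> \<bar>phi x - phi y\<bar> \<le> \<epsilon> / 4"
begin

section \<open>Calibration of the first injection\<close>

lemma p: "0 < p" "p \<le> 1"
  using n by (simp_all add: p_def)

lemma lam_pos: "0 < lam"
  using M \<beta> by (simp add: lam_def)

lemma phi_minus: "phi (- x) = - phi x"
  by (simp add: phi_def signed_powr_minus)

lemma phi_mono: "x \<le> y \<Longrightarrow> phi x \<le> phi y"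
  unfolding phi_def using p lam_pos by (intro mult_left_mono signed_powr_mono) auto

text \<open>The normalisation behind \<open>lam\<close>: at distance \<open>\<beta>\<close> the
  injection exceeds by 1 the largest value \<open>M\<close> that the second error can take.\<close>

lemma phi_\<beta>: "phi \<beta> = M + 1"
  using \<beta> by (simp add: phi_def lam_def signed_powr_nonneg)

lemma \<epsilon>1: "\<epsilon> \<le> 1"
  by (rule order_trans[OF \<epsilon>(3)]) simp

lemma \<eta>1_le: "\<eta>1 \<le> \<beta>" "\<eta>1 \<le> 1" "\<eta>1 \<le> \<eta>"
proof -
  have "(1::real) \<le> 2 ^ Suc n" by (rule one_le_power) simp
  then have "\<beta> / 2 ^ Suc n \<le> \<beta> / 1" using \<beta> by (intro divide_left_mono) auto
  then show "\<eta>1 \<le> \<beta>" using \<eta>1 by simp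
qed (use \<epsilon> \<epsilon>1 \<eta>1 in linarith)+

text \<open>The bound does not involve \<open>lam\<close>, because an exponent at most 1 turns the
  factor 3 into at most 3. This is why the speed bound \<open>M1\<close> of the tail can be fixed
  before the gain.\<close>

lemma phi_3\<beta>: "phi (3 * \<beta>) \<le> 3 * (M + 1)"
proof -
  have "(3::real) powr p \<le> 3 powr 1" using p by (intro powr_mono) auto
  then have "(3 * \<beta>) powr p \<le> 3 * \<beta> powr p" using \<beta> by (simp add: powr_mult)
  then have "lam * (3 * \<beta>) powr p \<le> lam * (3 * \<beta> powr p)" using lam_pos by simp
  then show ?thesis using \<beta> by (simp add: phi_def lam_def signed_powr_nonneg)
qed

lemma phi_bound: "\<bar>x\<bar> \<le> 3 * \<beta> \<Longrightarrow> \<bar>phi x\<bar> \<le> 3 * (M + 1)"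
  using phi_mono[of x "3 * \<beta>"] phi_mono[of "- x" "3 * \<beta>"] phi_3\<beta>
  by (simp add: phi_minus abs_le_iff)

text \<open>Since \<open>2 ^ (n + 1)\<close> raised to the power \<open>p\<close> is
  \<open>2 ^ n\<close>, halving the scale of the second error (weight \<open>n\<close>) matches
  halving the scale of the first one (weight \<open>n + 1\<close>).\<close>

lemma phi_small:
  assumes "\<bar>phi x\<bar> \<le> (M + 1) / 2 ^ n"
  shows "\<bar>x\<bar> \<le> \<beta> / 2 ^ Suc n"
proof (rule ccontr)
  assume "\<not> \<bar>x\<bar> \<le> \<beta> / 2 ^ Suc n"
  then have "(\<beta> / 2 ^ Suc n) powr p < \<bar>x\<bar> powr p" using \<beta> p
    by (intro powr_less_mono2) auto
  moreover have "((2::real) ^ Suc n) powr p = 2 ^ n"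
    unfolding p_def by (subst (1 2) powr_realpow[symmetric]) (auto simp: powr_powr)
  ultimately have "\<beta> powr p / 2 ^ n < \<bar>x\<bar> powr p"
    using \<beta> by (simp add: powr_divide)
  then have "lam * (\<beta> powr p / 2 ^ n) < lam * \<bar>x\<bar> powr p"
    using lam_pos by (rule mult_strict_left_mono)
  moreover have "\<bar>phi x\<bar> = lam * \<bar>x\<bar> powr p"
    using lam_pos by (cases "x = 0") (auto simp: phi_def abs_mult abs_signed_powr)
  ultimately show False using assms \<beta> by (simp add: lam_def)
qed

text \<open>The exponents compose as \<open>p * ((n - j) / n) = (n - j) / (n + 1)\<close>, and the
  power of \<open>lam\<close> produced on the way is the one built into \<open>\<kappa>\<close>. In
  the last component \<open>phi\<close> preserves the sign and the power of \<open>lam\<close> is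
  1.\<close>

lemma subchain_rhs:
  assumes "j \<in> {1..n}"
  shows "chain_rhs (Suc n) \<kappa> D a d e (Suc j)
    = chain_rhs n k D (phi a) (\<lambda>j. d (Suc j)) (\<lambda>j. e (Suc j)) j"
proof (cases "j < n")
  case True
  have "p * ((real n - real j) / real n) = (real n - real j) / real (Suc n)"
    using n by (simp add: p_def del: of_nat_Suc)
  then have "signed_powr (phi a) ((real n - real j) / real n)
      = lam powr ((real n - real j) / real n) * signed_powr a ((real n - real j) / real (Suc n))"
    using lam_pos by (simp add: phi_def signed_powr_mult signed_powr_signed_powr)
  then show ?thesis using True assms by (simp add: chain_rhs_def \<kappa>_def)
next
  case False
  then have "j = n" using assms by simp
  moreover have "sgn (phi a) = sgn a"
    using lam_pos by (simp add: phi_def sgn_mult sgn_signed_powr)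
  then have "sign_set (phi a) = sign_set a" by (rule sign_set_cong_sgn)
  ultimately show ?thesis using n lam_pos by (simp add: chain_rhs_def \<kappa>_def)
qed

text \<open>Tracking, upper side: were \<open>phi (a t)\<close> larger than \<open>x2 t + \<epsilon>\<close>, then going back from \<open>t\<close> to
  \<open>t - h\<close> would increase \<open>x1\<close> beyond its bound.\<close>

lemma tracking_upper:
  assumes mv: "mv_solution s t (\<lambda>r. {x2 r + d r - phi (a r)}) x1" and st: "s + h \<le> t"
    and a: "\<And>r. \<lbrakk>s \<le> r; r \<le> t\<rbrakk> \<Longrightarrow> \<bar>a r - x1 r\<bar> \<le> \<eta>1"
    and d: "\<And>r. \<lbrakk>s \<le> r; r \<le> t\<rbrakk> \<Longrightarrow> \<bar>d r\<bar> \<le> \<eta>1"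
    and x1: "\<And>r. \<lbrakk>s \<le> r; r \<le> t\<rbrakk> \<Longrightarrow> \<bar>x1 r\<bar> \<le> 2 * \<beta>"
    and x2: "\<And>r. \<lbrakk>s \<le> r; r \<le> t\<rbrakk> \<Longrightarrow> \<bar>x2 r\<bar> \<le> M"
    and lip: "\<And>r. \<lbrakk>s \<le> r; r \<le> t\<rbrakk> \<Longrightarrow> \<bar>x2 t - x2 r\<bar> \<le> M1 * (t - r)"
  shows "phi (a t) \<le> x2 t + \<epsilon>"
proof (rule ccontr)
  assume "\<not> phi (a t) \<le> x2 t + \<epsilon>"
  then have big: "phi (a t) > x2 t + \<epsilon>" by simp
  have st': "s \<le> t - h" "t - h \<le> t" using st h by auto
  \<comment> \<open>Wherever \<open>x1 r\<close> exceeds \<open>x1 t - \<eta>1\<close>, the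
    innovation is above \<open>x1 t - 2 * \<eta>1\<close>, so \<open>phi (a r)\<close> falls short
    of \<open>phi (a t)\<close> by at most \<open>\<epsilon> / 4\<close>. Of the excess
    \<open>\<epsilon>\<close>, the drift of \<open>x2\<close> and the disturbance take
    \<open>\<epsilon> / 8\<close> each, so that \<open>x1\<close> decreases at rate at least
    \<open>\<epsilon> / 4\<close>. Since \<open>x1 t\<close> lies above its own barrier, only the
    second entry of the maximum remains.\<close>
  have "x1 t \<le> max (x1 t - \<eta>1) (x1 (t - h) - \<epsilon> / 4 * (t - (t - h)))"
  proof (rule mv_solution_barrier[OF mv])
    fix r E assume r: "t - h < r" "r < t" "x1 t - \<eta>1 < x1 r" and E: "E \<in> {x2 r + d r - phi (a r)}"
    have sr: "s \<le> r" "r \<le> t" using r st' by auto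
    have "\<bar>x1 t\<bar> \<le> 2 * \<beta>" using x1[of t] st' by auto
    have "a t \<le> x1 t + \<eta>1" using a[of t] st' by (auto simp: abs_le_iff)
    then have "phi (a t) \<le> phi (x1 t + \<eta>1)" by (rule phi_mono)
    also have "\<bar>phi (x1 t + \<eta>1) - phi (x1 t - 2 * \<eta>1)\<bar> \<le> \<epsilon> / 4"
      using \<open>\<bar>x1 t\<bar> \<le> 2 * \<beta>\<close> \<eta>1_le \<eta>1 by (intro \<eta>1(4)) auto
    then have "phi (x1 t + \<eta>1) \<le> phi (x1 t - 2 * \<eta>1) + \<epsilon> / 4" by linarith
    also have "phi (x1 t - 2 * \<eta>1) \<le> phi (a r)"
      using a[OF sr] r by (intro phi_mono) linarith
    finally have "phi (a r) > x2 t + \<epsilon> - \<epsilon> / 4" using big by linarith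
    moreover have "x2 r \<le> x2 t + \<epsilon> / 8"
    proof -
      have "M1 * (t - r) \<le> M1 * h" using r M1 by (intro mult_left_mono) auto
      then show ?thesis using lip[OF sr] h by linarith
    qed
    ultimately show "E \<le> - (\<epsilon> / 4)" using E d[OF sr] \<eta>1 by auto
  qed (use st' \<epsilon> in auto)
  then have "x1 t \<le> x1 (t - h) - \<epsilon> / 4 * h" using \<eta>1 by auto
  \<comment> \<open>Origin of \<open>16 * \<beta> = h * \<epsilon>\<close>: the loss over the time
    \<open>h\<close> is the whole range of \<open>x1\<close>, from \<open>2 * \<beta>\<close> down
    to \<open>- 2 * \<beta>\<close>. At the lower end \<open>phi (a t)\<close> is at most
    \<open>- (M + 1)\<close>, which contradicts \<open>big\<close>.\<close>
  also have "\<epsilon> / 4 * h = 4 * \<beta>" using \<beta> by simp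
  also have "x1 (t - h) \<le> 2 * \<beta>" using x1[OF st'] by auto
  finally have "x1 t \<le> - 2 * \<beta>" by simp
  then have "a t \<le> - \<beta>" using a[of t] st' \<eta>1_le by auto
  then have "phi (a t) \<le> - (M + 1)" using phi_mono[of "a t" "- \<beta>"]
    by (simp add: phi_minus phi_\<beta>)
  then show False using big x2[of t] st' \<epsilon> by auto
qed

lemma tracking:
  assumes mv: "mv_solution s t (\<lambda>r. {x2 r + d r - phi (a r)}) x1" and st: "s + h \<le> t"
    and a: "\<And>r. \<lbrakk>s \<le> r; r \<le> t\<rbrakk> \<Longrightarrow> \<bar>a r - x1 r\<bar> \<le> \<eta>1"
    and d: "\<And>r. \<lbrakk>s \<le> r; r \<le> t\<rbrakk> \<Longrightarrow> \<bar>d r\<bar> \<le> \<eta>1"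
    and x1: "\<And>r. \<lbrakk>s \<le> r; r \<le> t\<rbrakk> \<Longrightarrow> \<bar>x1 r\<bar> \<le> 2 * \<beta>"
    and x2: "\<And>r. \<lbrakk>s \<le> r; r \<le> t\<rbrakk> \<Longrightarrow> \<bar>x2 r\<bar> \<le> M"
    and lip: "\<And>r. \<lbrakk>s \<le> r; r \<le> t\<rbrakk> \<Longrightarrow> \<bar>x2 t - x2 r\<bar> \<le> M1 * (t - r)"
  shows "\<bar>phi (a t) - x2 t\<bar> \<le> \<epsilon>"
proof -
  have "phi (a t) \<le> x2 t + \<epsilon>"
    by (rule tracking_upper[OF assms])
  moreover have "phi (- a t) \<le> - x2 t + \<epsilon>"
  proof (rule tracking_upper[of s t "\<lambda>r. - x2 r" "\<lambda>r. - d r" "\<lambda>r. - a r" "\<lambda>r. - x1 r"])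
    show "mv_solution s t (\<lambda>r. {- x2 r + - d r - phi (- a r)}) (\<lambda>r. - x1 r)"
      using mv_solution_uminus[OF mv] by (simp add: phi_minus algebra_simps)
    show "\<bar>- a r - - x1 r\<bar> \<le> \<eta>1" if "s \<le> r" "r \<le> t" for r using a[OF that]
      by linarith
    show "\<bar>- x2 t - - x2 r\<bar> \<le> M1 * (t - r)" if "s \<le> r" "r \<le> t" for r
      using lip[OF that] by linarith
  qed (use st d x1 x2 in auto)
  ultimately show ?thesis by (simp add: phi_minus abs_le_iff)
qed

text \<open>Beyond \<open>2 * \<beta>\<close> the innovation has absolute value at least
  \<open>\<beta>\<close>, because \<open>\<eta>1 \<le> \<beta>\<close>. The injection is then at
  least \<open>M + 1\<close>, enough against \<open>x2\<close> (at most \<open>M\<close>) and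
  \<open>d\<close> (at most 1).\<close>

lemma first_component_bound:
  assumes mv: "mv_solution s t (\<lambda>r. {x2 r + d r - phi (a r)}) x1" and st: "s \<le> t"
    and a: "\<And>r. \<lbrakk>s \<le> r; r \<le> t\<rbrakk> \<Longrightarrow> \<bar>a r - x1 r\<bar> \<le> \<eta>1"
    and d: "\<And>r. \<lbrakk>s \<le> r; r \<le> t\<rbrakk> \<Longrightarrow> \<bar>d r\<bar> \<le> \<eta>1"
    and x2: "\<And>r. \<lbrakk>s \<le> r; r \<le> t\<rbrakk> \<Longrightarrow> \<bar>x2 r\<bar> \<le> M"
    and init: "\<bar>x1 s\<bar> \<le> 2 * \<beta>"
  shows "\<bar>x1 t\<bar> \<le> 2 * \<beta>"
proof -
  have *: "y2 + d' - phi a' \<le> 0"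
    if "2 * \<beta> < y1" "\<bar>y2\<bar> \<le> M" "\<bar>d'\<bar> \<le> \<eta>1" "\<bar>a' - y1\<bar> \<le> \<eta>1" for y1 y2 d' a'
  proof -
    have "\<beta> \<le> a'" using that \<eta>1_le by auto
    then have "M + 1 \<le> phi a'" using phi_mono[of \<beta> a'] by (simp add: phi_\<beta>)
    then show ?thesis using that \<eta>1_le by auto
  qed
  have "x1 t \<le> max (2 * \<beta>) (x1 s - 0 * (t - s))"
  proof (rule mv_solution_barrier[OF mv])
    fix r E assume r: "s < r" "r < t" "2 * \<beta> < x1 r" and E: "E \<in> {x2 r + d r - phi (a r)}"
    then show "E \<le> - 0" using *[of "x1 r" "x2 r" "d r" "a r"] x2[of r] d[of r] a[of r] by auto
  qed (use st in auto)
  moreover have "- x1 t \<le> max (2 * \<beta>) (- x1 s - 0 * (t - s))"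
  proof (rule mv_solution_barrier[OF mv_solution_uminus[OF mv]])
    fix r E assume r: "s < r" "r < t" "2 * \<beta> < - x1 r"
      and E: "E \<in> uminus ` {x2 r + d r - phi (a r)}"
    have "- x2 r + - d r - phi (- a r) \<le> 0"
    proof (rule *[of "- x1 r"])
      show "\<bar>- a r - - x1 r\<bar> \<le> \<eta>1" using a[of r] r by simp
    qed (use r x2[of r] d[of r] in auto)
    then show "E \<le> - 0" using E by (simp add: phi_minus)
  qed (use st in auto)
  ultimately show ?thesis using init by auto
qed

section \<open>One contraction window of the longer chain\<close>

lemma hbox_Suc_iff:
  "hbox (Suc n) b1 R x \<longleftrightarrow> \<bar>x 1\<bar> \<le> 2 * \<beta> * R ^ Suc n \<and> hbox n b R (\<lambda>j. x (Suc j))"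
proof -
  have "{1..Suc n} = insert 1 (Suc ` {1..n})" unfolding image_Suc_atLeastAtMost by auto
  then have "hbox (Suc n) b1 R x \<longleftrightarrow> \<bar>x 1\<bar> \<le> b1 1 * R ^ (Suc (Suc n) - 1) \<and>
      (\<forall>j\<in>{1..n}. \<bar>x (Suc j)\<bar> \<le> b1 (Suc j) * R ^ (Suc (Suc n) - Suc j))"
    by (simp only: hbox_def ball_simps image_iff)
  moreover have "b1 1 = 2 * \<beta>" "\<And>j. j \<in> {1..n} \<Longrightarrow> b1 (Suc j) = b j"
    by (auto simp: b1_def)
  ultimately show ?thesis by (simp add: hbox_def)
qed

text \<open>Timetable of a window: during \<open>h\<close> the radius of the tail grows from 1 to at
  most 2 while tracking sets in; a contraction of duration \<open>2 * T\<close> brings 2 back to 1,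
  and one of duration \<open>T\<close> brings 1 to 1/2. Hence the length \<open>h + 3 * T\<close>.
  The hypothesis \<open>region\<close> provides the speed bound \<open>M1\<close>; the conclusion
  holds with the smaller radius \<open>2 * C\<close>, so that a continuation argument can discharge
  it.\<close>

lemma trajectory_bounds:
  assumes st: "s \<le> t" and sol: "chain_solution (Suc n) \<kappa> D s t a d e"
    and dist: "\<And>r. \<lbrakk>s \<le> r; r \<le> t\<rbrakk> \<Longrightarrow> disturbance_le (Suc n) \<eta>1 1 (a r) (d r) (e r)"
    and init: "hbox (Suc n) b1 1 (e s)"
    and region: "\<And>r. \<lbrakk>s \<le> r; r \<le> t\<rbrakk> \<Longrightarrow> hbox n b (3 * C) (\<lambda>j. e r (Suc j))"
  shows "\<bar>e t 1\<bar> \<le> 2 * \<beta>"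
    and "t \<le> s + (h + 3 * T) \<Longrightarrow> hbox n b (2 * C) (\<lambda>j. e t (Suc j))"
    and "t = s + (h + 3 * T) \<Longrightarrow> hbox n b (1 / 2) (\<lambda>j. e t (Suc j)) \<and> \<bar>e t 1\<bar> \<le> 2 * \<beta> / 2 ^ Suc n"
proof -
  define a' where "a' r = phi (a r)" for r
  define d' where "d' r j = d r (Suc j)" for r j
  define e' where "e' r j = e r (Suc j)" for r j
  have e'1: "e' r 1 = e r 2" for r by (simp add: e'_def numeral_2_eq_2)
  have sub: "chain_solution n k D s t a' d' e'"
    unfolding chain_solution_def
  proof
    fix j assume j: "j \<in> {1..n}"
    then have "mv_solution s t (\<lambda>r. chain_rhs (Suc n) \<kappa> D (a r) (d r) (e r) (Suc j)) (\<lambda>r. e r (Suc j))"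
      using sol unfolding chain_solution_def by auto
    then show "mv_solution s t (\<lambda>r. chain_rhs n k D (a' r) (d' r) (e' r) j) (\<lambda>r. e' r j)"
      using j by (simp add: subchain_rhs a'_def d'_def[abs_def] e'_def[abs_def])
  qed
  have "mv_solution s t (\<lambda>r. chain_rhs (Suc n) \<kappa> D (a r) (d r) (e r) 1) (\<lambda>r. e r 1)"
    using sol unfolding chain_solution_def by auto
  then have mv1: "mv_solution s t (\<lambda>r. {e' r 1 + d r 1 - phi (a r)}) (\<lambda>r. e r 1)"
    using n by (simp add: chain_rhs_def \<kappa>_def phi_def p_def e'_def)
  have a: "\<bar>a r - e r 1\<bar> \<le> \<eta>1" and d1: "\<bar>d r 1\<bar> \<le> \<eta>1"
    and d': "\<And>j. j \<in> {1..<n} \<Longrightarrow> \<bar>d' r j\<bar> \<le> \<eta>1" if "s \<le> r" "r \<le> t" for r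
    using dist[OF that] n by (auto simp: disturbance_le_def d'_def)
  have region': "hbox n b (3 * C) (e' r)" if "s \<le> r" "r \<le> t" for r
    using region[OF that] by (simp add: e'_def[abs_def])
  have e'_M: "\<bar>e' r j\<bar> \<le> M" if "s \<le> r" "r \<le> t" "j \<in> {1..n}" for r j
    by (rule M(2)[OF region'[OF that(1,2)] that(3)])
  have init1: "\<bar>e s 1\<bar> \<le> 2 * \<beta>" and init': "hbox n b 1 (e' s)"
    using init by (simp_all add: hbox_Suc_iff e'_def[abs_def])
  have x1: "\<bar>e r 1\<bar> \<le> 2 * \<beta>" if r: "s \<le> r" "r \<le> t" for r
  proof (rule first_component_bound[where ?d = "\<lambda>r. d r 1" and ?a = a and ?s = s
    and ?x1.0 = "\<lambda>r. e r 1" and ?x2.0 = "\<lambda>r. e' r 1" and ?t = r])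
    show "mv_solution s r (\<lambda>r. {e' r 1 + d r 1 - phi (a r)}) (\<lambda>r. e r 1)"
      using mv1 r by (auto intro: mv_solution_subset)
  qed (use r a d1 e'_M n init1 in auto)
  show "\<bar>e t 1\<bar> \<le> 2 * \<beta>" using x1[of t] st by simp
  have a'_le: "\<bar>a' r\<bar> \<le> 3 * (M + 1)" if "s \<le> r" "r \<le> t" for r
    unfolding a'_def using a[OF that] x1[OF that] \<eta>1_le by (intro phi_bound) linarith
  have rate: "\<bar>e' r' j - e' r j\<bar> \<le> M1 * (r' - r)"
    if "j \<in> {1..n}" "s \<le> r" "r \<le> r'" "r' \<le> t" for r r' j
  proof (rule mv_solution_abs_le)
    show "mv_solution s t (\<lambda>r. chain_rhs n k D (a' r) (d' r) (e' r) j) (\<lambda>r. e' r j)"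
      using sub that by (simp add: chain_solution_def)
    fix u E assume u: "r < u" "u < r'" and E: "E \<in> chain_rhs n k D (a' u) (d' u) (e' u) j"
    have u': "s \<le> u" "u \<le> t" using u that by auto
    show "\<bar>E\<bar> \<le> M1"
    proof (rule M1(2)[OF a'_le[OF u'] _ region'[OF u'] that(1) E])
      show "\<bar>d' u i\<bar> \<le> 1" if "i \<in> {1..<n}" for i
        using d'[OF u' that] \<eta>1_le by simp
    qed
  qed (use that in auto)
  have track: "\<bar>a' r - e' r 1\<bar> \<le> \<epsilon>" if r: "s + h \<le> r" "r \<le> t" for r
    unfolding a'_def
  proof (rule tracking[where ?d = "\<lambda>r. d r 1" and ?x1.0 = "\<lambda>r. e r 1"
    and ?x2.0 = "\<lambda>r. e' r 1" and ?s = s and ?t = r])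
    show "mv_solution s r (\<lambda>r. {e' r 1 + d r 1 - phi (a r)}) (\<lambda>r. e r 1)"
      using mv1 r by (auto intro: mv_solution_subset)
    show "\<bar>e' r 1 - e' u 1\<bar> \<le> M1 * (r - u)" if "s \<le> u" "u \<le> r" for u
      using rate[of 1 u r] n that r by auto
  qed (use r a d1 e'_M n x1 in auto)
  have dist': "disturbance_le n \<eta> R (a' r) (d' r) (e' r)" if "1 \<le> R" "s + h \<le> r" "r \<le> t" for R r
    unfolding disturbance_le_def
  proof (intro conjI ballI)
    have R: "\<eta> \<le> \<eta> * R ^ i" for i
      using one_le_power[OF \<open>1 \<le> R\<close>, of i] \<epsilon> by simp
    show "\<bar>a' r - e' r 1\<bar> \<le> \<eta> * R ^ n" using track[OF that(2,3)] \<epsilon> R[of n]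
      by linarith
    fix j assume "j \<in> {1..<n}"
    then have "\<bar>d' r j\<bar> \<le> \<eta>1" using d'[of r j] that h by auto
    then show "\<bar>d' r j\<bar> \<le> \<eta> * R ^ (n - j)" using \<eta>1_le R[of "n - j"] by linarith
  qed
  \<comment> \<open>Since \<open>M1 * h \<le> b j\<close>, a component moves by at most
    \<open>b j\<close> during \<open>h\<close>. Doubling the bound \<open>b j\<close> is covered by
    radius 2 because every weight is at least 1.\<close>
  have early: "hbox n b 2 (e' r)" if "s \<le> r" "r \<le> t" "r \<le> s + h" for r
    unfolding hbox_def
  proof
    fix j assume j: "j \<in> {1..n}"
    have "M1 * (r - s) \<le> M1 * h" using that M1 by (intro mult_left_mono) auto
    then have "\<bar>e' r j\<bar> \<le> \<bar>e' s j\<bar> + b j" using rate[of j s r] j that h(3)[OF j]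
      by auto
    also have "\<bar>e' s j\<bar> \<le> b j" using init' j by (simp add: hbox_def)
    also have "b j + b j = b j * 2 ^ 1" by simp
    also have "\<dots> \<le> b j * 2 ^ (Suc n - j)"
      using j b[OF j] by (intro mult_left_mono power_increasing) auto
    finally show "\<bar>e' r j\<bar> \<le> b j * 2 ^ (Suc n - j)" by simp
  qed
  have phase: "hbox n b (C * R) (e' r') \<and> (r' = r + R * T \<longrightarrow> hbox n b (R / 2) (e' r'))"
    if "1 \<le> R" "s + h \<le> r" "r \<le> r'" "r' \<le> t" "r' \<le> r + R * T" "hbox n b R (e' r)" for R r r'
  proof -
    have "s \<le> r" using that h by simp
    have "chain_solution n k D r r' a' d' e'"
      using sub that \<open>s \<le> r\<close> by (intro chain_solution_subset[OF sub])
    moreover have "\<forall>u\<in>{r..r'}. disturbance_le n \<eta> R (a' u) (d' u) (e' u)"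
      using that dist' by auto
    ultimately show ?thesis using contr[of R] that unfolding contracts_def by auto
  qed
  have bnn: "\<And>j. j \<in> {1..n} \<Longrightarrow> 0 \<le> b j" using b by (simp add: less_imp_le)
  have second: "hbox n b (2 * C) (e' r)" "r = s + h + 2 * T \<Longrightarrow> hbox n b 1 (e' r)"
    if "s + h \<le> r" "r \<le> t" "r \<le> s + h + 2 * T" for r
  proof -
    have "hbox n b 2 (e' (s + h))" using that h by (intro early) auto
    then show "hbox n b (2 * C) (e' r)" "r = s + h + 2 * T \<Longrightarrow> hbox n b 1 (e' r)"
      using phase[of 2 "s + h" r] that by (auto simp: mult.commute)
  qed
  have third: "hbox n b C (e' r)" "r = s + h + 3 * T \<Longrightarrow> hbox n b (1 / 2) (e' r)"
    if "s + h + 2 * T \<le> r" "r \<le> t" "r \<le> s + h + 3 * T" for r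
  proof -
    have "hbox n b 1 (e' (s + h + 2 * T))" using that T by (intro second(2)) auto
    then show "hbox n b C (e' r)" "r = s + h + 3 * T \<Longrightarrow> hbox n b (1 / 2) (e' r)"
      using phase[of 1 "s + h + 2 * T" r] that T by auto
  qed
  show "hbox n b (2 * C) (\<lambda>j. e t (Suc j))" if "t \<le> s + (h + 3 * T)"
  proof -
    consider "t \<le> s + h" | "s + h \<le> t" "t \<le> s + h + 2 * T" | "s + h + 2 * T \<le> t" by linarith
    then have "hbox n b (2 * C) (e' t)"
    proof cases
      case 1
      then have "hbox n b 2 (e' t)" using st by (intro early) auto
      then show ?thesis using C bnn by (rule_tac hbox_mono) auto
    next
      case 2 then show ?thesis by (intro second) auto
    next
      case 3
      then have "hbox n b C (e' t)" using that by (intro third) auto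
      then show ?thesis using C bnn by (rule_tac hbox_mono) auto
    qed
    then show ?thesis by (simp add: e'_def[abs_def])
  qed
  show "hbox n b (1 / 2) (\<lambda>j. e t (Suc j)) \<and> \<bar>e t 1\<bar> \<le> 2 * \<beta> / 2 ^ Suc n"
    if t: "t = s + (h + 3 * T)"
  proof
    have half: "hbox n b (1 / 2) (e' t)" using t T by (intro third) auto
    then show "hbox n b (1 / 2) (\<lambda>j. e t (Suc j))" by (simp add: e'_def[abs_def])
    have "1 \<in> {1..n}" using n by simp
    \<comment> \<open>\<open>b\<close> is itself a point of the box of radius \<open>3 * C\<close>,
      and \<open>M\<close> bounds the components of all such points.\<close>
    have "\<bar>b 1\<bar> \<le> M"
    proof (rule M(2))
      show "hbox n b (3 * C) b" unfolding hbox_def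
      proof
        fix j assume "j \<in> {1..n}"
        then show "\<bar>b j\<bar> \<le> b j * (3 * C) ^ (Suc n - j)"
          using b[of j] one_le_power[of "3 * C" "Suc n - j"] C by simp
      qed
    qed (use n in auto)
    then have "b 1 \<le> M" by simp
    have "\<bar>e' t 1\<bar> \<le> b 1 * (1 / 2) ^ (Suc n - 1)"
      using half \<open>1 \<in> {1..n}\<close> unfolding hbox_def by blast
    then have "\<bar>e' t 1\<bar> \<le> b 1 * (1 / 2) ^ n" by simp
    also have "\<dots> \<le> M * (1 / 2) ^ n" using \<open>b 1 \<le> M\<close> by (intro mult_right_mono) auto
    finally have "\<bar>e' t 1\<bar> \<le> M / 2 ^ n" by (simp add: power_one_over)
    moreover have "\<bar>a' t - e' t 1\<bar> \<le> \<epsilon>" using t T by (intro track) auto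
    \<comment> \<open>The first error is recovered from the injection:
      \<open>\<epsilon> \<le> 1 / 2 ^ n\<close> makes \<open>phi (a t)\<close> small enough for
      \<open>phi_small\<close>. The innovation and the noise then contribute one half each of
      \<open>2 * \<beta> / 2 ^ (n + 1)\<close>.\<close>
    ultimately have "\<bar>phi (a t)\<bar> \<le> (M + 1) / 2 ^ n"
      using \<epsilon>(3) by (simp add: a'_def add_divide_distrib)
    then have "\<bar>a t\<bar> \<le> \<beta> / 2 ^ Suc n" by (rule phi_small)
    moreover have "\<bar>a t - e t 1\<bar> \<le> \<beta> / 2 ^ Suc n" using a[of t] st \<eta>1(3) by linarith
    moreover have "2 * \<beta> / 2 ^ Suc n = \<beta> / 2 ^ Suc n + \<beta> / 2 ^ Suc n" by simp
    ultimately show "\<bar>e t 1\<bar> \<le> 2 * \<beta> / 2 ^ Suc n" by linarith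
  qed
qed

text \<open>Discharges \<open>region\<close> by real induction: as long as the tail is in the box of
  radius \<open>3 * C\<close>, it is in the box of radius \<open>2 * C\<close>, hence strictly
  inside the former, and continuity prolongs the inclusion a little.\<close>

lemma contracts_step: "contracts (Suc n) \<kappa> D b1 (h + 3 * T) \<eta>1 (3 * C) 1"
  unfolding contracts_def
proof (intro allI impI, elim conjE)
  fix s t a d e
  assume st: "s \<le> t" "t \<le> s + 1 * (h + 3 * T)"
    and sol: "chain_solution (Suc n) \<kappa> D s t a d e"
    and dist: "\<forall>r\<in>{s..t}. disturbance_le (Suc n) \<eta>1 1 (a r) (d r) (e r)"
    and init: "hbox (Suc n) b1 1 (e s)"
  define P where "P r \<longleftrightarrow> hbox n b (3 * C) (\<lambda>j. e r (Suc j))" for r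
  have bnn: "\<And>j. j \<in> {1..n} \<Longrightarrow> 0 \<le> b j" using b by (simp add: less_imp_le)
  have cont: "continuous_on {s..t} (\<lambda>r. e r (Suc j))" if "j \<in> {1..n}" for j
    using sol that unfolding chain_solution_def by (auto intro: mv_solution_continuous_on)
  have inner: "hbox n b (2 * C) (\<lambda>j. e u (Suc j))"
    if "s \<le> u" "u \<le> t" "\<And>r. \<lbrakk>s \<le> r; r \<le> u\<rbrakk> \<Longrightarrow> P r" for u
    using that dist st init
    by (intro trajectory_bounds(2)[where s = s and t = u and a = a and d = d]
        chain_solution_subset[OF sol]) (auto simp: P_def)
  have region: "P u" if "s \<le> u" "u \<le> t" for u
  proof (rule real_induct_Icc[where P = P and s = s and t = t])
    have "hbox n b 1 (\<lambda>j. e s (Suc j))" using init by (simp add: hbox_Suc_iff)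
    then show "P s" unfolding P_def using C bnn by (rule_tac hbox_mono) auto
  next
    fix u assume u: "s < u" "u \<le> t"
      and Pr: "\<And>r. \<lbrakk>s \<le> r; r < u\<rbrakk> \<Longrightarrow> P r"
    show "P u" unfolding P_def hbox_def
    proof
      fix j assume j: "j \<in> {1..n}"
      have "continuous_on (closure {s..<u}) (\<lambda>r. \<bar>e r (Suc j)\<bar>)"
        using u by (intro continuous_intros continuous_on_subset[OF cont[OF j]]) auto
      then show "\<bar>e u (Suc j)\<bar> \<le> b j * (3 * C) ^ (Suc n - j)"
        by (rule continuous_le_on_closure) (use u Pr j in \<open>auto simp: P_def hbox_def\<close>)
    qed
  next
    fix u assume u: "s \<le> u" "u < t"
      and Pr: "\<And>r. \<lbrakk>s \<le> r; r \<le> u\<rbrakk> \<Longrightarrow> P r"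
    have *: "hbox n b (2 * C) (\<lambda>j. e u (Suc j))" using inner[of u] u Pr by auto
    have "\<forall>\<^sub>F r in at u within {s..t}. \<bar>e r (Suc j)\<bar> < b j * (3 * C) ^ (Suc n - j)"
      if j: "j \<in> {1..n}" for j
    proof (rule order_tendstoD(2))
      show "((\<lambda>r. \<bar>e r (Suc j)\<bar>) \<longlongrightarrow> \<bar>e u (Suc j)\<bar>) (at u within {s..t})"
        using cont[OF j] u by (intro tendsto_rabs) (auto simp: continuous_on_def)
      have "\<bar>e u (Suc j)\<bar> \<le> b j * (2 * C) ^ (Suc n - j)" using * j by (simp add: hbox_def)
      also have "\<dots> < b j * (3 * C) ^ (Suc n - j)"
        using b[OF j] C j by (intro mult_strict_left_mono power_strict_mono) auto
      finally show "\<bar>e u (Suc j)\<bar> < b j * (3 * C) ^ (Suc n - j)" .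
    qed
    then have "\<forall>\<^sub>F r in at u within {s..t}. \<forall>j\<in>{1..n}. \<bar>e r (Suc j)\<bar> < b j * (3 * C) ^ (Suc n - j)"
      by (intro eventually_ball_finite) auto
    then obtain \<delta> where "\<delta> > 0"
      and \<delta>: "\<And>r. \<lbrakk>r \<in> {s..t}; r \<noteq> u; dist r u < \<delta>\<rbrakk> \<Longrightarrow>
        \<forall>j\<in>{1..n}. \<bar>e r (Suc j)\<bar> < b j * (3 * C) ^ (Suc n - j)"
      unfolding eventually_at by metis
    have "P r" if "u < r" "r < u + \<delta>" "r \<le> t" for r
      using \<delta>[of r] that u unfolding P_def hbox_def by (auto simp: dist_real_def intro: less_imp_le)
    then show "\<exists>\<delta>>0. \<forall>r. u < r \<and> r < u + \<delta> \<and> r \<le> t \<longrightarrow> P r"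
      using \<open>\<delta> > 0\<close> by blast
  qed (use that in auto)
  have region': "hbox n b (3 * C) (\<lambda>j. e r (Suc j))" if "s \<le> r" "r \<le> t" for r
    using region[OF that] by (simp add: P_def)
  have dist': "disturbance_le (Suc n) \<eta>1 1 (a r) (d r) (e r)" if "s \<le> r" "r \<le> t" for r
    using dist that by simp
  note bounds = trajectory_bounds[OF st(1) sol dist' init region']
  show "hbox (Suc n) b1 (3 * C * 1) (e t) \<and>
      (t = s + 1 * (h + 3 * T) \<longrightarrow> hbox (Suc n) b1 (1 / 2) (e t))"
    unfolding hbox_Suc_iff
  proof (intro conjI impI)
    have "2 * \<beta> * 1 \<le> 2 * \<beta> * (3 * C * 1) ^ Suc n"
      using C \<beta> one_le_power[of "3 * C" "Suc n"] by (intro mult_left_mono) auto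
    then show "\<bar>e t 1\<bar> \<le> 2 * \<beta> * (3 * C * 1) ^ Suc n" using bounds(1) by linarith
    show "hbox n b (3 * C * 1) (\<lambda>j. e t (Suc j))" using region'[of t] st by simp
    assume t: "t = s + 1 * (h + 3 * T)"
    show "\<bar>e t 1\<bar> \<le> 2 * \<beta> * (1 / 2) ^ Suc n" "hbox n b (1 / 2) (\<lambda>j. e t (Suc j))"
      using bounds(3) t by (auto simp: power_one_over)
  qed
qed

end

text \<open>The order of the choices avoids circularity. \<open>M\<close> and \<open>M1\<close> come
  from the chain of order \<open>n\<close> alone; then \<open>\<epsilon>\<close>, \<open>h\<close>
  and \<open>\<beta>\<close>, which determine \<open>lam\<close>; last \<open>\<eta>1\<close>, from
  the uniform continuity of the injection defined by \<open>lam\<close>.\<close>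

lemma contracting_gains:
  assumes "0 \<le> D" "1 \<le> n"
  shows "\<exists>k b T \<eta> C. (\<forall>j\<in>{1..n}. 0 < k j \<and> 0 < b j) \<and> 0 < T \<and> 0 < \<eta> \<and> 1 \<le> C \<and>
    (\<forall>R>0. contracts n k D b T \<eta> C R)"
  using \<open>1 \<le> n\<close>
proof (induction n rule: dec_induct)
  case base
  show ?case
  proof (intro exI conjI allI impI)
    show "contracts 1 (\<lambda>_. D + 1) D (\<lambda>_. 1) 1 (1/2) 1 R" if "0 < R" for R
      using contracts_base[OF \<open>0 \<le> D\<close>] that by (rule contracts_rescale) simp
  qed (use \<open>0 \<le> D\<close> in auto)
next
  case (step n)
  then obtain k b T \<eta> C where k: "\<And>j. j \<in> {1..n} \<Longrightarrow> 0 < k j"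
    and b: "\<And>j. j \<in> {1..n} \<Longrightarrow> 0 < b j"
    and T: "0 < T" and \<eta>: "0 < \<eta>" and C: "1 \<le> C"
    and contr: "\<And>R. 0 < R \<Longrightarrow> contracts n k D b T \<eta> C R"
    by metis
  have n: "1 \<le> n" by (rule step)
  define M where "M = (\<Sum>j=1..n. b j * (3 * C) ^ (Suc n - j))"
  have "0 \<le> M" unfolding M_def using b C by (intro sum_nonneg mult_nonneg_nonneg) (auto simp: less_imp_le)
  have M: "\<bar>x j\<bar> \<le> M" if "hbox n b (3 * C) x" "j \<in> {1..n}" for x j
  proof -
    have "\<bar>x j\<bar> \<le> b j * (3 * C) ^ (Suc n - j)" using that by (simp add: hbox_def)
    also have "\<dots> \<le> M" unfolding M_def using that b C
      by (intro member_le_sum mult_nonneg_nonneg) (auto simp: less_imp_le)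
    finally show ?thesis .
  qed
  define g where "g j = k j * (3 * (M + 1)) powr ((real n - real j) / real n)" for j
  have g: "0 \<le> g j" "g j \<le> (\<Sum>j=1..n. g j)" if "j \<in> {1..n}" for j
    using that k by (auto simp: g_def less_imp_le intro!: member_le_sum mult_nonneg_nonneg)
  \<comment> \<open>A bound on the speed of every tail component: next error, disturbance
    \<open>d\<close>, disturbance of the last component, and injections for an innovation of size at
    most \<open>3 * (M + 1)\<close>.\<close>
  define M1 where "M1 = M + 1 + D + (\<Sum>j=1..n. g j)"
  have "0 \<le> M1" unfolding M1_def using \<open>0 \<le> M\<close> \<open>0 \<le> D\<close> g
    by (auto intro!: add_nonneg_nonneg sum_nonneg)
  have M1: "\<bar>E\<bar> \<le> M1"
    if a: "\<bar>a\<bar> \<le> 3 * (M + 1)"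
      and d: "\<And>i. i \<in> {1..<n} \<Longrightarrow> \<bar>d i\<bar> \<le> 1"
      and x: "hbox n b (3 * C) x" and j: "j \<in> {1..n}"
        and E: "E \<in> chain_rhs n k D a d x j" for a d x j E
  proof (cases "j < n")
    case True
    have "\<bar>k j * signed_powr a ((real n - real j) / real n)\<bar> \<le> g j"
      using k[OF j] a True unfolding g_def abs_mult abs_signed_powr
      by (cases "a = 0") (auto intro!: mult_mono powr_mono2)
    then show ?thesis
      using E True d[of j] j M[OF x, of "Suc j"] g[OF j] \<open>0 \<le> D\<close>
        unfolding chain_rhs_def M1_def by auto
  next
    case False
    then have "j = n" using j by simp
    then obtain \<delta> \<sigma> where E: "E = \<delta> - k n * \<sigma>" "\<bar>\<delta>\<bar> \<le> D" "\<bar>\<sigma>\<bar> \<le> 1"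
      using E sign_set_abs_le by (auto simp: chain_rhs_def)
    have "\<bar>k n * \<sigma>\<bar> \<le> k n * 1"
      using E k[of n] n unfolding abs_mult by (intro mult_mono) auto
    moreover have "g n = k n" using \<open>0 \<le> M\<close> by (simp add: g_def)
    ultimately show ?thesis using E g[OF j] \<open>j = n\<close> \<open>0 \<le> M\<close>
      unfolding M1_def by auto
  qed
  define \<epsilon> where "\<epsilon> = min \<eta> (1 / 2 ^ n)"
  have \<epsilon>: "0 < \<epsilon>" "\<epsilon> \<le> \<eta>" "\<epsilon> \<le> 1 / 2 ^ n" using \<eta>
    by (auto simp: \<epsilon>_def)
  define h0 where "h0 = min (\<epsilon> / 8) (Min (b ` {1..n}))"
  have h0: "0 < h0" "h0 \<le> \<epsilon> / 8" "\<And>j. j \<in> {1..n} \<Longrightarrow> h0 \<le> b j"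
    using \<epsilon> b n by (auto simp: h0_def min_le_iff_disj)
  \<comment> \<open>So short a time that the tail moves by at most \<open>h0\<close>; the added 1
    keeps the denominator positive.\<close>
  define h where "h = h0 / (M1 + 1)"
  have "0 < h" using h0 \<open>0 \<le> M1\<close> by (simp add: h_def)
  have "(M1 + 1) * h = h0" using \<open>0 \<le> M1\<close> by (simp add: h_def)
  then have "M1 * h \<le> h0" using \<open>0 < h\<close> by (simp add: algebra_simps)
  define \<beta> where "\<beta> = h * \<epsilon> / 16"
  have \<beta>: "0 < \<beta>" "16 * \<beta> = h * \<epsilon>" using \<open>0 < h\<close> \<epsilon>
    by (auto simp: \<beta>_def)
  define p lam where "p = real n / real (Suc n)" and "lam = (M + 1) / \<beta> powr p"
  \<comment> \<open>The range: first errors of size at most \<open>2 * \<beta>\<close>, shifted by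
    at most \<open>2 * \<eta>1\<close>, which is at most \<open>2 * \<beta>\<close>.\<close>
  have "uniformly_continuous_on {- 4 * \<beta>..4 * \<beta>} (\<lambda>x. lam * signed_powr x p)"
    using n by (intro compact_uniformly_continuous continuous_on_mult_left
        continuous_on_signed_powr continuous_on_id compact_Icc) (simp add: p_def)
  moreover have "0 < \<epsilon> / 4" using \<epsilon> by simp
  ultimately obtain \<rho> where "\<rho> > 0"
    and \<rho>0: "\<And>x y. \<lbrakk>x \<in> {- 4 * \<beta>..4 * \<beta>}; y \<in> {- 4 * \<beta>..4 * \<beta>};
      dist y x < \<rho>\<rbrakk> \<Longrightarrow> dist (lam * signed_powr y p) (lam * signed_powr x p) < \<epsilon> / 4"
    by (rule uniformly_continuous_onE) blast
  have \<rho>: "\<And>x y. \<lbrakk>\<bar>x\<bar> \<le> 4 * \<beta>; \<bar>y\<bar> \<le> 4 * \<beta>; \<bar>x - y\<bar> < \<rho>\<rbrakk>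
      \<Longrightarrow> \<bar>lam * signed_powr x p - lam * signed_powr y p\<bar> < \<epsilon> / 4"
  proof -
    fix x y assume "\<bar>x\<bar> \<le> 4 * \<beta>" "\<bar>y\<bar> \<le> 4 * \<beta>"
      and xy: "\<bar>x - y\<bar> < \<rho>"
    then have "x \<in> {- 4 * \<beta>..4 * \<beta>}" "y \<in> {- 4 * \<beta>..4 * \<beta>}" by auto
    then show "\<bar>lam * signed_powr x p - lam * signed_powr y p\<bar> < \<epsilon> / 4"
      using \<rho>0[of y x] xy by (simp add: dist_real_def)
  qed
  \<comment> \<open>The entries serve, in order, the budget of \<open>tracking_upper\<close>, the
    final value of the first error, and the uniform continuity between the points
    \<open>x1 t + \<eta>1\<close> and \<open>x1 t - 2 * \<eta>1\<close>, which are
    \<open>3 * \<eta>1\<close> apart.\<close>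
  define \<eta>1 where "\<eta>1 = min (\<epsilon> / 8) (min (\<beta> / 2 ^ Suc n) (\<rho> / 4))"
  have \<eta>1: "0 < \<eta>1" "\<eta>1 \<le> \<epsilon> / 8" "\<eta>1 \<le> \<beta> / 2 ^ Suc n" "3 * \<eta>1 < \<rho>"
    using \<epsilon> \<beta> \<open>\<rho> > 0\<close> by (auto simp: \<eta>1_def min_def)
  have h: "M1 * h \<le> \<epsilon> / 8" "\<And>j. j \<in> {1..n} \<Longrightarrow> M1 * h \<le> b j"
    using \<open>M1 * h \<le> h0\<close> h0 by (auto intro: order_trans)
  define \<kappa> b1 where "\<kappa> = (\<lambda>j. if j = 1 then lam
      else k (j - 1) * lam powr ((real (Suc n) - real j) / real n))"
    and "b1 = (\<lambda>j. if j = 1 then 2 * \<beta> else b (j - 1))"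
  interpret high_gain_chain n k b D T \<eta> C h M M1 \<epsilon> \<beta> \<eta>1 p lam "\<lambda>x. lam * signed_powr x p" \<kappa> b1
  proof unfold_locales
    show "\<bar>lam * signed_powr x p - lam * signed_powr y p\<bar> \<le> \<epsilon> / 4"
      if "\<bar>x\<bar> \<le> 4 * \<beta>" "\<bar>y\<bar> \<le> 4 * \<beta>" "\<bar>x - y\<bar> \<le> 3 * \<eta>1" for x y
      using \<rho>[OF that(1,2)] that(3) \<eta>1(4) by linarith
  qed (rule refl p_def lam_def \<kappa>_def b1_def n b T C contr \<epsilon> \<open>0 \<le> M\<close> M \<open>0 \<le> M1\<close> M1 \<open>0 < h\<close> h \<beta> \<eta>1; assumption)+
  show ?case
  proof (intro exI conjI allI impI)
    show "contracts (Suc n) \<kappa> D b1 (h + 3 * T) \<eta>1 (3 * C) R" if "0 < R" for R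
      using contracts_step that by (rule contracts_rescale) simp
    show "\<forall>j\<in>{1..Suc n}. 0 < \<kappa> j \<and> 0 < b1 j"
    proof
      fix j assume "j \<in> {1..Suc n}"
      then have "j = 1 \<or> j - 1 \<in> {1..n}" by auto
      then show "0 < \<kappa> j \<and> 0 < b1 j"
        using lam_pos \<beta> k b by (auto simp: \<kappa>_def b1_def)
    qed
  qed (use \<eta>1 \<open>0 < h\<close> T C in auto)
qed

section \<open>Input-to-state stability from one contraction\<close>

lemma class_K_mono:
  assumes "class_K \<gamma>" "0 \<le> x" "x \<le> y"
  shows "\<gamma> x \<le> \<gamma> y"
proof (cases "x = y")
  case False
  then have "\<gamma> x < \<gamma> y"
    using assms by (intro strict_mono_onD[of "{0..}" \<gamma>]) (auto simp: class_K_def)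
  then show ?thesis by simp
qed simp

lemma class_K_nonneg: "class_K \<gamma> \<Longrightarrow> 0 \<le> x \<Longrightarrow> 0 \<le> \<gamma> x"
  using class_K_mono[of \<gamma> 0 x] by (simp add: class_K_def)

lemma class_K_zero: "class_K \<gamma> \<Longrightarrow> \<gamma> 0 = 0"
  by (simp add: class_K_def)

lemma class_K_max:
  assumes "class_K \<gamma>" "0 \<le> x" "0 \<le> y"
  shows "\<gamma> (max x y) = max (\<gamma> x) (\<gamma> y)"
  using class_K_mono[OF assms(1,2), of y] class_K_mono[OF assms(1,3), of x] by (auto simp: max_def)

lemma class_K_compose:
  assumes "class_K f" "class_K g"
  shows "class_K (\<lambda>x. f (g x))"
  unfolding class_K_def
proof (intro conjI)
  have "continuous_on (g ` {0..}) f"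
    using assms class_K_nonneg by (auto simp: class_K_def intro: continuous_on_subset)
  then show "continuous_on {0..} (\<lambda>x. f (g x))"
    using assms continuous_on_compose[of "{0..}" g f] by (auto simp: class_K_def o_def)
  show "strict_mono_on {0..} (\<lambda>x. f (g x))"
    using assms class_K_nonneg[OF assms(2)] unfolding class_K_def strict_mono_on_def by simp
qed (use assms in \<open>simp add: class_K_def\<close>)

lemma class_K_add:
  assumes "class_K f" "class_K g"
  shows "class_K (\<lambda>x. f x + g x)"
  unfolding class_K_def
proof (intro conjI)
  show "continuous_on {0..} (\<lambda>x. f x + g x)"
    using assms by (intro continuous_on_add) (simp_all add: class_K_def)
qed (use assms in \<open>auto simp: class_K_def strict_mono_on_def add_strict_mono\<close>)

lemma class_K_cmult:
  assumes "class_K f" "0 < c"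
  shows "class_K (\<lambda>x. c * f x)"
  unfolding class_K_def
proof (intro conjI)
  show "continuous_on {0..} (\<lambda>x. c * f x)"
    using assms by (intro continuous_on_mult_left) (simp add: class_K_def)
qed (use assms in \<open>auto simp: class_K_def strict_mono_on_def\<close>)

lemma class_K_id: "class_K (\<lambda>x. x)"
  by (auto simp: class_K_def strict_mono_on_def intro: continuous_on_id)

lemma class_K_power: "0 < n \<Longrightarrow> class_K (\<lambda>x. x ^ n)"
  unfolding class_K_def
  by (intro conjI continuous_on_power continuous_on_id) (auto simp: strict_mono_on_def intro: power_strict_mono)

lemma class_K_powr: "0 < p \<Longrightarrow> class_K (\<lambda>x. x powr p)"
  unfolding class_K_def
  by (intro conjI continuous_on_powr' continuous_on_id continuous_on_const)
    (auto simp: strict_mono_on_def intro: powr_less_mono2)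

lemma class_K_sum:
  assumes "finite I" "I \<noteq> {}" "\<And>i. i \<in> I \<Longrightarrow> class_K (f i)"
  shows "class_K (\<lambda>x. \<Sum>i\<in>I. f i x)"
  using assms
proof (induction I rule: finite_ne_induct)
  case (insert i I)
  then show ?case by (simp add: class_K_add)
qed simp

text \<open>Contractions exist for positive radii only. Letting \<open>R\<close> decrease to
  \<open>Rs\<close> includes \<open>Rs = 0\<close>, the case of no disturbance, which gives exact
  convergence.\<close>

lemma hbox_closed:
  assumes "\<And>R. Rs < R \<Longrightarrow> hbox n b (C * R) x"
  shows "hbox n b (C * Rs) x"
  unfolding hbox_def
proof
  fix j assume j: "j \<in> {1..n}"
  have "((\<lambda>R. b j * (C * R) ^ (Suc n - j)) \<longlongrightarrow> b j * (C * Rs) ^ (Suc n - j)) (at_right Rs)"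
    by (intro tendsto_intros)
  moreover have "\<forall>\<^sub>F R in at_right Rs. \<bar>x j\<bar> \<le> b j * (C * R) ^ (Suc n - j)"
    using assms j by (intro eventually_at_right_less[THEN eventually_mono]) (auto simp: hbox_def)
  ultimately show "\<bar>x j\<bar> \<le> b j * (C * Rs) ^ (Suc n - j)"
    by (rule tendsto_lowerbound) simp
qed

lemma disturbance_le_mono:
  assumes "disturbance_le n \<eta> R a d e" "0 \<le> R" "R \<le> R'" "0 \<le> \<eta>"
  shows "disturbance_le n \<eta> R' a d e"
proof -
  have "\<eta> * R ^ i \<le> \<eta> * R' ^ i" for i
    using assms by (intro mult_left_mono power_mono) auto
  then show ?thesis using assms(1) unfolding disturbance_le_def by (meson order_trans)
qed

lemma contractsD:
  assumes "contracts n k D b T \<eta> C R" "s \<le> t" "t \<le> s + R * T" "chain_solution n k D s t a d e"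
    and "\<And>u. \<lbrakk>s \<le> u; u \<le> t\<rbrakk> \<Longrightarrow> disturbance_le n \<eta> R (a u) (d u) (e u)" "hbox n b R (e s)"
  shows "hbox n b (C * R) (e t)" "t = s + R * T \<Longrightarrow> hbox n b (R / 2) (e t)"
proof -
  have "\<forall>u\<in>{s..t}. disturbance_le n \<eta> R (a u) (d u) (e u)" using assms(5) by simp
  then show "hbox n b (C * R) (e t)" "t = s + R * T \<Longrightarrow> hbox n b (R / 2) (e t)"
    using assms(1-4,6) unfolding contracts_def by blast+
qed

section \<open>Contractions over successive time windows\<close>

locale contracting_chain =
  fixes n :: nat and k b :: "nat \<Rightarrow> real" and D T \<eta> C :: real
  assumes n: "1 \<le> n" and b: "\<And>j. j \<in> {1..n} \<Longrightarrow> 0 < b j"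
    and T: "0 < T" and \<eta>: "0 < \<eta>" and C: "1 \<le> C"
    and contr: "\<And>R. 0 < R \<Longrightarrow> contracts n k D b T \<eta> C R"
begin

lemma bnn: "\<And>j. j \<in> {1..n} \<Longrightarrow> 0 \<le> b j"
  using b by (simp add: less_imp_le)

text \<open>Cut the time into windows of length \<open>R * T\<close>. At the end of each the state
  is back in the box of radius \<open>R\<close> (even \<open>R / 2\<close>), and inside a window it
  can only reach radius \<open>C * R\<close>.\<close>

lemma hbox_invariant:
  assumes "0 < R" "s \<le> t" "chain_solution n k D s t a d e"
    and dist: "\<And>u. \<lbrakk>s \<le> u; u \<le> t\<rbrakk> \<Longrightarrow> disturbance_le n \<eta> R (a u) (d u) (e u)"
    and "hbox n b R (e s)"
  shows "hbox n b (C * R) (e t)"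
proof -
  have RT: "0 < R * T" using assms T by simp
  have step: "hbox n b R (e (s + real N * (R * T)))" if "s + real N * (R * T) \<le> t" for N
    using that
  proof (induction N)
    case (Suc N)
    have "s \<le> s + real N * (R * T)" using RT by simp
    have eq: "s + real (Suc N) * (R * T) = s + real N * (R * T) + R * T"
      by (simp add: algebra_simps)
    have "hbox n b (R / 2) (e (s + real (Suc N) * (R * T)))"
    proof (rule contractsD(2)[OF contr[OF \<open>0 < R\<close>], where s = "s + real N * (R * T)"])
      show "chain_solution n k D (s + real N * (R * T)) (s + real (Suc N) * (R * T)) a d e"
        using Suc.prems \<open>s \<le> s + real N * (R * T)\<close>
          by (intro chain_solution_subset[OF assms(3)]) auto
      show "hbox n b R (e (s + real N * (R * T)))" using Suc RT eq by (intro Suc.IH) linarith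
      show "disturbance_le n \<eta> R (a u) (d u) (e u)"
        if "s + real N * (R * T) \<le> u" "u \<le> s + real (Suc N) * (R * T)" for u
        using that Suc.prems \<open>s \<le> s + real N * (R * T)\<close> by (intro dist) linarith+
    qed (use eq RT in linarith)+
    then show ?case using \<open>0 < R\<close> bnn by (rule_tac hbox_mono) auto
  qed (use assms in simp)
  define N where "N = nat \<lfloor>(t - s) / (R * T)\<rfloor>"
  have q: "0 \<le> (t - s) / (R * T)" using assms RT by simp
  have "real N \<le> (t - s) / (R * T)" "(t - s) / (R * T) \<le> real N + 1"
    using q by (simp_all add: N_def)
  then have N: "s + real N * (R * T) \<le> t" "t \<le> s + real N * (R * T) + R * T"
    using RT by (simp_all add: pos_le_divide_eq pos_divide_le_eq algebra_simps)
  have "s \<le> s + real N * (R * T)" using RT by simp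
  show ?thesis
  proof (rule contractsD(1)[OF contr[OF \<open>0 < R\<close>], where s = "s + real N * (R * T)"])
    show "chain_solution n k D (s + real N * (R * T)) t a d e"
      using \<open>s \<le> s + real N * (R * T)\<close> by (intro chain_solution_subset[OF assms(3)]) auto
    show "disturbance_le n \<eta> R (a u) (d u) (e u)" if "s + real N * (R * T) \<le> u" "u \<le> t" for u
      using that \<open>s \<le> s + real N * (R * T)\<close> by (intro dist) linarith+
  qed (use N step in auto)
qed

text \<open>The radii \<open>R0\<close>, \<open>R0 / 2\<close>, \<open>R0 / 4\<close> and so on take
  the times \<open>R0 * T\<close>, \<open>R0 * T / 2\<close> and so on, altogether at most
  \<open>2 * T * R0\<close>. The induction is on the number of halvings needed to get down to
  \<open>R1\<close>; from then on the box of radius \<open>R1\<close> is kept up to the factor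
  \<open>C\<close>.\<close>

lemma hbox_decay:
  assumes "0 < R1" "0 \<le> R0" "chain_solution n k D s t a d e"
    and dist: "\<And>u. \<lbrakk>s \<le> u; u \<le> t\<rbrakk> \<Longrightarrow> disturbance_le n \<eta> R1 (a u) (d u) (e u)"
    and "hbox n b R0 (e s)" "s + 2 * T * R0 \<le> t"
  shows "hbox n b (C * R1) (e t)"
proof -
  obtain N where "R0 / R1 < 2 ^ N" using real_arch_pow[of 2 "R0 / R1"] by auto
  then have "R0 \<le> R1 * 2 ^ N" using \<open>0 < R1\<close> by (simp add: pos_divide_less_eq mult.commute)
  then show ?thesis using assms(2-6)
  proof (induction N arbitrary: R0 s)
    case 0
    note prems = "0.prems"
    have "R0 \<le> R1" using prems(1) by simp
    then have R1: "hbox n b R1 (e s)" by (rule hbox_mono[OF prems(5) prems(2) _ bnn])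
    have "0 \<le> T * R0" using T prems(2) by simp
    then have "s \<le> t" using prems(6) by linarith
    then show ?case using prems(3,4) R1 by (rule hbox_invariant[OF \<open>0 < R1\<close>])
  next
    case (Suc N)
    note prems = Suc.prems
    have TR: "0 \<le> T * R0" using T prems(2) by simp
    then have st: "s \<le> t" using prems(6) by linarith
    show ?case
    proof (cases "R0 \<le> R1")
      case True
      then have R1: "hbox n b R1 (e s)" by (rule hbox_mono[OF prems(5) prems(2) _ bnn])
      show ?thesis using st prems(3,4) R1 by (rule hbox_invariant[OF \<open>0 < R1\<close>])
    next
      case False
      then have "0 < R0" using \<open>0 < R1\<close> by simp
      let ?s = "s + R0 * T"
      have s: "s \<le> ?s" "?s + 2 * T * (R0 / 2) \<le> t" "?s \<le> t"
        using TR prems(6) by (simp_all add: mult.commute)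
      have "hbox n b (R0 / 2) (e ?s)"
      proof (rule contractsD(2)[OF contr[OF \<open>0 < R0\<close>], where s = s])
        show "chain_solution n k D s ?s a d e"
          using s(3) by (intro chain_solution_subset[OF prems(3)]) simp_all
        show "disturbance_le n \<eta> R0 (a u) (d u) (e u)" if "s \<le> u" "u \<le> ?s" for u
          using s(3) False that \<eta> \<open>0 < R1\<close>
            by (intro disturbance_le_mono[OF prems(4)]) linarith+
      qed (use s(1) prems(5) in simp_all)
      moreover have "chain_solution n k D ?s t a d e"
        using s(1) by (intro chain_solution_subset[OF prems(3)]) simp_all
      moreover have "R0 / 2 \<le> R1 * 2 ^ N" "0 \<le> R0 / 2" using prems(1,2) by simp_all
      moreover have "disturbance_le n \<eta> R1 (a u) (d u) (e u)" if "?s \<le> u" "u \<le> t" for u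
        using prems(4)[of u] that s(1) by linarith
      ultimately show ?thesis using s(2) by (intro Suc.IH[of "R0 / 2" ?s])
    qed
  qed
qed

lemma hbox_iss:
  assumes "0 \<le> R1" "0 \<le> R0" "s \<le> t" "chain_solution n k D s t a d e"
    and dist: "\<And>u. \<lbrakk>s \<le> u; u \<le> t\<rbrakk> \<Longrightarrow> disturbance_le n \<eta> R1 (a u) (d u) (e u)"
    and init: "hbox n b R0 (e s)"
  shows "hbox n b (C * max R0 R1) (e t)"
    and "s + 2 * T * R0 \<le> t \<Longrightarrow> hbox n b (C * R1) (e t)"
proof -
  have dist': "disturbance_le n \<eta> R (a u) (d u) (e u)" if "R1 < R" "s \<le> u" "u \<le> t" for R u
    using that \<open>0 \<le> R1\<close> \<eta> by (intro disturbance_le_mono[OF dist]) auto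
  show "hbox n b (C * max R0 R1) (e t)"
  proof (rule hbox_closed)
    fix R assume R: "max R0 R1 < R"
    show "hbox n b (C * R) (e t)"
    proof (rule hbox_invariant)
      show "hbox n b R (e s)" using R \<open>0 \<le> R0\<close> by (intro hbox_mono[OF init _ _ bnn]) simp_all
      show "disturbance_le n \<eta> R (a u) (d u) (e u)" if "s \<le> u" "u \<le> t" for u
        using R that by (intro dist') simp_all
    qed (use R assms(1-4) in simp_all)
  qed
  show "hbox n b (C * R1) (e t)" if "s + 2 * T * R0 \<le> t"
  proof (rule hbox_closed)
    fix R assume R: "R1 < R"
    show "hbox n b (C * R) (e t)"
    proof (rule hbox_decay)
      show "disturbance_le n \<eta> R (a u) (d u) (e u)" if "s \<le> u" "u \<le> t" for u
        using R that by (intro dist') simp_all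
    qed (use R assms(1-4) init that in simp_all)
  qed
qed

end

text \<open>Input-to-state stability with settling in finite time: after \<open>\<tau> r\<close> the
  initial error leaves no trace, so for \<open>\<delta> = 0\<close> the error vanishes. The initial
  time \<open>s\<close> is arbitrary because the cascade restarts chains in mid-course.\<close>

definition iss_estimate ::
  "nat \<Rightarrow> (nat \<Rightarrow> real) \<Rightarrow> real \<Rightarrow> (real \<Rightarrow> real) \<Rightarrow> (real \<Rightarrow> real) \<Rightarrow> (real \<Rightarrow> real) \<Rightarrow> bool" where
  "iss_estimate n k D \<alpha> \<gamma> \<tau> \<longleftrightarrow>
     (\<forall>s t a d e r \<delta>. s \<le> t \<and> 0 \<le> r \<and> 0 \<le> \<delta> \<and> chain_solution n k D s t a d e \<and>
        (\<forall>u\<in>{s..t}. \<bar>a u - e u 1\<bar> \<le> \<delta> \<and> (\<forall>j\<in>{1..<n}. \<bar>d u j\<bar> \<le> \<delta>)) \<and> (\<forall>j\<in>{1..n}. \<bar>e s j\<bar> \<le> r) \<longrightarrow>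
        (\<forall>j\<in>{1..n}. \<bar>e t j\<bar> \<le> max (\<alpha> r) (\<gamma> \<delta>) \<and> (s + \<tau> r \<le> t \<longrightarrow> \<bar>e t j\<bar> \<le> \<gamma> \<delta>)))"

text \<open>Translation between ordinary sizes and homogeneous radii. The box of radius
  \<open>\<rho> r\<close> contains all points with components at most \<open>r\<close>; disturbances
  up to \<open>\<delta>\<close> are admissible at radius \<open>\<nu> \<delta>\<close>;
  \<open>G R\<close> bounds the components in the box of radius \<open>C * R\<close>. Sums stand in
  for the maxima.\<close>

lemma iss_gains:
  assumes "0 \<le> D" "1 \<le> n"
  shows "\<exists>k. (\<forall>j\<in>{1..n}. 0 < k j) \<and>
    (\<exists>\<alpha> \<gamma> \<tau>. class_K \<alpha> \<and> class_K \<gamma> \<and> class_K \<tau> \<and> iss_estimate n k D \<alpha> \<gamma> \<tau>)"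
proof -
  obtain k b T \<eta> C where kb: "\<forall>j\<in>{1..n}. 0 < k j \<and> 0 < b j"
    and T: "0 < T" and \<eta>: "0 < \<eta>" and C: "1 \<le> C"
    and contr: "\<forall>R>0. contracts n k D b T \<eta> C R"
    using contracting_gains[OF assms] by blast
  have b: "0 < b j" if "j \<in> {1..n}" for j using kb that by blast
  have n: "1 \<le> n" by (rule assms(2))
  interpret contracting_chain n k b D T \<eta> C
  proof
    show "contracts n k D b T \<eta> C R" if "0 < R" for R using contr that by blast
  qed (fact n b T \<eta> C)+
  define \<rho> where "\<rho> r = (\<Sum>j=1..n. (1 / b j * r) powr (1 / real (Suc n - j)))" for r
  define \<nu> where "\<nu> \<delta> = (\<Sum>i=1..n. (1 / \<eta> * \<delta>) powr (1 / real i))" for \<delta>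
  define G where "G R = (\<Sum>j=1..n. b j * (C * R) ^ (Suc n - j))" for R
  have "class_K \<rho>" unfolding \<rho>_def[abs_def]
  proof (rule class_K_sum)
    fix j assume j: "j \<in> {1..n}"
    show "class_K (\<lambda>r. (1 / b j * r) powr (1 / real (Suc n - j)))"
      by (rule class_K_compose[OF class_K_powr class_K_cmult[OF class_K_id]]) (use j b[OF j] in simp_all)
  qed (use n in simp_all)
  have "class_K \<nu>" unfolding \<nu>_def[abs_def]
  proof (rule class_K_sum)
    fix i assume i: "i \<in> {1..n}"
    show "class_K (\<lambda>\<delta>. (1 / \<eta> * \<delta>) powr (1 / real i))"
      by (rule class_K_compose[OF class_K_powr class_K_cmult[OF class_K_id]]) (use i \<eta> in simp_all)
  qed (use n in simp_all)
  have "class_K G" unfolding G_def[abs_def]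
  proof (rule class_K_sum)
    fix j assume j: "j \<in> {1..n}"
    show "class_K (\<lambda>R. b j * (C * R) ^ (Suc n - j))"
      by (rule class_K_cmult[OF class_K_compose[OF class_K_power class_K_cmult[OF class_K_id]]])
        (use j b[OF j] C in simp_all)
  qed (use n in simp_all)
  have powr_root: "x \<le> c * R ^ i" if "(1 / c * x) powr (1 / real i) \<le> R" "0 < c" "0 \<le> x" "0 < i" for c x R i
  proof -
    have "1 / c * x = ((1 / c * x) powr (1 / real i)) powr real i"
      using that by (simp add: powr_powr)
    also have "\<dots> = ((1 / c * x) powr (1 / real i)) ^ i"
      using that by (cases "x = 0") (simp_all add: powr_realpow)
    also have "\<dots> \<le> R ^ i" using that by (intro power_mono) auto
    finally show ?thesis using that by (simp add: field_simps)
  qed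
  have hbox_G: "\<bar>x j\<bar> \<le> G R" if "hbox n b (C * R) x" "j \<in> {1..n}" "0 \<le> R" for x j R
  proof -
    have "\<bar>x j\<bar> \<le> b j * (C * R) ^ (Suc n - j)" using that by (simp add: hbox_def)
    also have "\<dots> \<le> G R" unfolding G_def using that bnn C
      by (intro member_le_sum mult_nonneg_nonneg) auto
    finally show ?thesis .
  qed
  have "iss_estimate n k D (\<lambda>r. G (\<rho> r)) (\<lambda>\<delta>. G (\<nu> \<delta>)) (\<lambda>r. 2 * T * \<rho> r)"
    unfolding iss_estimate_def
  proof (intro allI impI, elim conjE)
    fix s t a d e r \<delta>
    assume st: "s \<le> t" and "0 \<le> r" "0 \<le> \<delta>" and sol: "chain_solution n k D s t a d e"
      and dist: "\<forall>u\<in>{s..t}. \<bar>a u - e u 1\<bar> \<le> \<delta> \<and> (\<forall>j\<in>{1..<n}. \<bar>d u j\<bar> \<le> \<delta>)"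
      and init: "\<forall>j\<in>{1..n}. \<bar>e s j\<bar> \<le> r"
    have nn: "0 \<le> \<rho> r" "0 \<le> \<nu> \<delta>"
      using \<open>class_K \<rho>\<close> \<open>class_K \<nu>\<close> \<open>0 \<le> r\<close> \<open>0 \<le> \<delta>\<close> by (simp_all add: class_K_nonneg)
    have "hbox n b (\<rho> r) (e s)" unfolding hbox_def
    proof
      fix j assume j: "j \<in> {1..n}"
      have "(1 / b j * r) powr (1 / real (Suc n - j)) \<le> \<rho> r"
        unfolding \<rho>_def using j by (intro member_le_sum) auto
      then have "r \<le> b j * \<rho> r ^ (Suc n - j)" using b[OF j] \<open>0 \<le> r\<close> j
        by (intro powr_root) auto
      then show "\<bar>e s j\<bar> \<le> b j * \<rho> r ^ (Suc n - j)" using init j by (meson order_trans)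
    qed
    moreover have "disturbance_le n \<eta> (\<nu> \<delta>) (a u) (d u) (e u)" if "s \<le> u" "u \<le> t" for u
    proof -
      have \<delta>: "\<delta> \<le> \<eta> * \<nu> \<delta> ^ i" if "i \<in> {1..n}" for i
      proof (rule powr_root)
        show "(1 / \<eta> * \<delta>) powr (1 / real i) \<le> \<nu> \<delta>"
          unfolding \<nu>_def using that by (intro member_le_sum) simp_all
      qed (use \<eta> \<open>0 \<le> \<delta>\<close> that in simp_all)
      have u: "\<bar>a u - e u 1\<bar> \<le> \<delta>" "\<And>j. j \<in> {1..<n} \<Longrightarrow> \<bar>d u j\<bar> \<le> \<delta>"
        using dist that by simp_all
      show ?thesis unfolding disturbance_le_def
      proof (intro conjI ballI)
        show "\<bar>a u - e u 1\<bar> \<le> \<eta> * \<nu> \<delta> ^ n" using u(1) \<delta>[of n] n by simp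
        fix j assume j: "j \<in> {1..<n}"
        then have "n - j \<in> {1..n}" by auto
        then show "\<bar>d u j\<bar> \<le> \<eta> * \<nu> \<delta> ^ (n - j)"
          using u(2)[OF j] \<delta> by (meson order_trans)
      qed
    qed
    ultimately have *: "hbox n b (C * max (\<rho> r) (\<nu> \<delta>)) (e t)"
      "s + 2 * T * \<rho> r \<le> t \<Longrightarrow> hbox n b (C * \<nu> \<delta>) (e t)"
      using hbox_iss[OF nn(2,1) st sol] by blast+
    have "\<bar>e t j\<bar> \<le> max (G (\<rho> r)) (G (\<nu> \<delta>))" if "j \<in> {1..n}" for j
      using hbox_G[OF *(1) that] nn class_K_max[OF \<open>class_K G\<close> nn] by simp
    moreover have "\<bar>e t j\<bar> \<le> G (\<nu> \<delta>)" if "j \<in> {1..n}" "s + 2 * T * \<rho> r \<le> t" for j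
      using hbox_G[OF *(2) that(1)] that(2) nn by simp
    ultimately show "\<forall>j\<in>{1..n}. \<bar>e t j\<bar> \<le> max (G (\<rho> r)) (G (\<nu> \<delta>)) \<and>
        (s + 2 * T * \<rho> r \<le> t \<longrightarrow> \<bar>e t j\<bar> \<le> G (\<nu> \<delta>))" by blast
  qed
  moreover have "class_K (\<lambda>r. G (\<rho> r))" "class_K (\<lambda>\<delta>. G (\<nu> \<delta>))" "class_K (\<lambda>r. 2 * T * \<rho> r)"
    using class_K_compose[OF \<open>class_K G\<close> \<open>class_K \<rho>\<close>] class_K_compose[OF \<open>class_K G\<close> \<open>class_K \<nu>\<close>]
      class_K_cmult[OF \<open>class_K \<rho>\<close>, of "2 * T"] T by simp_all
  moreover have "\<forall>j\<in>{1..n}. 0 < k j" using kb by blast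
  ultimately show ?thesis by blast
qed

section \<open>The cascade\<close>

text \<open>Errors of a cascade of \<open>m\<close> chains, chain \<open>i\<close> being of order \<open>i\<close>: component \<open>j\<close> of chain
  \<open>i > j\<close> is disturbed through \<open>\<omega>\<close>
    by the whole of chain \<open>j\<close>.\<close>

definition cascade_errors ::
  "nat \<Rightarrow> (nat \<Rightarrow> nat \<Rightarrow> real) \<Rightarrow> (nat \<Rightarrow> real) \<Rightarrow> (real \<Rightarrow> real) \<Rightarrow> real \<Rightarrow> real
     \<Rightarrow> (nat \<Rightarrow> real \<Rightarrow> nat \<Rightarrow> real) \<Rightarrow> bool" where
  "cascade_errors m k D \<omega> \<delta> t E \<longleftrightarrow>
     (\<forall>i\<in>{1..m}. \<exists>a d. chain_solution i (k i) (D i) 0 t a d (E i) \<and>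
        (\<forall>u\<in>{0..t}. \<bar>a u - E i u 1\<bar> \<le> \<delta> \<and>
           (\<forall>j\<in>{1..<i}. \<forall>\<rho>. (\<forall>l\<in>{1..j}. \<bar>E j u l\<bar> \<le> \<rho>) \<longrightarrow> \<bar>d u j\<bar> \<le> \<omega> \<rho> + \<delta>)))"

lemma cascade_errors_mono:
  assumes "cascade_errors m k D \<omega> \<delta> t E" "m' \<le> m" "t' \<le> t"
  shows "cascade_errors m' k D \<omega> \<delta> t' E"
  unfolding cascade_errors_def
proof
  fix i assume "i \<in> {1..m'}"
  then have "i \<in> {1..m}" using assms(2) by simp
  then obtain a d where sol: "chain_solution i (k i) (D i) 0 t a d (E i)"
    and bd: "\<forall>u\<in>{0..t}. \<bar>a u - E i u 1\<bar> \<le> \<delta> \<and>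
           (\<forall>j\<in>{1..<i}. \<forall>\<rho>. (\<forall>l\<in>{1..j}. \<bar>E j u l\<bar> \<le> \<rho>) \<longrightarrow> \<bar>d u j\<bar> \<le> \<omega> \<rho> + \<delta>)"
    using assms(1) unfolding cascade_errors_def by blast
  show "\<exists>a d. chain_solution i (k i) (D i) 0 t' a d (E i) \<and>
        (\<forall>u\<in>{0..t'}. \<bar>a u - E i u 1\<bar> \<le> \<delta> \<and>
           (\<forall>j\<in>{1..<i}. \<forall>\<rho>. (\<forall>l\<in>{1..j}. \<bar>E j u l\<bar> \<le> \<rho>) \<longrightarrow> \<bar>d u j\<bar> \<le> \<omega> \<rho> + \<delta>))"
  proof (intro exI conjI)
    show "chain_solution i (k i) (D i) 0 t' a d (E i)"
      by (rule chain_solution_subset[OF sol]) (use assms(3) in simp_all)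
    show "\<forall>u\<in>{0..t'}. \<bar>a u - E i u 1\<bar> \<le> \<delta> \<and>
           (\<forall>j\<in>{1..<i}. \<forall>\<rho>. (\<forall>l\<in>{1..j}. \<bar>E j u l\<bar> \<le> \<rho>) \<longrightarrow> \<bar>d u j\<bar> \<le> \<omega> \<rho> + \<delta>)"
      by (rule ballI, rule bspec[OF bd]) (use assms(3) in auto)
  qed
qed

definition cascade_estimate ::
  "nat \<Rightarrow> (nat \<Rightarrow> nat \<Rightarrow> real) \<Rightarrow> (nat \<Rightarrow> real) \<Rightarrow> (real \<Rightarrow> real)
     \<Rightarrow> (real \<Rightarrow> real) \<Rightarrow> (real \<Rightarrow> real) \<Rightarrow> (real \<Rightarrow> real) \<Rightarrow> bool" where
  "cascade_estimate m k D \<omega> A G \<tau> \<longleftrightarrow>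
     (\<forall>t r \<delta> E. 0 \<le> t \<and> 0 \<le> r \<and> 0 \<le> \<delta> \<and> cascade_errors m k D \<omega> \<delta> t E \<and>
        (\<forall>i\<in>{1..m}. \<forall>j\<in>{1..i}. \<bar>E i 0 j\<bar> \<le> r) \<longrightarrow>
        (\<forall>i\<in>{1..m}. \<forall>j\<in>{1..i}. \<bar>E i t j\<bar> \<le> max (A r) (G \<delta>) \<and> (\<tau> r \<le> t \<longrightarrow> \<bar>E i t j\<bar> \<le> G \<delta>)))"

lemma cascade_estimateD:
  assumes "cascade_estimate m k D \<omega> A G \<tau>" "0 \<le> t" "0 \<le> r" "0 \<le> \<delta>" "cascade_errors m k D \<omega> \<delta> t E"
    and "\<And>i j. \<lbrakk>i \<in> {1..m}; j \<in> {1..i}\<rbrakk> \<Longrightarrow> \<bar>E i 0 j\<bar> \<le> r" "i \<in> {1..m}" "j \<in> {1..i}"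
  shows "\<bar>E i t j\<bar> \<le> max (A r) (G \<delta>)" "\<tau> r \<le> t \<Longrightarrow> \<bar>E i t j\<bar> \<le> G \<delta>"
proof -
  have "\<forall>i\<in>{1..m}. \<forall>j\<in>{1..i}. \<bar>E i 0 j\<bar> \<le> r" using assms(6) by blast
  then have "\<forall>i\<in>{1..m}. \<forall>j\<in>{1..i}. \<bar>E i t j\<bar> \<le> max (A r) (G \<delta>) \<and> (\<tau> r \<le> t \<longrightarrow> \<bar>E i t j\<bar> \<le> G \<delta>)"
    using assms(1)[unfolded cascade_estimate_def, rule_format, of t r \<delta> E] assms(2-5) by blast
  then show "\<bar>E i t j\<bar> \<le> max (A r) (G \<delta>)" "\<tau> r \<le> t \<Longrightarrow> \<bar>E i t j\<bar> \<le> G \<delta>"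
    using assms(7,8) by blast+
qed

lemma iss_estimateD:
  assumes "iss_estimate n k D \<alpha> \<gamma> \<tau>" "s \<le> t" "0 \<le> r" "0 \<le> \<delta>" "chain_solution n k D s t a d e"
    and "\<And>u. \<lbrakk>s \<le> u; u \<le> t\<rbrakk> \<Longrightarrow> \<bar>a u - e u 1\<bar> \<le> \<delta>"
    and "\<And>u j. \<lbrakk>s \<le> u; u \<le> t; j \<in> {1..<n}\<rbrakk> \<Longrightarrow> \<bar>d u j\<bar> \<le> \<delta>"
    and "\<And>j. j \<in> {1..n} \<Longrightarrow> \<bar>e s j\<bar> \<le> r" "j \<in> {1..n}"
  shows "\<bar>e t j\<bar> \<le> max (\<alpha> r) (\<gamma> \<delta>)" "s + \<tau> r \<le> t \<Longrightarrow> \<bar>e t j\<bar> \<le> \<gamma> \<delta>"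
proof -
  have "\<forall>u\<in>{s..t}. \<bar>a u - e u 1\<bar> \<le> \<delta> \<and> (\<forall>j\<in>{1..<n}. \<bar>d u j\<bar> \<le> \<delta>)" using assms(6,7) by simp
  moreover have "\<forall>j\<in>{1..n}. \<bar>e s j\<bar> \<le> r" using assms(8) by blast
  ultimately have "\<forall>j\<in>{1..n}. \<bar>e t j\<bar> \<le> max (\<alpha> r) (\<gamma> \<delta>) \<and> (s + \<tau> r \<le> t \<longrightarrow> \<bar>e t j\<bar> \<le> \<gamma> \<delta>)"
    using assms(1)[unfolded iss_estimate_def, rule_format, of s t r \<delta> a d e] assms(2-5) by blast
  then show "\<bar>e t j\<bar> \<le> max (\<alpha> r) (\<gamma> \<delta>)" "s + \<tau> r \<le> t \<Longrightarrow> \<bar>e t j\<bar> \<le> \<gamma> \<delta>"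
    using assms(9) by blast+
qed

text \<open>Until \<open>\<tau> r\<close> the earlier chains may be large, and the new chain is only
  known to stay within \<open>A2 r\<close> and \<open>G2 \<delta>\<close>. From
  \<open>\<tau> r\<close> on the earlier errors are within \<open>G \<delta>\<close>, so the new
  chain is restarted there with disturbances bounded in terms of \<open>\<delta>\<close> alone, and
  settles after a further time that depends on its size at the restart.\<close>

lemma cascade_estimate_Suc:
  fixes m :: nat
  defines "n \<equiv> Suc m"
  assumes est: "cascade_estimate m k D \<omega> A G \<tau>" and K: "class_K A" "class_K G" "class_K \<tau>"
    and iss: "iss_estimate n (k n) (D n) \<alpha> \<gamma> \<sigma>"
      and K': "class_K \<alpha>" "class_K \<gamma>" "class_K \<sigma>"
    and \<omega>: "class_K \<omega>"
  shows "\<exists>A G \<tau>. class_K A \<and> class_K G \<and> class_K \<tau> \<and> cascade_estimate n k D \<omega> A G \<tau>"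
proof -
  \<comment> \<open>The factors 2 turn a sum into a maximum: \<open>max x y + \<delta>\<close> is at
    most \<open>max (2 * x) (2 * y + 2 * \<delta>)\<close>.\<close>
  define A1 where "A1 r = 2 * \<omega> (A r)" for r
  define G1 where "G1 \<delta> = 2 * \<omega> (G \<delta>) + 2 * \<delta>" for \<delta>
  define A2 where "A2 r = \<alpha> r + \<gamma> (A1 r)" for r
  define G2 where "G2 \<delta> = \<gamma> (G1 \<delta>)" for \<delta>
  have "class_K A1" unfolding A1_def[abs_def]
    by (rule class_K_cmult[OF class_K_compose[OF \<omega> K(1)]]) simp
  moreover have "class_K G1" unfolding G1_def[abs_def]
    by (rule class_K_add[OF class_K_cmult[OF class_K_compose[OF \<omega> K(2)]] class_K_cmult[OF class_K_id]]) simp_all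
  ultimately have K2: "class_K A2" "class_K G2"
    unfolding A2_def[abs_def] G2_def[abs_def]
    using class_K_add[OF K'(1) class_K_compose[OF K'(2)]] class_K_compose[OF K'(2)] by blast+
  have new: "\<bar>E n t j\<bar> \<le> max (A2 r) (G2 \<delta>)"
    "\<tau> r + \<sigma> (A2 r) \<le> t \<Longrightarrow> \<bar>E n t j\<bar> \<le> G2 \<delta> + \<alpha> (G2 \<delta>)"
    if "0 \<le> t" and r: "0 \<le> r" and \<delta>: "0 \<le> \<delta>"
      and err: "cascade_errors n k D \<omega> \<delta> t E"
      and init: "\<And>i j. \<lbrakk>i \<in> {1..n}; j \<in> {1..i}\<rbrakk> \<Longrightarrow> \<bar>E i 0 j\<bar> \<le> r" and j: "j \<in> {1..n}" for t r \<delta> E j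
  proof -
    have "n \<in> {1..n}" by (simp add: n_def)
    then obtain a d where sol: "chain_solution n (k n) (D n) 0 t a d (E n)"
      and bd: "\<forall>u\<in>{0..t}. \<bar>a u - E n u 1\<bar> \<le> \<delta> \<and>
           (\<forall>j\<in>{1..<n}. \<forall>\<rho>. (\<forall>l\<in>{1..j}. \<bar>E j u l\<bar> \<le> \<rho>) \<longrightarrow> \<bar>d u j\<bar> \<le> \<omega> \<rho> + \<delta>)"
      using err unfolding cascade_errors_def by blast
    have a: "\<bar>a u - E n u 1\<bar> \<le> \<delta>" if "0 \<le> u" "u \<le> t" for u
      using bd that by simp
    have d: "\<bar>d u j\<bar> \<le> \<omega> \<rho> + \<delta>" if "0 \<le> u" "u \<le> t" "j \<in> {1..<n}" "\<And>l. l \<in> {1..j} \<Longrightarrow> \<bar>E j u l\<bar> \<le> \<rho>" for u j \<rho>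
      using bspec[OF bd, of u] that by simp
    have old: "\<bar>E i u l\<bar> \<le> max (A r) (G \<delta>)" "\<tau> r \<le> u \<Longrightarrow> \<bar>E i u l\<bar> \<le> G \<delta>"
      if "0 \<le> u" "u \<le> t" "i \<in> {1..m}" "l \<in> {1..i}" for u i l
    proof -
      have err': "cascade_errors m k D \<omega> \<delta> u E"
        by (rule cascade_errors_mono[OF err _ that(2)]) (simp add: n_def)
      have init': "\<bar>E i 0 j\<bar> \<le> r" if "i \<in> {1..m}" "j \<in> {1..i}" for i j
        using init[of i j] that by (simp add: n_def)
      show "\<bar>E i u l\<bar> \<le> max (A r) (G \<delta>)"
        by (rule cascade_estimateD(1)[OF est that(1) r \<delta> err' init' that(3,4)])
      show "\<bar>E i u l\<bar> \<le> G \<delta>" if "\<tau> r \<le> u"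
        by (rule cascade_estimateD(2)[OF est \<open>0 \<le> u\<close> r \<delta> err' init' \<open>i \<in> {1..m}\<close> \<open>l \<in> {1..i}\<close> that])
    qed
    have nn: "0 \<le> A r" "0 \<le> G \<delta>" "0 \<le> A1 r" "0 \<le> G1 \<delta>" "0 \<le> A2 r" "0 \<le> G2 \<delta>" "0 \<le> \<tau> r"
      using \<open>class_K A1\<close> \<open>class_K G1\<close> K K2 r \<delta>
        by (simp_all add: class_K_nonneg)
    have \<omega>_nn: "0 \<le> \<omega> (A r)" "0 \<le> \<omega> (G \<delta>)" using \<omega> nn
      by (simp_all add: class_K_nonneg)
    have \<delta>_G1: "\<delta> \<le> G1 \<delta>" using \<omega>_nn \<delta> by (simp add: G1_def)
    have d_early: "\<bar>d u j\<bar> \<le> max (A1 r) (G1 \<delta>)" if "0 \<le> u" "u \<le> t" "j \<in> {1..<n}" for u j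
    proof -
      have "\<bar>d u j\<bar> \<le> \<omega> (max (A r) (G \<delta>)) + \<delta>"
        by (rule d[OF that]) (rule old(1), use that in \<open>auto simp: n_def\<close>)
      also have "\<dots> = max (\<omega> (A r)) (\<omega> (G \<delta>)) + \<delta>" using nn
        by (simp add: class_K_max[OF \<omega>])
      also have "\<dots> \<le> max (A1 r) (G1 \<delta>)" using \<delta> \<omega>_nn
        by (simp add: A1_def G1_def max_def)
      finally show ?thesis .
    qed
    have d_late: "\<bar>d u j\<bar> \<le> G1 \<delta>" if "\<tau> r \<le> u" "u \<le> t" "j \<in> {1..<n}" for u j
    proof -
      have u: "0 \<le> u" using that nn by simp
      have "\<bar>d u j\<bar> \<le> \<omega> (G \<delta>) + \<delta>"
        by (rule d[OF u that(2,3)]) (rule old(2), use that u in \<open>auto simp: n_def\<close>)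
      also have "\<dots> \<le> G1 \<delta>" using \<delta> \<omega>_nn by (simp add: G1_def)
      finally show ?thesis .
    qed
    have bound: "\<bar>E n u l\<bar> \<le> max (A2 r) (G2 \<delta>)" if "0 \<le> u" "u \<le> t" "l \<in> {1..n}" for u l
    proof -
      have "\<bar>E n u l\<bar> \<le> max (\<alpha> r) (\<gamma> (max (A1 r) (G1 \<delta>)))"
      proof (rule iss_estimateD(1)[OF iss \<open>0 \<le> u\<close> r _ _ _ _ _ that(3)])
        show "chain_solution n (k n) (D n) 0 u a d (E n)"
          by (rule chain_solution_subset[OF sol]) (use that in simp_all)
        show "\<bar>a x - E n x 1\<bar> \<le> max (A1 r) (G1 \<delta>)" if "0 \<le> x" "x \<le> u" for x
          using a[of x] that \<open>u \<le> t\<close> \<delta>_G1 by linarith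
        show "\<bar>d x j\<bar> \<le> max (A1 r) (G1 \<delta>)" if "0 \<le> x" "x \<le> u" "j \<in> {1..<n}" for x j
          using that \<open>u \<le> t\<close> by (intro d_early) linarith+
        show "\<bar>E n 0 j\<bar> \<le> r" if "j \<in> {1..n}" for j
          using init[OF \<open>n \<in> {1..n}\<close> that] .
      qed (use nn in simp)
      also have "\<dots> = max (\<alpha> r) (max (\<gamma> (A1 r)) (G2 \<delta>))"
        using nn by (simp add: class_K_max[OF K'(2)] G2_def)
      also have "\<dots> \<le> max (A2 r) (G2 \<delta>)"
        using class_K_nonneg[OF K'(1) r] class_K_nonneg[OF K'(2) nn(3)] by (auto simp: A2_def le_max_iff_disj)
      finally show ?thesis .
    qed
    show "\<bar>E n t j\<bar> \<le> max (A2 r) (G2 \<delta>)"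
      using bound[of t j] \<open>0 \<le> t\<close> j by simp
    show "\<bar>E n t j\<bar> \<le> G2 \<delta> + \<alpha> (G2 \<delta>)" if t: "\<tau> r + \<sigma> (A2 r) \<le> t"
    proof -
      have "0 \<le> \<sigma> (A2 r)" using K' nn by (simp add: class_K_nonneg)
      then have "\<tau> r \<le> t" using t by simp
      have *: "\<bar>E n t j\<bar> \<le> max (\<alpha> (max (A2 r) (G2 \<delta>))) (\<gamma> (G1 \<delta>))"
        "\<tau> r + \<sigma> (max (A2 r) (G2 \<delta>)) \<le> t \<Longrightarrow> \<bar>E n t j\<bar> \<le> \<gamma> (G1 \<delta>)"
      proof -
        have c: "chain_solution n (k n) (D n) (\<tau> r) t a d (E n)"
          by (rule chain_solution_subset[OF sol]) (use nn in simp_all)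
        have a': "\<bar>a x - E n x 1\<bar> \<le> G1 \<delta>" if "\<tau> r \<le> x" "x \<le> t" for x
          using a[of x] that \<delta>_G1 nn by linarith
        have i: "\<bar>E n (\<tau> r) j\<bar> \<le> max (A2 r) (G2 \<delta>)" if "j \<in> {1..n}" for j
          using bound[of "\<tau> r" j] nn \<open>\<tau> r \<le> t\<close> that by simp
        have m: "0 \<le> max (A2 r) (G2 \<delta>)" using nn by simp
        note I = iss_estimateD[OF iss \<open>\<tau> r \<le> t\<close> m nn(4) c a' d_late i j]
        show "\<bar>E n t j\<bar> \<le> max (\<alpha> (max (A2 r) (G2 \<delta>))) (\<gamma> (G1 \<delta>))" by (rule I(1)) simp_all
        show "\<bar>E n t j\<bar> \<le> \<gamma> (G1 \<delta>)" if "\<tau> r + \<sigma> (max (A2 r) (G2 \<delta>)) \<le> t" by (rule I(2)) (simp_all add: that)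
      qed
      have \<alpha>nn: "0 \<le> \<alpha> (G2 \<delta>)" using K' nn by (simp add: class_K_nonneg)
      show ?thesis
      \<comment> \<open>The restart radius is the larger of \<open>A2 r\<close> and
        \<open>G2 \<delta>\<close>. If it is \<open>A2 r\<close>, the waiting time
        \<open>\<sigma> (A2 r)\<close> is over and the chain has settled. Otherwise the radius
        depends on \<open>\<delta>\<close> alone, and the bound without settling, which contains
        \<open>\<alpha> (G2 \<delta>)\<close>, is good enough.\<close>
      proof (cases "G2 \<delta> \<le> A2 r")
        case True
        then have "\<bar>E n t j\<bar> \<le> \<gamma> (G1 \<delta>)" using *(2) t by (simp add: max_def)
        then show ?thesis using \<alpha>nn by (simp add: G2_def)
      next
        case False
        then have "max (A2 r) (G2 \<delta>) = G2 \<delta>" by simp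
        then have "\<bar>E n t j\<bar> \<le> max (\<alpha> (G2 \<delta>)) (G2 \<delta>)" using *(1)
          by (simp add: G2_def)
        then show ?thesis using \<alpha>nn nn by linarith
      qed
    qed
  qed
  define A' where "A' r = A r + A2 r" for r
  define G' where "G' \<delta> = G \<delta> + (G2 \<delta> + \<alpha> (G2 \<delta>))" for \<delta>
  define \<tau>' where "\<tau>' r = \<tau> r + \<sigma> (A2 r)" for r
  have "class_K A'" unfolding A'_def[abs_def] by (rule class_K_add[OF K(1) K2(1)])
  moreover have "class_K G'" unfolding G'_def[abs_def]
    by (rule class_K_add[OF K(2) class_K_add[OF K2(2) class_K_compose[OF K'(1) K2(2)]]])
  moreover have "class_K \<tau>'" unfolding \<tau>'_def[abs_def]
    by (rule class_K_add[OF K(3) class_K_compose[OF K'(3) K2(1)]])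
  moreover have "cascade_estimate n k D \<omega> A' G' \<tau>'"
    unfolding cascade_estimate_def
  proof (intro allI impI ballI, elim conjE)
    fix t r \<delta> E i j
    assume t: "0 \<le> t" and r: "0 \<le> r" and \<delta>: "0 \<le> \<delta>"
      and err: "cascade_errors n k D \<omega> \<delta> t E"
      and init0: "\<forall>i\<in>{1..n}. \<forall>j\<in>{1..i}. \<bar>E i 0 j\<bar> \<le> r"
        and i: "i \<in> {1..n}" and j: "j \<in> {1..i}"
    have init: "\<bar>E i 0 j\<bar> \<le> r" if "i \<in> {1..n}" "j \<in> {1..i}" for i j
      using init0 that by blast
    have nn: "0 \<le> A r" "0 \<le> G \<delta>" "0 \<le> A2 r" "0 \<le> G2 \<delta>" "0 \<le> \<tau> r"
      using K K2 r \<delta> by (simp_all add: class_K_nonneg)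
    have nn': "0 \<le> \<alpha> (G2 \<delta>)" "0 \<le> \<sigma> (A2 r)" using K' nn
      by (simp_all add: class_K_nonneg)
    have le: "A r \<le> A' r" "A2 r \<le> A' r" "G \<delta> \<le> G' \<delta>" "G2 \<delta> \<le> G' \<delta>" "G2 \<delta> + \<alpha> (G2 \<delta>) \<le> G' \<delta>"
      using nn nn' by (simp_all add: A'_def G'_def)
    show "\<bar>E i t j\<bar> \<le> max (A' r) (G' \<delta>) \<and> (\<tau>' r \<le> t \<longrightarrow> \<bar>E i t j\<bar> \<le> G' \<delta>)"
    proof (cases "i = n")
      case True
      have j': "j \<in> {1..n}" using j True by simp
      have "\<bar>E n t j\<bar> \<le> max (A2 r) (G2 \<delta>)" by (rule new(1)[OF t r \<delta> err init j'])
      moreover have "\<bar>E n t j\<bar> \<le> G2 \<delta> + \<alpha> (G2 \<delta>)" if "\<tau>' r \<le> t"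
        using new(2)[OF t r \<delta> err init j'] that by (simp add: \<tau>'_def)
      ultimately show ?thesis using le True by (smt (verit) max_def)
    next
      case False
      then have i': "i \<in> {1..m}" using i by (simp add: n_def)
      have err': "cascade_errors m k D \<omega> \<delta> t E"
        by (rule cascade_errors_mono[OF err]) (simp_all add: n_def)
      have init': "\<bar>E i 0 j\<bar> \<le> r" if "i \<in> {1..m}" "j \<in> {1..i}" for i j
        using init[of i j] that by (simp add: n_def)
      have "\<bar>E i t j\<bar> \<le> max (A r) (G \<delta>)"
        by (rule cascade_estimateD(1)[OF est t r \<delta> err' init' i' j])
      moreover have "\<bar>E i t j\<bar> \<le> G \<delta>" if "\<tau>' r \<le> t"
        by (rule cascade_estimateD(2)[OF est t r \<delta> err' init' i' j]) (use that nn' in \<open>simp_all add: \<tau>'_def\<close>)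
      ultimately show ?thesis using le by (smt (verit) max_def)
    qed
  qed
  ultimately show ?thesis by blast
qed

lemma cascade_gains:
  assumes "\<And>i. i \<in> {1..m} \<Longrightarrow>
      \<exists>\<alpha> \<gamma> \<tau>. class_K \<alpha> \<and> class_K \<gamma> \<and> class_K \<tau> \<and> iss_estimate i (k i) (D i) \<alpha> \<gamma> \<tau>"
    and "class_K \<omega>"
  shows "\<exists>A G \<tau>. class_K A \<and> class_K G \<and> class_K \<tau> \<and> cascade_estimate m k D \<omega> A G \<tau>"
  using assms(1)
proof (induction m)
  case 0
  have "cascade_estimate 0 k D \<omega> (\<lambda>x. x) (\<lambda>x. x) (\<lambda>x. x)"
    by (simp add: cascade_estimate_def)
  then show ?case using class_K_id by blast
next
  case (Suc m)
  have "\<exists>A G \<tau>. class_K A \<and> class_K G \<and> class_K \<tau> \<and> cascade_estimate m k D \<omega> A G \<tau>"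
    by (rule Suc.IH) (rule Suc.prems, simp)
  then obtain A G \<tau> where K: "class_K A" "class_K G" "class_K \<tau>" "cascade_estimate m k D \<omega> A G \<tau>"
    by blast
  obtain \<alpha> \<gamma> \<sigma> where "class_K \<alpha>" "class_K \<gamma>" "class_K \<sigma>" "iss_estimate (Suc m) (k (Suc m)) (D (Suc m)) \<alpha> \<gamma> \<sigma>"
    using Suc.prems[of "Suc m"] by auto
  then show ?case using K assms(2) by (intro cascade_estimate_Suc)
qed

section \<open>Moduli of continuity\<close>

text \<open>Averaging over \<open>{r..2 * r}\<close> makes a monotone function continuous:
  \<open>\<psi> r\<close> is an increment of a primitive of \<open>\<phi>\<close> divided by
  \<open>r\<close>. It lies between \<open>\<phi> r\<close> and \<open>\<phi> (2 * r)\<close>, hence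
  tends to 0 at 0. Adding \<open>r\<close> makes it strictly increasing.\<close>

lemma class_K_majorant:
  fixes \<phi> :: "real \<Rightarrow> real"
  assumes mono: "mono_on {0..} \<phi>" and nonneg: "\<And>r. 0 \<le> r \<Longrightarrow> 0 \<le> \<phi> r"
    and lim: "(\<phi> \<longlongrightarrow> 0) (at_right 0)" and zero: "\<phi> 0 = 0"
  shows "\<exists>\<omega>. class_K \<omega> \<and> (\<forall>r\<ge>0. \<phi> r \<le> \<omega> r)"
proof -
  define \<psi> where "\<psi> r = integral {1..2} (\<lambda>s. \<phi> (r * s))" for r
  have mono': "\<phi> x \<le> \<phi> y" if "0 \<le> x" "x \<le> y" for x y
    using mono_onD[OF mono, of x y] that by simp
  have int: "\<phi> integrable_on {a..b}" if "0 \<le> a" for a b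
    using that by (intro integrable_on_mono_on mono_on_subset[OF mono]) auto
  have int_scaled: "(\<lambda>s. \<phi> (r * s)) integrable_on {1..2}" if "0 \<le> r" for r
    using that by (intro integrable_on_mono_on) (auto intro!: mono_onI mono' mult_left_mono)
  have lower: "\<phi> r \<le> \<psi> r" if "0 \<le> r" for r
  proof -
    have "integral {1..2} (\<lambda>s::real. \<phi> r) \<le> \<psi> r" unfolding \<psi>_def
      by (intro integral_le int_scaled mono') (use that in \<open>auto intro: mult_left_mono[of 1 _ r, simplified]\<close>)
    then show ?thesis by simp
  qed
  have upper: "\<psi> r \<le> \<phi> (2 * r)" if "0 \<le> r" for r
  proof -
    have "\<psi> r \<le> integral {1..2} (\<lambda>s::real. \<phi> (2 * r))" unfolding \<psi>_def
      by (intro integral_le int_scaled mono') (use that in \<open>auto intro: mult_left_mono[of _ 2 r] simp: mult.commute[of 2]\<close>)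
    then show ?thesis by simp
  qed
  have \<psi>_nn: "0 \<le> \<psi> r" if "0 \<le> r" for r using nonneg[OF that] lower[OF that] by simp
  have \<psi>_mono: "\<psi> x \<le> \<psi> y" if "0 \<le> x" "x \<le> y" for x y
    unfolding \<psi>_def using that by (intro integral_le int_scaled mono' mult_right_mono) auto
  have \<psi>_eq: "\<psi> r = (integral {0..2 * r} \<phi> - integral {0..r} \<phi>) / r" if "0 < r" for r
  proof -
    have "(\<phi> has_integral integral {r..2 * r} \<phi>) {r..2 * r}"
      using int[of r "2 * r"] that by (simp add: has_integral_integral)
    from has_integral_stretch_real[OF this, of r]
    have "((\<lambda>s. \<phi> (r * s)) has_integral integral {r..2 * r} \<phi> / r) {1..2}"
      using that by (simp add: field_simps)
    then have "\<psi> r = integral {r..2 * r} \<phi> / r" unfolding \<psi>_def by (rule integral_unique)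
    moreover have "integral {0..r} \<phi> + integral {r..2 * r} \<phi> = integral {0..2 * r} \<phi>"
      using that int[of 0 "2 * r"] by (intro Henstock_Kurzweil_Integration.integral_combine) auto
    ultimately show ?thesis by simp
  qed
  have cont: "isCont \<psi> r" if "0 < r" for r
  proof -
    have c: "continuous_on {0..2 * (2 * r)} (\<lambda>x. integral {0..x} \<phi>)"
      by (rule indefinite_integral_continuous_1[OF int]) simp
    have "continuous_on {0<..<2 * r} (\<lambda>r. (integral {0..2 * r} \<phi> - integral {0..r} \<phi>) / r)"
      by (intro continuous_on_divide continuous_on_diff continuous_on_id
          continuous_on_compose2[OF c] continuous_on_mult_left) auto
    moreover have "continuous_on {0<..<2 * r} \<psi> \<longleftrightarrow>
        continuous_on {0<..<2 * r} (\<lambda>r. (integral {0..2 * r} \<phi> - integral {0..r} \<phi>) / r)"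
      by (rule continuous_on_cong) (auto simp: \<psi>_eq)
    ultimately have "continuous_on {0<..<2 * r} \<psi>" by simp
    then show ?thesis using that by (simp add: continuous_on_eq_continuous_at)
  qed
  have "\<psi> 0 = 0" using upper[of 0] lower[of 0] zero by simp
  have cont0: "continuous (at 0 within {0..}) \<psi>"
    unfolding continuous_within \<open>\<psi> 0 = 0\<close>
  proof (rule tendsto_sandwich)
    have ev: "\<forall>\<^sub>F x in at (0::real) within {0..}. x \<in> {0..}"
      unfolding eventually_at_filter by simp
    show "\<forall>\<^sub>F x in at 0 within {0..}. 0 \<le> \<psi> x"
      by (rule eventually_mono[OF ev \<psi>_nn]) simp
    show "\<forall>\<^sub>F x in at 0 within {0..}. \<psi> x \<le> \<phi> (2 * x)"
      by (rule eventually_mono[OF ev upper]) simp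
    have "filterlim (\<lambda>x::real. 2 * x) (at_right 0) (at_right 0)"
      by (intro filterlim_times_pos[of "\<lambda>x. x" 0]) (simp_all add: filterlim_ident)
    then have "((\<lambda>x. \<phi> (2 * x)) \<longlongrightarrow> 0) (at_right 0)"
      by (rule filterlim_compose[OF lim])
    then show "((\<lambda>x. \<phi> (2 * x)) \<longlongrightarrow> 0) (at 0 within {0..})"
      by (simp add: at_within_Ici_at_right)
  qed simp
  have "continuous_on {0..} \<psi>"
    unfolding continuous_on_eq_continuous_within
  proof
    fix x :: real assume "x \<in> {0..}"
    then show "continuous (at x within {0..}) \<psi>"
      using cont0 cont[of x] by (cases "x = 0") (auto intro: continuous_at_imp_continuous_at_within)
  qed
  then have "class_K (\<lambda>r. \<psi> r + r)"
    unfolding class_K_def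
  proof (intro conjI)
    show "continuous_on {0..} (\<lambda>r. \<psi> r + r)"
      if "continuous_on {0..} \<psi>" using that by (intro continuous_on_add continuous_on_id)
    show "strict_mono_on {0..} (\<lambda>r. \<psi> r + r)"
    proof (rule strict_mono_onI)
      fix x y :: real assume "x \<in> {0..}" "x < y"
      then show "\<psi> x + x < \<psi> y + y" using \<psi>_mono[of x y] by simp
    qed
  qed (simp add: \<open>\<psi> 0 = 0\<close>)
  moreover have "\<phi> r \<le> \<psi> r + r" if "0 \<le> r" for r using lower[OF that] that by simp
  ultimately show ?thesis by blast
qed

text \<open>Tychonoff over all indices: extensional functions are those whose factors outside
  \<open>{1..j}\<close> are the singleton of \<open>undefined\<close>.\<close>

lemma compact_PiE_Icc:
  fixes c :: real
  shows "compact ({1..j::nat} \<rightarrow>\<^sub>E {- c..c})"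
proof -
  have "({1..j} \<rightarrow>\<^sub>E {- c..c}) = PiE UNIV (\<lambda>l. if l \<in> {1..j} then {- c..c} else {undefined})"
    by (auto simp: PiE_iff extensional_def split: if_splits)
  moreover have "compactin (product_topology (\<lambda>_. euclidean) UNIV)
      (PiE UNIV (\<lambda>l. if l \<in> {1..j} then {- c..c} else {undefined}))"
    unfolding compactin_PiE by auto
  ultimately show ?thesis by (simp add: euclidean_product_topology)
qed

context
  fixes F :: "real^'p \<Rightarrow> (nat \<Rightarrow> real) \<Rightarrow> real" and j :: nat and c q :: real
  assumes F: "continuous_on (UNIV \<times> ({1..j} \<rightarrow>\<^sub>E UNIV)) (\<lambda>(u, x). F u x)"
begin

lemma bounded_on_box:
  "\<exists>B\<ge>0. \<forall>u z. norm u \<le> q \<and> (\<forall>l\<in>{1..j}. \<bar>z l\<bar> \<le> c) \<longrightarrow> \<bar>F u (restrict z {1..j})\<bar> \<le> B"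
proof -
  have "compact ((\<lambda>(u, x). F u x) ` (cball 0 q \<times> ({1..j} \<rightarrow>\<^sub>E {- c..c})))"
    by (intro compact_continuous_image compact_Times compact_cball compact_PiE_Icc
        continuous_on_subset[OF F]) auto
  then have "bounded ((\<lambda>(u, x). F u x) ` (cball 0 q \<times> ({1..j} \<rightarrow>\<^sub>E {- c..c})))"
    by (rule compact_imp_bounded)
  then obtain B where B: "\<forall>x\<in>(\<lambda>(u, x). F u x) ` (cball 0 q \<times> ({1..j} \<rightarrow>\<^sub>E {- c..c})). norm x \<le> B"
    unfolding bounded_iff by blast
  have "\<bar>F u (restrict z {1..j})\<bar> \<le> \<bar>B\<bar>" if "norm u \<le> q" "\<forall>l\<in>{1..j}. \<bar>z l\<bar> \<le> c" for u z
  proof -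
    have "z l \<in> {- c..c}" if "l \<in> {1..j}" for l
      using bspec[OF \<open>\<forall>l\<in>{1..j}. \<bar>z l\<bar> \<le> c\<close> that]
        unfolding atLeastAtMost_iff by linarith
    then have "restrict z {1..j} \<in> {1..j} \<rightarrow>\<^sub>E {- c..c}"
      by (intro restrict_PiE_iff[THEN iffD2] ballI)
    then have "(u, restrict z {1..j}) \<in> cball 0 q \<times> ({1..j} \<rightarrow>\<^sub>E {- c..c})"
      using that by simp
    then have "F u (restrict z {1..j}) \<in> (\<lambda>(u, x). F u x) ` (cball 0 q \<times> ({1..j} \<rightarrow>\<^sub>E {- c..c}))"
      by (rule rev_image_eqI) simp
    from bspec[OF B this] show ?thesis by simp
  qed
  then show ?thesis by (intro exI[of _ "\<bar>B\<bar>"]) auto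
qed

text \<open>Only \<open>z\<close> is confined to a bounded set, \<open>zh\<close> is not, and
  \<open>\<rho>\<close> may be large. Writing \<open>zh = z + \<rho> * e\<close> with
  \<open>e\<close> in the unit cube makes the supremum for each fixed \<open>\<rho>\<close> one over
  the same compact set \<open>K\<close>. It is monotone, since a smaller \<open>\<rho>\<close> can
  be absorbed by shrinking \<open>e\<close>, and tends to 0 with \<open>\<rho>\<close> by uniform
  continuity.\<close>

lemma perturbation_modulus:
  assumes "0 \<le> c" "0 \<le> q"
  shows "\<exists>\<omega>. class_K \<omega> \<and> (\<forall>u z zh \<rho>. norm u \<le> q \<and> (\<forall>l\<in>{1..j}. \<bar>z l\<bar> \<le> c) \<and> 0 \<le> \<rho> \<and>
      (\<forall>l\<in>{1..j}. \<bar>zh l - z l\<bar> \<le> \<rho>) \<longrightarrow>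
      \<bar>F u (restrict zh {1..j}) - F u (restrict z {1..j})\<bar> \<le> \<omega> \<rho>)"
proof -
  define K where "K = cball (0::real^'p) q \<times> ({1..j} \<rightarrow>\<^sub>E {- c..c}) \<times> ({1..j} \<rightarrow>\<^sub>E {- (1::real)..1})"
  define h where "h = (\<lambda>(\<rho>, u, x, e). \<bar>F u (restrict (\<lambda>l. x l + \<rho> * e l) {1..j}) - F u (restrict x {1..j})\<bar>)"
  have "compact K" unfolding K_def by (intro compact_Times compact_cball compact_PiE_Icc)
  \<comment> \<open>The slab over \<open>{0..1}\<close> serves the limit at 0, the slice at
    \<open>R\<close> the finiteness of the supremum there.\<close>
  have h_cont: "continuous_on ({0..1} \<times> K \<union> {R} \<times> K) h" for R
  proof -
    have c1: "continuous_on S (\<lambda>y::real \<times> (real^'p) \<times> (nat \<Rightarrow> real) \<times> (nat \<Rightarrow> real).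
        restrict (\<lambda>l. fst (snd (snd y)) l + s y * snd (snd (snd y)) l) {1..j})"
      if s: "continuous_on S s" for S s
    proof (rule continuous_on_coordinatewise_then_product)
      fix l
      have "continuous_on S (\<lambda>y::real \<times> (real^'p) \<times> (nat \<Rightarrow> real) \<times> (nat \<Rightarrow> real). fst (snd (snd y)))"
        "continuous_on S (\<lambda>y::real \<times> (real^'p) \<times> (nat \<Rightarrow> real) \<times> (nat \<Rightarrow> real). snd (snd (snd y)))"
        by (intro continuous_on_fst continuous_on_snd continuous_on_id)+
      note this[THEN continuous_on_product_then_coordinatewise, of l]
      then have "continuous_on S (\<lambda>y. fst (snd (snd y)) l + s y * snd (snd (snd y)) l)"
        by (rule continuous_on_add[OF _ continuous_on_mult[OF s]])
      then show "continuous_on S (\<lambda>y. restrict (\<lambda>l. fst (snd (snd y)) l + s y * snd (snd (snd y)) l) {1..j} l)"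
        by (cases "l \<in> {1..j}") (simp_all add: restrict_def del: atLeastAtMost_iff)
    qed
    have c2: "continuous_on S (\<lambda>y. F (fst (snd y)) (restrict (\<lambda>l. fst (snd (snd y)) l + s y * snd (snd (snd y)) l) {1..j}))"
      if "continuous_on S s" for S
        and s :: "real \<times> (real^'p) \<times> (nat \<Rightarrow> real) \<times> (nat \<Rightarrow> real) \<Rightarrow> real"
    proof -
      have "continuous_on S (\<lambda>y. (\<lambda>(u, x). F u x) (fst (snd y), restrict (\<lambda>l. fst (snd (snd y)) l + s y * snd (snd (snd y)) l) {1..j}))"
      proof (rule continuous_on_compose2[OF F])
        show "continuous_on S (\<lambda>y. (fst (snd y), restrict (\<lambda>l. fst (snd (snd y)) l + s y * snd (snd (snd y)) l) {1..j}))"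
          by (rule continuous_on_Pair[OF continuous_on_fst[OF continuous_on_snd[OF continuous_on_id]] c1[OF that]])
      qed auto
      then show ?thesis by simp
    qed
    have "continuous_on S (\<lambda>y. \<bar>F (fst (snd y)) (restrict (\<lambda>l. fst (snd (snd y)) l + fst y * snd (snd (snd y)) l) {1..j})
        - F (fst (snd y)) (restrict (\<lambda>l. fst (snd (snd y)) l + 0 * snd (snd (snd y)) l) {1..j})\<bar>)" for S
      by (rule continuous_on_rabs[OF continuous_on_diff[OF c2[OF continuous_on_fst[OF continuous_on_id]] c2[OF continuous_on_const]]])
    then show ?thesis by (simp add: h_def case_prod_unfold)
  qed
  define \<phi> where "\<phi> \<rho> = (SUP k\<in>K. h (\<rho>, k))" for \<rho>
  define z0 :: "nat \<Rightarrow> real" where "z0 = restrict (\<lambda>_. 0) {1..j}"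
  have z0: "(0, z0, z0) \<in> K" using assms by (auto simp: K_def z0_def)
  then have "K \<noteq> {}" by blast
  have bdd: "bdd_above ((\<lambda>k. h (\<rho>, k)) ` K)" for \<rho>
  proof -
    have "continuous_on K (\<lambda>k. h (\<rho>, k))"
      by (rule continuous_on_compose2[OF h_cont[of \<rho>]]) (auto intro!: continuous_on_Pair continuous_on_id)
    then show ?thesis
      using \<open>compact K\<close>
        by (intro bounded_imp_bdd_above compact_imp_bounded compact_continuous_image)
  qed
  have h_le: "h (\<rho>, k) \<le> \<phi> \<rho>" if "k \<in> K" for \<rho> k
    unfolding \<phi>_def by (rule cSUP_upper[OF that bdd])
  have h0: "h (0, k) = 0" for k by (simp add: h_def case_prod_unfold)
  have \<phi>_nn: "0 \<le> \<phi> \<rho>" for \<rho>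
  proof -
    have "0 \<le> h (\<rho>, 0, z0, z0)" by (simp add: h_def)
    also have "\<dots> \<le> \<phi> \<rho>" by (rule h_le[OF z0])
    finally show ?thesis .
  qed
  have "\<exists>\<omega>. class_K \<omega> \<and> (\<forall>r\<ge>0. \<phi> r \<le> \<omega> r)"
  proof (rule class_K_majorant)
    show "mono_on {0..} \<phi>"
    proof (rule mono_onI)
      fix r s :: real assume rs: "r \<in> {0..}" "s \<in> {0..}" "r \<le> s"
      show "\<phi> r \<le> \<phi> s"
      proof (cases "s = 0")
        case False
        then have "0 < s" using rs by simp
        show ?thesis unfolding \<phi>_def[of r]
        proof (rule cSUP_least[OF \<open>K \<noteq> {}\<close>])
          fix k assume "k \<in> K"
          then obtain u x e where k: "k = (u, x, e)" "u \<in> cball 0 q" "x \<in> {1..j} \<rightarrow>\<^sub>E {- c..c}" "e \<in> {1..j} \<rightarrow>\<^sub>E {- 1..1}"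
            unfolding K_def by blast
          define e' where "e' = restrict (\<lambda>l. r / s * e l) {1..j}"
          have "r / s * e l \<in> {- 1..1}" if "l \<in> {1..j}" for l
          proof -
            have "\<bar>e l\<bar> \<le> 1" using k(4) that by (auto simp: PiE_iff abs_le_iff)
            moreover have "\<bar>r / s\<bar> \<le> 1" using rs \<open>0 < s\<close> by simp
            ultimately have "\<bar>r / s\<bar> * \<bar>e l\<bar> \<le> 1" by (intro mult_le_one) auto
            then have "\<bar>r / s * e l\<bar> \<le> 1" by (simp only: abs_mult)
            then show ?thesis unfolding atLeastAtMost_iff by linarith
          qed
          then have "e' \<in> {1..j} \<rightarrow>\<^sub>E {- 1..1}" unfolding e'_def
            by (intro restrict_PiE_iff[THEN iffD2] ballI)
          then have "(u, x, e') \<in> K" using k by (simp add: K_def)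
          moreover have "restrict (\<lambda>l. x l + s * e' l) {1..j} = restrict (\<lambda>l. x l + r * e l) {1..j}"
            using \<open>0 < s\<close> by (auto simp: e'_def)
          then have "h (r, k) = h (s, u, x, e')" by (simp add: h_def k)
          ultimately show "h (r, k) \<le> \<phi> s" using h_le by simp
        qed
      qed (use rs in simp)
    qed
    show "\<phi> 0 = 0" using \<open>K \<noteq> {}\<close> by (simp add: \<phi>_def h0)
    show "(\<phi> \<longlongrightarrow> 0) (at_right 0)"
    proof (rule tendstoI)
      fix \<epsilon> :: real assume "0 < \<epsilon>"
      have "uniformly_continuous_on ({0..1} \<times> K) h"
        using \<open>compact K\<close> by (intro compact_uniformly_continuous compact_Times compact_Icc
            continuous_on_subset[OF h_cont]) auto
      then obtain \<delta> where "\<delta> > 0"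
        and \<delta>: "\<And>y y'. \<lbrakk>y \<in> {0..1} \<times> K; y' \<in> {0..1} \<times> K; dist y' y < \<delta>\<rbrakk>
          \<Longrightarrow> dist (h y') (h y) < \<epsilon> / 2"
        using \<open>0 < \<epsilon>\<close>
          by (rule_tac uniformly_continuous_onE[of _ h "\<epsilon> / 2"]) auto
      have "\<phi> r \<le> \<epsilon> / 2" if "0 < r" "r < min \<delta> 1" for r
        unfolding \<phi>_def
      proof (rule cSUP_least[OF \<open>K \<noteq> {}\<close>])
        fix k assume "k \<in> K"
        then have "dist (h (r, k)) (h (0, k)) < \<epsilon> / 2"
          using that by (intro \<delta>) (auto simp: dist_Pair_Pair)
        then show "h (r, k) \<le> \<epsilon> / 2" by (simp add: h0)
      qed
      then have "dist (\<phi> r) 0 < \<epsilon>" if "0 < r" "r < min \<delta> 1" for r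
        using \<phi>_nn[of r] that \<open>0 < \<epsilon>\<close> by (force simp: dist_real_def)
      moreover have "\<forall>\<^sub>F r in at_right 0. r \<in> {0<..<min \<delta> 1}"
        using \<open>\<delta> > 0\<close> by (intro eventually_at_right_real) simp
      ultimately show "\<forall>\<^sub>F r in at_right 0. dist (\<phi> r) 0 < \<epsilon>"
        by (auto elim: eventually_mono)
    qed
  qed (rule \<phi>_nn)
  then obtain \<omega> where \<omega>: "class_K \<omega>" "\<And>r. 0 \<le> r \<Longrightarrow> \<phi> r \<le> \<omega> r" by blast
  have "\<bar>F u (restrict zh {1..j}) - F u (restrict z {1..j})\<bar> \<le> \<omega> \<rho>"
    if u: "norm u \<le> q" and z: "\<forall>l\<in>{1..j}. \<bar>z l\<bar> \<le> c"
      and \<rho>: "0 \<le> \<rho>"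
      and zh: "\<forall>l\<in>{1..j}. \<bar>zh l - z l\<bar> \<le> \<rho>" for u z zh \<rho>
  proof -
    \<comment> \<open>For \<open>\<rho> = 0\<close> the quotient is 0 by convention, which is the
      right value because \<open>zh\<close> and \<open>z\<close> then agree.\<close>
    define e where "e = restrict (\<lambda>l. (zh l - z l) / \<rho>) {1..j}"
    have eq: "\<rho> * e l = zh l - z l" if "l \<in> {1..j}" for l
      using zh that by (cases "\<rho> = 0") (auto simp: e_def)
    have "(zh l - z l) / \<rho> \<in> {- 1..1}" if "l \<in> {1..j}" for l
    proof -
      have "\<bar>(zh l - z l) / \<rho>\<bar> \<le> 1" using zh that \<rho> by (cases "\<rho> = 0") auto
      then show ?thesis unfolding atLeastAtMost_iff by linarith
    qed
    then have "e \<in> {1..j} \<rightarrow>\<^sub>E {- 1..1}" unfolding e_def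
      by (intro restrict_PiE_iff[THEN iffD2] ballI)
    moreover have "z l \<in> {- c..c}" if "l \<in> {1..j}" for l
      using bspec[OF z that] unfolding atLeastAtMost_iff by linarith
    then have "restrict z {1..j} \<in> {1..j} \<rightarrow>\<^sub>E {- c..c}"
      by (intro restrict_PiE_iff[THEN iffD2] ballI)
    ultimately have "(u, restrict z {1..j}, e) \<in> K" using u by (simp add: K_def)
    then have "h (\<rho>, u, restrict z {1..j}, e) \<le> \<omega> \<rho>"
      using h_le \<omega>(2)[OF \<rho>] by (meson order_trans)
    moreover have "restrict (\<lambda>l. restrict z {1..j} l + \<rho> * e l) {1..j} = restrict zh {1..j}"
      by (rule ext) (simp add: eq restrict_def)
    ultimately show ?thesis by (simp add: h_def)
  qed
  then show ?thesis using \<omega>(1) by blast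
qed

end

section \<open>Absolutely continuous functions and differential inclusions\<close>

lemma abs_continuous_imp_continuous_on:
  assumes "abs_continuous_on_interval f c d"
  shows "continuous_on {c..d} f"
  unfolding continuous_on_iff
proof (intro ballI allI impI)
  fix x \<epsilon> :: real assume x: "x \<in> {c..d}" and "0 < \<epsilon>"
  then obtain \<delta> where "\<delta> > 0"
    and \<delta>: "\<And>(n::nat) a b. \<lbrakk>\<forall>l<n. c \<le> a l \<and> a l \<le> b l \<and> b l \<le> d;
      disjoint_family_on (\<lambda>l. {a l<..<b l}) {..<n}; (\<Sum>l<n. b l - a l) < \<delta>\<rbrakk>
      \<Longrightarrow> (\<Sum>l<n. \<bar>f (b l) - f (a l)\<bar>) < \<epsilon>"
    using assms unfolding abs_continuous_on_interval_def by meson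
  have "dist (f y) (f x) < \<epsilon>" if y: "y \<in> {c..d}" "dist y x < \<delta>" for y
  proof -
    have "(\<Sum>l<1::nat. \<bar>f (max x y) - f (min x y)\<bar>) < \<epsilon>"
      by (rule \<delta>[of 1 "\<lambda>_. min x y" "\<lambda>_. max x y"])
        (use x y in \<open>auto simp: disjoint_family_on_def dist_real_def max_def min_def\<close>)
    then show ?thesis by (auto simp: dist_real_def max_def min_def split: if_splits)
  qed
  then show "\<exists>\<delta>>0. \<forall>y\<in>{c..d}. dist y x < \<delta> \<longrightarrow> dist (f y) (f x) < \<epsilon>"
    using \<open>\<delta> > 0\<close> by blast
qed

lemma abs_continuous_minus:
  assumes "abs_continuous_on_interval f c d"
  shows "abs_continuous_on_interval (\<lambda>x. - f x) c d"
proof -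
  have "\<bar>- f x - - f y\<bar> = \<bar>f x - f y\<bar>" for x y by simp
  then show ?thesis using assms unfolding abs_continuous_on_interval_def by presburger
qed

lemma abs_continuous_diff:
  assumes f: "abs_continuous_on_interval f c d" and g: "abs_continuous_on_interval g c d"
  shows "abs_continuous_on_interval (\<lambda>x. f x - g x) c d"
  unfolding abs_continuous_on_interval_def
proof (intro allI impI)
  fix \<epsilon> :: real assume "0 < \<epsilon>"
  then have e2: "\<epsilon> / 2 > 0" by simp
  obtain \<delta>1 where \<delta>1: "\<delta>1 > 0" "\<And>(n::nat) a b. (\<forall>l<n. c \<le> a l \<and> a l \<le> b l \<and> b l \<le> d) \<and>
      disjoint_family_on (\<lambda>l. {a l<..<b l}) {..<n} \<and> (\<Sum>l<n. b l - a l) < \<delta>1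
      \<Longrightarrow> (\<Sum>l<n. \<bar>f (b l) - f (a l)\<bar>) < \<epsilon> / 2"
    using f e2 unfolding abs_continuous_on_interval_def by meson
  obtain \<delta>2 where \<delta>2: "\<delta>2 > 0" "\<And>(n::nat) a b. (\<forall>l<n. c \<le> a l \<and> a l \<le> b l \<and> b l \<le> d) \<and>
      disjoint_family_on (\<lambda>l. {a l<..<b l}) {..<n} \<and> (\<Sum>l<n. b l - a l) < \<delta>2
      \<Longrightarrow> (\<Sum>l<n. \<bar>g (b l) - g (a l)\<bar>) < \<epsilon> / 2"
    using g e2 unfolding abs_continuous_on_interval_def by meson
  have "(\<Sum>l<n. \<bar>(f (b l) - g (b l)) - (f (a l) - g (a l))\<bar>) < \<epsilon>"
    if "(\<forall>l<n. c \<le> a l \<and> a l \<le> b l \<and> b l \<le> d) \<and>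
      disjoint_family_on (\<lambda>l. {a l<..<b l}) {..<n} \<and> (\<Sum>l<n. b l - a l) < min \<delta>1 \<delta>2" for n :: nat and a b
  proof -
    have "(\<Sum>l<n. \<bar>(f (b l) - g (b l)) - (f (a l) - g (a l))\<bar>)
        \<le> (\<Sum>l<n. \<bar>f (b l) - f (a l)\<bar> + \<bar>g (b l) - g (a l)\<bar>)" by (intro sum_mono) linarith
    also have "\<dots> < \<epsilon>" using \<delta>1(2)[of n a b] \<delta>2(2)[of n a b] that
      by (simp add: sum.distrib)
    finally show ?thesis .
  qed
  then show "\<exists>\<delta>>0. \<forall>(n::nat) a b. (\<forall>l<n. c \<le> a l \<and> a l \<le> b l \<and> b l \<le> d) \<and>
      disjoint_family_on (\<lambda>l. {a l<..<b l}) {..<n} \<and> (\<Sum>l<n. b l - a l) < \<delta> \<longrightarrow>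
      (\<Sum>l<n. \<bar>f (b l) - g (b l) - (f (a l) - g (a l))\<bar>) < \<epsilon>"
    using \<delta>1(1) \<delta>2(1) by (intro exI[of _ "min \<delta>1 \<delta>2"]) auto
qed

lemma Lipschitz_imp_abs_continuous:
  assumes "\<And>x y. \<lbrakk>c \<le> x; x \<le> y; y \<le> d\<rbrakk> \<Longrightarrow> \<bar>f y - f x\<bar> \<le> K * (y - x)"
  shows "abs_continuous_on_interval f c d"
  unfolding abs_continuous_on_interval_def
proof (intro allI impI)
  fix \<epsilon> :: real assume "0 < \<epsilon>"
  define K' where "K' = \<bar>K\<bar> + 1"
  have "K' > 0" by (simp add: K'_def)
  have "(\<Sum>l<n. \<bar>f (b l) - f (a l)\<bar>) < \<epsilon>"
    if *: "(\<forall>l<n. c \<le> a l \<and> a l \<le> b l \<and> b l \<le> d)"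
      and "(\<Sum>l<n. b l - a l) < \<epsilon> / K'" for n :: nat and a b
  proof -
    have "(\<Sum>l<n. \<bar>f (b l) - f (a l)\<bar>) \<le> (\<Sum>l<n. K' * (b l - a l))"
    proof (rule sum_mono)
      fix l assume "l \<in> {..<n}"
      then have l: "c \<le> a l" "a l \<le> b l" "b l \<le> d" using * by auto
      have "K * (b l - a l) \<le> K' * (b l - a l)" using l by (intro mult_right_mono) (auto simp: K'_def)
      then show "\<bar>f (b l) - f (a l)\<bar> \<le> K' * (b l - a l)" using assms[OF l] by linarith
    qed
    also have "\<dots> < \<epsilon>"
      using that(2) \<open>K' > 0\<close>
        by (simp add: sum_distrib_left[symmetric] pos_less_divide_eq mult.commute)
    finally show ?thesis .
  qed
  then show "\<exists>\<delta>>0. \<forall>(n::nat) a b. (\<forall>l<n. c \<le> a l \<and> a l \<le> b l \<and> b l \<le> d) \<and>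
      disjoint_family_on (\<lambda>l. {a l<..<b l}) {..<n} \<and> (\<Sum>l<n. b l - a l) < \<delta> \<longrightarrow>
      (\<Sum>l<n. \<bar>f (b l) - f (a l)\<bar>) < \<epsilon>"
    using \<open>0 < \<epsilon>\<close> \<open>K' > 0\<close> by (intro exI[of _ "\<epsilon> / K'"]) auto
qed

text \<open>On a fine tagged division the pieces tagged in the exceptional null set are handled by
  absolute continuity, the others by the derivative.\<close>

lemma abs_continuous_increment_le:
  assumes ac: "abs_continuous_on_interval f s t" and "s \<le> t" and N: "negligible N"
    and der: "\<And>x. \<lbrakk>s < x; x < t; x \<notin> N\<rbrakk> \<Longrightarrow> \<exists>D\<le>c. (f has_real_derivative D) (at x)"
  shows "f t - f s \<le> c * (t - s)"
proof -
  have main: "f t - f s \<le> (c + \<epsilon>) * (t - s) + 2 * \<epsilon>" if \<epsilon>: "0 < \<epsilon>" for \<epsilon>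
  proof -
    \<comment> \<open>The end points count as exceptional, the derivative being known inside the
      interval only.\<close>
    define N' where "N' = insert s (insert t N)"
    have "negligible N'" using N by (simp add: N'_def negligible_insert)
    then have "N' \<in> sets lebesgue" "emeasure lebesgue N' = 0"
      unfolding negligible_iff_null_sets by (rule null_setsD2, rule null_setsD1)
    obtain \<delta> where "\<delta> > 0"
      and \<delta>: "\<And>(n::nat) a b. \<lbrakk>\<forall>l<n. s \<le> a l \<and> a l \<le> b l \<and> b l \<le> t;
        disjoint_family_on (\<lambda>l. {a l<..<b l}) {..<n}; (\<Sum>l<n. b l - a l) < \<delta>\<rbrakk>
        \<Longrightarrow> (\<Sum>l<n. \<bar>f (b l) - f (a l)\<bar>) < \<epsilon>"
      using ac \<epsilon> unfolding abs_continuous_on_interval_def by meson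
    \<comment> \<open>Total length allowed to the exceptional pieces: \<open>\<delta>\<close> for
      absolute continuity, the other entry so that leaving them out of the linear term costs at most
      \<open>\<epsilon>\<close>.\<close>
    define \<eta> where "\<eta> = min \<delta> (\<epsilon> / (\<bar>c\<bar> + \<epsilon>))"
    have "\<eta> > 0" "\<eta> \<le> \<delta>" using \<epsilon> \<open>\<delta> > 0\<close>
      by (auto simp: \<eta>_def intro!: divide_pos_pos add_nonneg_pos)
    have c\<eta>: "(\<bar>c\<bar> + \<epsilon>) * \<eta> \<le> \<epsilon>"
    proof -
      have "(\<bar>c\<bar> + \<epsilon>) * \<eta> \<le> (\<bar>c\<bar> + \<epsilon>) * (\<epsilon> / (\<bar>c\<bar> + \<epsilon>))"
        using \<epsilon> by (intro mult_left_mono) (auto simp: \<eta>_def)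
      also have "\<dots> = \<epsilon>" using \<epsilon> by (simp add: add_nonneg_pos less_imp_neq[symmetric])
      finally show ?thesis .
    qed
    obtain G where G: "open G" "N' \<subseteq> G" "emeasure lebesgue (G - N') < ennreal \<eta>"
      using sets_lebesgue_outer_open[OF \<open>N' \<in> sets lebesgue\<close> \<open>\<eta> > 0\<close>]
        by metis
    have "emeasure lebesgue G \<le> emeasure lebesgue N' + emeasure lebesgue (G - N')"
      using G \<open>N' \<in> sets lebesgue\<close>
      by (metis Diff_partition borel_open emeasure_subadditive sets.Diff sets_completionI_sets sets_lborel)
    then have G_small: "emeasure lebesgue G < ennreal \<eta>"
      using G \<open>emeasure lebesgue N' = 0\<close> by simp
    \<comment> \<open>The gauge: near an exceptional point, stay inside the small open set
      \<open>G\<close>; near any other point \<open>x\<close>, be so close that increments over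
      intervals straddling \<open>x\<close> have slope at most
      \<open>c + \<epsilon>\<close>.\<close>
    have "\<exists>r>0. if x \<in> N' then ball x r \<subseteq> G else
        x \<in> {s<..<t} \<longrightarrow> (\<forall>u v. u \<le> x \<and> x \<le> v \<and> u \<in> ball x r \<and> v \<in> ball x r \<longrightarrow> f v - f u \<le> (c + \<epsilon>) * (v - u))" for x
    proof (cases "x \<in> N' \<or> x \<notin> {s<..<t}")
      case True
      then show ?thesis using G open_contains_ball by (cases "x \<in> N'") (auto intro: exI[of _ 1])
    next
      case False
      then obtain D where "D \<le> c" and D: "(f has_real_derivative D) (at x)"
        using der[of x] by (auto simp: N'_def)
      have "(f has_derivative (*) D) (at x)" using D by (simp add: has_field_derivative_def)
      then obtain r where "r > 0"
        and r: "\<And>y. norm (y - x) < r \<Longrightarrow> norm (f y - f x - D * (y - x)) \<le> \<epsilon> * norm (y - x)"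
        using \<epsilon> unfolding has_derivative_at_alt by meson
      have "f v - f u \<le> (c + \<epsilon>) * (v - u)" if "u \<le> x" "x \<le> v" "u \<in> ball x r" "v \<in> ball x r" for u v
      proof -
        have "\<bar>f v - f x - D * (v - x)\<bar> \<le> \<epsilon> * (v - x)" "\<bar>f u - f x - D * (u - x)\<bar> \<le> \<epsilon> * (x - u)"
          using r[of v] r[of u] that by (auto simp: dist_real_def)
        then have "f v - f u \<le> D * (v - u) + \<epsilon> * (v - u)" by (simp add: algebra_simps abs_le_iff)
        also have "\<dots> \<le> c * (v - u) + \<epsilon> * (v - u)" using \<open>D \<le> c\<close> that
          by (intro add_right_mono mult_right_mono) auto
        finally show ?thesis by (simp add: algebra_simps)
      qed
      then show ?thesis using \<open>r > 0\<close> False by auto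
    qed
    then obtain r where r: "\<And>x. r x > 0" "\<And>x. x \<in> N' \<Longrightarrow> ball x (r x) \<subseteq> G"
      "\<And>x u v. \<lbrakk>x \<notin> N'; x \<in> {s<..<t}; u \<le> x; x \<le> v; u \<in> ball x (r x); v \<in> ball x (r x)\<rbrakk>
         \<Longrightarrow> f v - f u \<le> (c + \<epsilon>) * (v - u)"
      by metis
    have "gauge (\<lambda>x. ball x (r x))" using r by (intro gauge_ball_dependent) auto
    then obtain p where p: "p tagged_division_of {s..t}" and fine: "(\<lambda>x. ball x (r x)) fine p"
      by (rule fine_division_exists_real)
    have "finite p" using p by (rule tagged_division_of_finite)
    have piece: "\<exists>u v. K = {u..v} \<and> u \<le> x \<and> x \<le> v \<and> s \<le> u \<and> v \<le> t \<and> Inf K = u \<and> Sup K = v \<and>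
        {u..v} \<subseteq> ball x (r x)" if xK: "(x, K) \<in> p" for x K
    proof -
      have "x \<in> K" "K \<subseteq> {s..t}" using tagged_division_ofD(2,3)[OF p xK] by blast+
      obtain u v where uv: "K = cbox u v" using tagged_division_ofD(4)[OF p xK] by blast
      have "u \<le> x" "x \<le> v" using \<open>x \<in> K\<close> uv by auto
      then have "u \<in> K" "v \<in> K" using uv by auto
      moreover have "K \<subseteq> ball x (r x)" using fine xK unfolding fine_def by blast
      ultimately show ?thesis
        using \<open>K \<subseteq> {s..t}\<close> uv \<open>u \<le> x\<close> \<open>x \<le> v\<close>
        by (intro exI[of _ u] exI[of _ v]) auto
    qed
    define B where "B = {y \<in> p. fst y \<in> N'}"
    have "finite B" "B \<subseteq> p" using \<open>finite p\<close> by (auto simp: B_def)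
    obtain h where h: "bij_betw h {..<card B} B"
      using ex_bij_betw_nat_finite[OF \<open>finite B\<close>] by (auto simp: atLeast0LessThan)
    define a b where "a l = Inf (snd (h l))" and "b l = Sup (snd (h l))" for l
    have hB: "h l \<in> B" if "l < card B" for l using h that by (auto simp: bij_betw_def)
    have ab: "snd (h l) = {a l..b l}" "s \<le> a l" "a l \<le> b l" "b l \<le> t" "{a l..b l} \<subseteq> G" if "l < card B" for l
    proof -
      obtain x K where hl: "h l = (x, K)" by (cases "h l")
      have "(x, K) \<in> p" "x \<in> N'" using hB[OF that] hl by (auto simp: B_def)
      then show "snd (h l) = {a l..b l}" "s \<le> a l" "a l \<le> b l" "b l \<le> t" "{a l..b l} \<subseteq> G"
        using piece[of x K] r(2)[of x] hl unfolding a_def b_def by auto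
    qed
    have disj: "disjoint_family_on (\<lambda>l. {a l<..<b l}) {..<card B}"
      unfolding disjoint_family_on_def
    proof (intro ballI impI)
      fix l l' assume l: "l \<in> {..<card B}" "l' \<in> {..<card B}" "l \<noteq> l'"
      then have ne: "h l \<noteq> h l'" using h unfolding bij_betw_def inj_on_def by blast
      have "h l \<in> p" "h l' \<in> p" using hB l \<open>B \<subseteq> p\<close> by blast+
      then have "interior (snd (h l)) \<inter> interior (snd (h l')) = {}"
        using tagged_division_ofD(5)[OF p, of "fst (h l)" "snd (h l)" "fst (h l')" "snd (h l')"] ne by simp
      then show "{a l<..<b l} \<inter> {a l'<..<b l'} = {}" using ab(1) l
        by (simp add: interior_atLeastAtMost_real)
    qed
    have len: "(\<Sum>l<card B. b l - a l) < \<eta>"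
    proof -
      have "ennreal (\<Sum>l<card B. b l - a l) = (\<Sum>l<card B. emeasure lborel {a l<..<b l})"
        using ab(3) by (subst sum_ennreal[symmetric]) auto
      also have "\<dots> = emeasure lborel (\<Union>l<card B. {a l<..<b l})"
        using disj by (intro sum_emeasure) auto
      also have "\<dots> \<le> emeasure lborel G"
        using ab(5) G(1) by (intro emeasure_mono UN_least) (auto simp: subset_iff)
      also have "\<dots> = emeasure lebesgue G" using G(1) by simp
      finally have "ennreal (\<Sum>l<card B. b l - a l) < ennreal \<eta>" using G_small by simp
      moreover have "0 \<le> (\<Sum>l<card B. b l - a l)" using ab(3) by (intro sum_nonneg) auto
      ultimately show ?thesis by (simp add: ennreal_less_iff)
    qed
    have reindex: "(\<Sum>y\<in>B. g y) = (\<Sum>l<card B. g (h l))" for g :: "real \<times> real set \<Rightarrow> real"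
      by (rule sum.reindex_bij_betw[OF h, symmetric])
    have bad: "(\<Sum>(x, K)\<in>B. f (Sup K) - f (Inf K)) \<le> \<epsilon>"
    proof -
      have "(\<Sum>(x, K)\<in>B. f (Sup K) - f (Inf K)) = (\<Sum>l<card B. f (b l) - f (a l))"
        unfolding reindex by (simp add: a_def b_def case_prod_unfold)
      also have "\<dots> \<le> (\<Sum>l<card B. \<bar>f (b l) - f (a l)\<bar>)" by (intro sum_mono) simp
      also have "\<dots> < \<epsilon>" using ab len \<open>\<eta> \<le> \<delta>\<close>
        by (intro \<delta>[OF _ disj]) auto
      finally show ?thesis by simp
    qed
    have good: "(\<Sum>(x, K)\<in>p - B. f (Sup K) - f (Inf K)) \<le> (\<Sum>(x, K)\<in>p - B. (c + \<epsilon>) * (Sup K - Inf K))"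
    proof (rule sum_mono, clarify)
      fix x K assume xK: "(x, K) \<in> p" "(x, K) \<notin> B"
      then have "x \<notin> N'" by (auto simp: B_def)
      obtain u v where uv: "K = {u..v}" "u \<le> x" "x \<le> v" "s \<le> u" "v \<le> t" "Inf K = u" "Sup K = v"
        "{u..v} \<subseteq> ball x (r x)" using piece[OF xK(1)] by blast
      have "x \<in> {s<..<t}" using uv \<open>x \<notin> N'\<close> by (auto simp: N'_def)
      then show "f (Sup K) - f (Inf K) \<le> (c + \<epsilon>) * (Sup K - Inf K)"
        using r(3)[OF \<open>x \<notin> N'\<close>, of u v] uv subsetD[OF uv(8), of u] subsetD[OF uv(8), of v] by simp
    qed
    have split: "(\<Sum>y\<in>p. g y) = (\<Sum>y\<in>p - B. g y) + (\<Sum>y\<in>B. g y)" for g :: "real \<times> real set \<Rightarrow> real"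
      by (rule sum.subset_diff[OF \<open>B \<subseteq> p\<close> \<open>finite p\<close>])
    have total: "(\<Sum>(x, K)\<in>p. g (Sup K) - g (Inf K)) = g t - g s" for g :: "real \<Rightarrow> real"
      by (rule additive_tagged_division_1[OF \<open>s \<le> t\<close> p])
    have lenB: "(\<Sum>(x, K)\<in>B. Sup K - Inf K) = (\<Sum>l<card B. b l - a l)"
      unfolding reindex by (simp add: a_def b_def case_prod_unfold)
    have "f t - f s \<le> (\<Sum>(x, K)\<in>p - B. (c + \<epsilon>) * (Sup K - Inf K)) + \<epsilon>"
      using good bad total[of f] split[of "\<lambda>(x, K). f (Sup K) - f (Inf K)"] by linarith
    also have "(\<Sum>(x, K)\<in>p - B. (c + \<epsilon>) * (Sup K - Inf K)) = (c + \<epsilon>) * (\<Sum>(x, K)\<in>p - B. Sup K - Inf K)"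
      by (simp add: sum_distrib_left case_prod_unfold)
    also have "(\<Sum>(x, K)\<in>p - B. Sup K - Inf K) = (t - s) - (\<Sum>l<card B. b l - a l)"
      using total[of "\<lambda>x. x"] split[of "\<lambda>(x, K). Sup K - Inf K"] lenB by linarith
    \<comment> \<open>As \<open>c + \<epsilon>\<close> may be negative, removing the exceptional
      pieces can increase the bound, but by no more than
      \<open>(\<bar>c\<bar> + \<epsilon>) * \<eta>\<close>.\<close>
    also have "(c + \<epsilon>) * ((t - s) - (\<Sum>l<card B. b l - a l)) \<le> (c + \<epsilon>) * (t - s) + (\<bar>c\<bar> + \<epsilon>) * \<eta>"
    proof -
      have "0 \<le> (\<Sum>l<card B. b l - a l)" using ab(3) by (intro sum_nonneg) auto
      then have "- (c + \<epsilon>) * (\<Sum>l<card B. b l - a l) \<le> (\<bar>c\<bar> + \<epsilon>) * \<eta>"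
        using len \<epsilon> by (intro mult_mono) auto
      then show ?thesis by (simp add: algebra_simps)
    qed
    finally show ?thesis using c\<eta> by linarith
  qed
  have "((\<lambda>\<epsilon>. (c + \<epsilon>) * (t - s) + 2 * \<epsilon>) \<longlongrightarrow> (c + 0) * (t - s) + 2 * 0) (at_right 0)"
    by (intro tendsto_intros)
  moreover have "\<forall>\<^sub>F \<epsilon> in at_right 0. f t - f s \<le> (c + \<epsilon>) * (t - s) + 2 * \<epsilon>"
    by (rule eventually_mono[OF eventually_at_right_less main])
  ultimately have "f t - f s \<le> (c + 0) * (t - s) + 2 * 0"
    by (rule tendsto_lowerbound) simp
  then show ?thesis by simp
qed

text \<open>The exceptional null set is disposed of once and for all here. The lower bound is the
  upper one for \<open>- f\<close>.\<close>

lemma inclusion_solution_imp_mv_solution: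
  assumes "inclusion_solution F f" "0 \<le> T"
  shows "mv_solution 0 T F f"
proof -
  have ac: "abs_continuous_on_interval f 0 T" using assms by (simp add: inclusion_solution_def)
  have "AE t in lebesgue_on {0..}. \<exists>D\<in>F t. (f has_real_derivative D) (at t within {0..})"
    using assms by (simp add: inclusion_solution_def)
  then have "AE t in lebesgue. t \<in> {0..} \<longrightarrow> (\<exists>D\<in>F t. (f has_real_derivative D) (at t within {0..}))"
    by (subst (asm) AE_restrict_space_iff) auto
  then obtain N where "negligible N"
    and N: "\<And>t. \<lbrakk>t \<in> {0..}; t \<notin> N\<rbrakk> \<Longrightarrow> \<exists>D\<in>F t. (f has_real_derivative D) (at t within {0..})"
    unfolding negligible_iff_null_sets by (rule AE_E3) auto
  have der: "\<exists>D\<in>F t. (f has_real_derivative D) (at t)" if "0 < t" "t \<notin> N" for t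
  proof -
    have "t \<in> interior {0..}" using that by simp
    then have at: "at t within {0..} = at t" by (rule at_within_interior)
    have "\<exists>D\<in>F t. (f has_real_derivative D) (at t within {0..})"
      by (rule N) (use that in simp_all)
    then show ?thesis by (simp only: at)
  qed
  have ac_sub: "abs_continuous_on_interval g s t"
    if acg: "abs_continuous_on_interval g 0 T" and "0 \<le> s" "t \<le> T" for g s t
    unfolding abs_continuous_on_interval_def
  proof (intro allI impI)
    fix \<epsilon> :: real assume "0 < \<epsilon>"
    from acg[unfolded abs_continuous_on_interval_def, rule_format, OF this]
    obtain \<delta> where "\<delta> > 0"
      and \<delta>: "\<And>(n::nat) a b. (\<forall>l<n. 0 \<le> a l \<and> a l \<le> b l \<and> b l \<le> T) \<and>
        disjoint_family_on (\<lambda>l. {a l<..<b l}) {..<n} \<and> (\<Sum>l<n. b l - a l) < \<delta>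
        \<Longrightarrow> (\<Sum>l<n. \<bar>g (b l) - g (a l)\<bar>) < \<epsilon>"
      by blast
    have "(\<Sum>l<n. \<bar>g (b l) - g (a l)\<bar>) < \<epsilon>"
      if *: "(\<forall>l<n. s \<le> a l \<and> a l \<le> b l \<and> b l \<le> t) \<and> disjoint_family_on (\<lambda>l. {a l<..<b l}) {..<n} \<and>
        (\<Sum>l<n. b l - a l) < \<delta>" for n :: nat and a b
    proof (rule \<delta>, intro conjI)
      show "\<forall>l<n. 0 \<le> a l \<and> a l \<le> b l \<and> b l \<le> T"
        using *[THEN conjunct1] order_trans[OF \<open>0 \<le> s\<close>] order_trans[OF _ \<open>t \<le> T\<close>] by blast
    qed (use * in simp_all)
    then show "\<exists>\<delta>>0. \<forall>(n::nat) a b. (\<forall>l<n. s \<le> a l \<and> a l \<le> b l \<and> b l \<le> t) \<and>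
        disjoint_family_on (\<lambda>l. {a l<..<b l}) {..<n} \<and> (\<Sum>l<n. b l - a l) < \<delta> \<longrightarrow>
        (\<Sum>l<n. \<bar>g (b l) - g (a l)\<bar>) < \<epsilon>"
      using \<open>\<delta> > 0\<close> by blast
  qed
  show ?thesis
    unfolding mv_solution_def
  proof (intro conjI allI impI; (elim conjE)?)
    show "continuous_on {0..T} f" using ac by (rule abs_continuous_imp_continuous_on)
    fix s t c assume st: "0 \<le> s" "s \<le> t" "t \<le> T"
    show "f t - f s \<le> c * (t - s)" if c: "\<forall>r\<in>{s<..<t}. \<forall>D\<in>F r. D \<le> c"
    proof (rule abs_continuous_increment_le[OF ac_sub[OF ac st(1,3)] st(2) \<open>negligible N\<close>])
      fix x assume x: "s < x" "x < t" "x \<notin> N"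
      then obtain D where D: "D \<in> F x" "(f has_real_derivative D) (at x)" using der[of x] st by auto
      moreover have "D \<le> c" using c x D(1) by auto
      ultimately show "\<exists>D\<le>c. (f has_real_derivative D) (at x)" by blast
    qed
    show "c * (t - s) \<le> f t - f s" if c: "\<forall>r\<in>{s<..<t}. \<forall>D\<in>F r. c \<le> D"
    proof -
      have "- f t - - f s \<le> - c * (t - s)"
      proof (rule abs_continuous_increment_le[OF ac_sub[OF abs_continuous_minus[OF ac] st(1,3)] st(2) \<open>negligible N\<close>])
        fix x assume x: "s < x" "x < t" "x \<notin> N"
        then obtain D where D: "D \<in> F x" "(f has_real_derivative D) (at x)" using der[of x] st by auto
        then have "((\<lambda>x. - f x) has_real_derivative - D) (at x)" by (intro DERIV_minus)
        moreover have "- D \<le> - c" using c x D(1) by auto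
        ultimately show "\<exists>D\<le>- c. ((\<lambda>x. - f x) has_real_derivative D) (at x)" by blast
      qed
      then show ?thesis by simp
    qed
  qed
qed

lemma inclusion_solution_diff:
  assumes f: "inclusion_solution F f" and g: "inclusion_solution G g"
    and H: "\<And>t D E. \<lbrakk>0 \<le> t; D \<in> F t; E \<in> G t\<rbrakk> \<Longrightarrow> D - E \<in> H t"
  shows "inclusion_solution H (\<lambda>t. f t - g t)"
  unfolding inclusion_solution_def
proof (intro conjI allI impI)
  show "abs_continuous_on_interval (\<lambda>t. f t - g t) 0 T" if "0 \<le> T" for T
    using f g that by (intro abs_continuous_diff) (auto simp: inclusion_solution_def)
  have "AE t in lebesgue_on {0..}. (\<exists>D\<in>F t. (f has_real_derivative D) (at t within {0..}))"
    "AE t in lebesgue_on {0..}. (\<exists>D\<in>G t. (g has_real_derivative D) (at t within {0..}))"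
    using f g by (auto simp: inclusion_solution_def)
  moreover have "AE t in lebesgue_on {0..}. 0 \<le> t" by (rule AE_I2) simp
  ultimately show "AE t in lebesgue_on {0..}. \<exists>D\<in>H t. ((\<lambda>t. f t - g t) has_real_derivative D) (at t within {0..})"
  proof eventually_elim
    case (elim t)
    then obtain D E where "D \<in> F t" "E \<in> G t" "(f has_real_derivative D) (at t within {0..})"
      "(g has_real_derivative E) (at t within {0..})" by blast
    then show ?case using H[OF elim(3), of D E] by (blast intro: DERIV_diff)
  qed
qed

section \<open>Lebesgue differentiation\<close>

lemma bounded_measurable_integrable_on:
  fixes g :: "real \<Rightarrow> real"
  assumes "g \<in> borel_measurable (lebesgue_on {a..b})" "\<And>x. x \<in> {a..b} \<Longrightarrow> \<bar>g x\<bar> \<le> M"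
  shows "g integrable_on {a..b}"
  by (rule measurable_bounded_by_integrable_imp_integrable[OF assms(1), of "\<lambda>_. M"])
    (use assms(2) in \<open>auto simp: integrable_const_ivl\<close>)

text \<open>Vitali covering: where \<open>g < p\<close> but arbitrarily short intervals have mean above \<open>q\<close>, these
  intervals lie mostly outside \<open>{g < p}\<close>, though inside a slightly larger open set.\<close>

lemma negligible_upper_density:
  fixes g :: "real \<Rightarrow> real" and p q M R :: real
  assumes meas: "g \<in> borel_measurable lebesgue" and M: "\<And>x. \<bar>g x\<bar> \<le> M" and pq: "p < q"
  shows "negligible {x \<in> {- R<..<R}. g x < p \<and> (\<forall>d>0. \<exists>u v. u \<le> x \<and> x \<le> v \<and> u < v \<and> v - u < d \<and>
           q * (v - u) < integral {u..v} g)}" (is "negligible ?E")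
  unfolding negligible_outer_le
proof (intro allI impI)
  fix e :: real assume "0 < e"
  define S where "S = {- R<..<R} \<inter> {x. g x < p}"
  have "{x. g x < p} \<in> sets lebesgue"
    using borel_measurable_less[OF meas borel_measurable_const[of p]] by simp
  then have S: "S \<in> sets lebesgue" by (auto simp: S_def)
  \<comment> \<open>\<open>g \<le> p + A\<close> everywhere and \<open>g < p\<close> on
    \<open>S\<close>, so an interval in \<open>G\<close> with mean above \<open>q\<close> has at
    least the fraction \<open>(q - p) / A\<close> of its length in \<open>G - S\<close>. Bounding
    the measure of \<open>G - S\<close> by \<open>e1\<close> then bounds the total length of
    disjoint intervals of this kind by \<open>e\<close>.\<close>
  define A where "A = M + \<bar>p\<bar> + 1"
  have "A > 0" using M[of 0] by (simp add: A_def)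
  define e1 where "e1 = e * (q - p) / A"
  have "e1 > 0" using \<open>0 < e\<close> pq \<open>A > 0\<close> by (simp add: e1_def)
  obtain G where G: "open G" "S \<subseteq> G" "G - S \<in> lmeasurable" "emeasure lebesgue (G - S) < ennreal e1"
    using sets_lebesgue_outer_open[OF S \<open>e1 > 0\<close>] by metis
  have GS: "measure lebesgue (G - S) \<le> e1"
    using G(3,4) \<open>e1 > 0\<close> by (simp add: emeasure_eq_measure2 ennreal_less_iff)
  have int: "g integrable_on {u..v}" for u v
    by (rule bounded_measurable_integrable_on[OF measurable_restrict_space1[OF meas] M])
  define K where "K = {(u, v). u < v \<and> {u..v} \<subseteq> G \<and> q * (v - u) < integral {u..v} g}"
  have cb: "cball ((fst i + snd i) / 2) ((snd i - fst i) / 2) = {fst i..snd i}" for i :: "real \<times> real"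
    by (auto simp: cball_eq_atLeastAtMost field_simps)
  have cover: "\<exists>i\<in>K. x \<in> cball ((fst i + snd i) / 2) ((snd i - fst i) / 2) \<and> (snd i - fst i) / 2 < d"
    if xE: "x \<in> ?E" and "0 < d" for x d
  proof -
    have "x \<in> G" using xE G(2) by (auto simp: S_def)
    then obtain r where "r > 0" "ball x r \<subseteq> G" using G(1) open_contains_ball by metis
    then have "min r d > 0" using \<open>0 < d\<close> by simp
    then obtain u v where uv: "u \<le> x" "x \<le> v" "u < v" "v - u < min r d" "q * (v - u) < integral {u..v} g"
      using xE by blast
    have "{u..v} \<subseteq> ball x r" using uv by (auto simp: dist_real_def)
    then have "(u, v) \<in> K" using uv \<open>ball x r \<subseteq> G\<close> by (auto simp: K_def)
    then show ?thesis unfolding cb using uv by (intro bexI[of _ "(u, v)"]) auto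
  qed
  obtain C where C: "countable C" "C \<subseteq> K"
    "pairwise (\<lambda>i j. disjnt (cball ((fst i + snd i) / 2) ((snd i - fst i) / 2)) (cball ((fst j + snd j) / 2) ((snd j - fst j) / 2))) C"
    "negligible (?E - (\<Union>i\<in>C. cball ((fst i + snd i) / 2) ((snd i - fst i) / 2)))"
  proof (rule Vitali_covering_theorem_cballs)
    show "0 < (snd i - fst i) / 2" if "i \<in> K" for i using that by (auto simp: K_def)
    show "\<exists>i. i \<in> K \<and> x \<in> cball ((fst i + snd i) / 2) ((snd i - fst i) / 2) \<and> (snd i - fst i) / 2 < d"
      if "x \<in> ?E" "0 < d" for x d using cover[OF that] by blast
  qed
  have disj: "pairwise (\<lambda>i j. disjnt {fst i..snd i} {fst j..snd j}) C" using C(3) unfolding cb .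
  have one: "(q - p) * (snd i - fst i) \<le> A * measure lebesgue ({fst i..snd i} \<inter> (G - S))" if "i \<in> C" for i
  proof -
    obtain u v where i: "i = (u, v)" by (cases i)
    then have uv: "u < v" "{u..v} \<subseteq> G" "q * (v - u) < integral {u..v} g" using that C(2)
      by (auto simp: K_def)
    have m: "(G - S) \<inter> {u..v} \<in> lmeasurable"
      by (rule fmeasurable_Int_fmeasurable[OF G(3)]) simp
    have ind: "integral {u..v} (indicator (G - S)) = measure lebesgue ((G - S) \<inter> {u..v})"
      by (rule integral_indicator[OF m])
    have ind_int: "(indicator (G - S) :: real \<Rightarrow> real) integrable_on {u..v}"
      using m by (simp add: lmeasurable_iff_integrable_on integrable_on_indicator Int_commute)
    have "integral {u..v} g \<le> integral {u..v} (\<lambda>x. p + A * indicator (G - S) x)"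
    proof (rule integral_le[OF int])
      show "(\<lambda>x. p + A * indicator (G - S) x) integrable_on {u..v}"
        using ind_int by (intro integrable_add integrable_on_mult_right) (auto simp: integrable_const_ivl)
      show "g x \<le> p + A * indicator (G - S) x" if "x \<in> {u..v}" for x
      proof (cases "x \<in> S")
        case True then show ?thesis by (simp add: S_def)
      next
        case False
        then have "x \<in> G - S" using that uv(2) by auto
        then show ?thesis using M[of x] by (simp add: A_def)
      qed
    qed
    also have "\<dots> = p * (v - u) + A * measure lebesgue ((G - S) \<inter> {u..v})"
      using ind_int uv(1) by (subst Henstock_Kurzweil_Integration.integral_add)
        (auto simp: integrable_const_ivl integrable_on_mult_right ind)
    finally show ?thesis using uv(3) i by (simp add: algebra_simps Int_commute)
  qed
  have finite_bound: "measure lebesgue (\<Union>i\<in>C'. {fst i..snd i}) \<le> e" if "C' \<subseteq> C" "finite C'" for C'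
  proof -
    have disj': "pairwise (\<lambda>i j. disjnt {fst i..snd i} {fst j..snd j}) C'"
      using disj that(1) by (rule pairwise_subset)
    have "measure lebesgue (\<Union>i\<in>C'. {fst i..snd i}) = (\<Sum>i\<in>C'. measure lebesgue {fst i..snd i})"
      using that(2) disj' by (intro measure_UNION') auto
    also have "\<dots> = (\<Sum>i\<in>C'. snd i - fst i)"
    proof (rule sum.cong)
      fix i assume "i \<in> C'"
      then have "fst i < snd i" using that(1) C(2) by (auto simp: K_def)
      then show "measure lebesgue {fst i..snd i} = snd i - fst i" by simp
    qed simp
    finally have eq: "measure lebesgue (\<Union>i\<in>C'. {fst i..snd i}) = (\<Sum>i\<in>C'. snd i - fst i)" .
    have "(q - p) * (\<Sum>i\<in>C'. snd i - fst i) = (\<Sum>i\<in>C'. (q - p) * (snd i - fst i))"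
      by (rule sum_distrib_left)
    also have "\<dots> \<le> (\<Sum>i\<in>C'. A * measure lebesgue ({fst i..snd i} \<inter> (G - S)))"
      using one that(1) by (intro sum_mono) blast
    also have "\<dots> = A * (\<Sum>i\<in>C'. measure lebesgue ({fst i..snd i} \<inter> (G - S)))"
      by (rule sum_distrib_left[symmetric])
    also have "(\<Sum>i\<in>C'. measure lebesgue ({fst i..snd i} \<inter> (G - S)))
        = measure lebesgue (\<Union>i\<in>C'. {fst i..snd i} \<inter> (G - S))"
    proof (rule measure_UNION'[symmetric])
      show "{fst i..snd i} \<inter> (G - S) \<in> lmeasurable" for i :: "real \<times> real"
        by (rule fmeasurable_Int_fmeasurable) (use G(3) in \<open>auto simp: fmeasurableD\<close>)
      show "pairwise (\<lambda>i j. disjnt ({fst i..snd i} \<inter> (G - S)) ({fst j..snd j} \<inter> (G - S))) C'"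
        using disj' by (rule pairwise_mono) (auto simp: disjnt_def)
    qed (rule that(2))
    also have "\<dots> \<le> measure lebesgue (G - S)"
      by (rule measure_mono_fmeasurable) (use G(3) that(2) in \<open>auto simp: fmeasurableD intro!: sets.finite_UN\<close>)
    also note GS
    finally have "(q - p) * (\<Sum>i\<in>C'. snd i - fst i) \<le> A * e1" using \<open>A > 0\<close> by simp
    also have "A * e1 = (q - p) * e" using \<open>A > 0\<close> by (simp add: e1_def)
    finally show ?thesis unfolding eq using pq by simp
  qed
  define U where "U = (\<Union>i\<in>C. {fst i..snd i})"
  have U: "U \<in> lmeasurable" "measure lebesgue U \<le> e"
    unfolding U_def
    by (rule fmeasurable_UN_bound[OF C(1) _ finite_bound], simp_all)
      (rule measure_UN_bound[OF C(1) _ finite_bound], simp_all)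
  have neg: "negligible (?E - U)" using C(4) unfolding cb U_def .
  show "\<exists>T. ?E \<subseteq> T \<and> T \<in> lmeasurable \<and> measure lebesgue T \<le> e"
  proof (intro exI conjI)
    show "?E \<subseteq> U \<union> (?E - U)" by blast
    have N: "?E - U \<in> lmeasurable" "measure lebesgue (?E - U) = 0"
      using neg by (simp_all add: negligible_imp_measurable negligible_imp_measure0)
    show "U \<union> (?E - U) \<in> lmeasurable" by (rule fmeasurable.Un[OF U(1) N(1)])
    have "measure lebesgue (U \<union> (?E - U)) \<le> measure lebesgue U + measure lebesgue (?E - U)"
      by (rule measure_Un_le) (use U N in \<open>auto simp: fmeasurableD\<close>)
    then show "measure lebesgue (U \<union> (?E - U)) \<le> e" using U N by simp
  qed
qed

text \<open>If the means over short intervals around \<open>x\<close> keep exceeding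
  \<open>h x + \<epsilon>\<close>, then rationals \<open>p < q\<close> strictly between
  \<open>h x\<close> and \<open>h x + \<epsilon>\<close> put \<open>x\<close> into one of countably
  many null sets. Taking \<open>h\<close> to be \<open>g\<close> and \<open>- g\<close> gives both
  inequalities.\<close>

lemma lebesgue_differentiation:
  fixes g :: "real \<Rightarrow> real"
  assumes meas: "g \<in> borel_measurable lebesgue" and M: "\<And>x. \<bar>g x\<bar> \<le> M"
  shows "\<exists>N. negligible N \<and> (\<forall>x. x \<notin> N \<longrightarrow> (\<forall>\<epsilon>>0. \<exists>d>0. \<forall>u v. u \<le> x \<and> x \<le> v \<and> v - u < d \<longrightarrow>
    \<bar>integral {u..v} g - g x * (v - u)\<bar> \<le> \<epsilon> * (v - u)))"
proof -
  define E where "E h p q R = {x \<in> {- R<..<R}. h x < p \<and> (\<forall>d>0. \<exists>u v. u \<le> x \<and> x \<le> v \<and> u < v \<and> v - u < d \<and>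
      q * (v - u) < integral {u..v} h)}" for h :: "real \<Rightarrow> real" and p q R
  define P where "P = {(p, q) \<in> \<rat> \<times> \<rat>. p < (q::real)}"
  define N where "N = (\<Union>(p, q)\<in>P. \<Union>R\<in>\<nat>. E g p q R) \<union> (\<Union>(p, q)\<in>P. \<Union>R\<in>\<nat>. E (\<lambda>x. - g x) p q R)"
  have "countable P" unfolding P_def
    by (rule countable_subset[of _ "\<rat> \<times> \<rat>"]) (auto intro: countable_SIGMA countable_rat)
  have neg: "negligible (E h p q R)" if "h \<in> borel_measurable lebesgue" "\<And>x. \<bar>h x\<bar> \<le> M" "p < q" for h p q R
    unfolding E_def by (rule negligible_upper_density[OF that])
  have negU: "negligible (\<Union>(p, q)\<in>P. \<Union>R\<in>\<nat>. E h p q R)"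
    if "h \<in> borel_measurable lebesgue" "\<And>x. \<bar>h x\<bar> \<le> M" for h
  proof -
    have "negligible (\<Union>R\<in>\<nat>. E h p q R)" if "p < q" for p q
    proof -
      have "negligible (\<Union>n. E h p q (of_nat n))"
        by (rule negligible_countable_Union) (use neg[OF \<open>h \<in> borel_measurable lebesgue\<close> \<open>\<And>x. \<bar>h x\<bar> \<le> M\<close> that] in auto)
      then show ?thesis by (simp add: Nats_def)
    qed
    then show ?thesis using \<open>countable P\<close>
      by (intro negligible_countable_Union) (auto simp: P_def)
  qed
  have upper: "\<exists>d>0. \<forall>u v. u \<le> x \<and> x \<le> v \<and> v - u < d \<longrightarrow> integral {u..v} h \<le> (h x + \<epsilon>) * (v - u)"
    if x: "x \<notin> (\<Union>(p, q)\<in>P. \<Union>R\<in>\<nat>. E h p q R)"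
      and \<epsilon>: "0 < \<epsilon>" for h x \<epsilon>
  proof -
    obtain p where p: "p \<in> \<rat>" "h x < p" "p < h x + \<epsilon>"
      using Rats_dense_in_real[of "h x" "h x + \<epsilon>"] \<epsilon> by auto
    obtain q where q: "q \<in> \<rat>" "p < q" "q < h x + \<epsilon>" using Rats_dense_in_real[OF p(3)]
      by auto
    obtain n where n: "\<bar>x\<bar> < of_nat n" using reals_Archimedean2 by blast
    have "(p, q) \<in> P" using p q by (simp add: P_def)
    then have "x \<notin> E h p q (of_nat n)" using x by (auto simp: Nats_def)
    moreover have "x \<in> {- real n<..<real n}" using n by auto
    ultimately have "\<not> (\<forall>d>0. \<exists>u v. u \<le> x \<and> x \<le> v \<and> u < v \<and> v - u < d \<and> q * (v - u) < integral {u..v} h)"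
      using p(2) unfolding E_def by blast
    then obtain d where "d > 0"
      and d': "\<And>u v. \<not> (u \<le> x \<and> x \<le> v \<and> u < v \<and> v - u < d \<and> q * (v - u) < integral {u..v} h)"
      by blast
    have d: "integral {u..v} h \<le> q * (v - u)" if "u \<le> x" "x \<le> v" "u < v" "v - u < d" for u v
      using d'[of u v] that by linarith
    have "integral {u..v} h \<le> (h x + \<epsilon>) * (v - u)" if "u \<le> x" "x \<le> v" "v - u < d" for u v
    proof (cases "u = v")
      case False
      then have "u < v" using that by simp
      then have "integral {u..v} h \<le> q * (v - u)" using that by (intro d)
      also have "\<dots> \<le> (h x + \<epsilon>) * (v - u)" using q(3) \<open>u < v\<close>
        by (intro mult_right_mono) auto
      finally show ?thesis .
    qed simp
    then show ?thesis using \<open>d > 0\<close> by blast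
  qed
  have "\<exists>d>0. \<forall>u v. u \<le> x \<and> x \<le> v \<and> v - u < d \<longrightarrow> \<bar>integral {u..v} g - g x * (v - u)\<bar> \<le> \<epsilon> * (v - u)"
    if x: "x \<notin> N" and \<epsilon>: "0 < \<epsilon>" for x \<epsilon>
  proof -
    have xg: "x \<notin> (\<Union>(p, q)\<in>P. \<Union>R\<in>\<nat>. E g p q R)" "x \<notin> (\<Union>(p, q)\<in>P. \<Union>R\<in>\<nat>. E (\<lambda>x. - g x) p q R)"
      using x unfolding N_def by simp_all
    obtain d1 where d1: "d1 > 0" "\<And>u v. \<lbrakk>u \<le> x; x \<le> v; v - u < d1\<rbrakk> \<Longrightarrow> integral {u..v} g \<le> (g x + \<epsilon>) * (v - u)"
      using upper[OF xg(1) \<epsilon>] by blast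
    obtain d2 where d2: "d2 > 0" "\<And>u v. \<lbrakk>u \<le> x; x \<le> v; v - u < d2\<rbrakk> \<Longrightarrow> integral {u..v} (\<lambda>x. - g x) \<le> (- g x + \<epsilon>) * (v - u)"
      using upper[OF xg(2) \<epsilon>] by blast
    have "\<bar>integral {u..v} g - g x * (v - u)\<bar> \<le> \<epsilon> * (v - u)" if "u \<le> x" "x \<le> v" "v - u < min d1 d2" for u v
      using d1(2)[of u v] d2(2)[of u v] that by (simp add: algebra_simps abs_le_iff)
    then show ?thesis using d1(1) d2(1) by (intro exI[of _ "min d1 d2"]) auto
  qed
  moreover have "negligible N" unfolding N_def
    using negU[OF meas M] negU[of "\<lambda>x. - g x"] meas M by (intro negligible_Un) auto
  ultimately show ?thesis by blast
qed

section \<open>Primitives of locally bounded measurable functions\<close>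

lemma locally_bounded_measurableD:
  fixes f :: "real \<Rightarrow> real"
  assumes "locally_bounded_measurable f" "0 \<le> T"
  obtains M where "0 \<le> M" "\<And>t. \<lbrakk>0 \<le> t; t \<le> T\<rbrakk> \<Longrightarrow> \<bar>f t\<bar> \<le> M"
proof -
  have "bounded (f ` {0..T})" using assms by (simp add: locally_bounded_measurable_def)
  then obtain M where "\<forall>x\<in>f ` {0..T}. norm x \<le> M" unfolding bounded_iff by blast
  then have "\<bar>f t\<bar> \<le> \<bar>M\<bar>" if "0 \<le> t" "t \<le> T" for t using that by force
  then show ?thesis using that[of "\<bar>M\<bar>"] by simp
qed

lemma locally_bounded_measurable_restrict:
  fixes f :: "real \<Rightarrow> real"
  assumes "locally_bounded_measurable f" "0 \<le> a"
  shows "f \<in> borel_measurable (lebesgue_on {a..b})"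
proof -
  have "f \<in> borel_measurable (lebesgue_on {0..})" using assms
    by (simp add: locally_bounded_measurable_def)
  then show ?thesis by (rule measurable_restrict_mono) (use assms in auto)
qed

lemma locally_bounded_measurable_integrable_on:
  fixes f :: "real \<Rightarrow> real"
  assumes "locally_bounded_measurable f" "0 \<le> a"
  shows "f integrable_on {a..b}"
proof (cases "a \<le> b")
  case True
  then obtain M where M: "\<And>t. \<lbrakk>0 \<le> t; t \<le> b\<rbrakk> \<Longrightarrow> \<bar>f t\<bar> \<le> M"
    using locally_bounded_measurableD[OF assms(1), of b] assms(2) by (metis order_trans)
  show ?thesis
    by (rule bounded_measurable_integrable_on[OF locally_bounded_measurable_restrict[OF assms], of _ M])
      (use M assms(2) in auto)
qed (simp add: integrable_on_empty)

lemma indefinite_integral_diff: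
  fixes f :: "real \<Rightarrow> real"
  assumes "locally_bounded_measurable f" "0 \<le> x" "x \<le> y"
  shows "integral {0..y} f - integral {0..x} f = integral {x..y} f"
  using Henstock_Kurzweil_Integration.integral_combine[OF assms(2,3) locally_bounded_measurable_integrable_on[OF assms(1)]]
  by simp

lemma indefinite_integral_Lipschitz:
  fixes f :: "real \<Rightarrow> real"
  assumes "locally_bounded_measurable f" "0 \<le> x" "x \<le> y"
    and M: "\<And>t. \<lbrakk>x \<le> t; t \<le> y\<rbrakk> \<Longrightarrow> \<bar>f t\<bar> \<le> M"
  shows "\<bar>integral {0..y} f - integral {0..x} f\<bar> \<le> M * (y - x)"
proof -
  have "norm (integral {x..y} f) \<le> integral {x..y} (\<lambda>_. M)"
  proof (rule integral_norm_bound_integral)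
    show "f integrable_on {x..y}" by (rule locally_bounded_measurable_integrable_on[OF assms(1,2)])
  qed (use M in \<open>auto simp: integrable_const_ivl\<close>)
  then show ?thesis using assms by (simp add: indefinite_integral_diff[OF assms(1-3)] mult.commute)
qed

text \<open>Differentiation is available for globally bounded functions, so \<open>f\<close> is cut
  off outside \<open>{0..T}\<close> for every natural \<open>T\<close>; the exceptional sets have a
  null union.\<close>

lemma indefinite_integral_derivative:
  fixes f :: "real \<Rightarrow> real"
  assumes f: "locally_bounded_measurable f"
  shows "AE t in lebesgue_on {0..}. ((\<lambda>t. integral {0..t} f) has_real_derivative f t) (at t within {0..})"
proof -
  define g where "g T x = (if x \<in> {0..real T} then f x else 0)" for T :: nat and x
  have "\<exists>N. negligible N \<and> (\<forall>x. x \<notin> N \<longrightarrow> (\<forall>\<epsilon>>0. \<exists>d>0. \<forall>u v. u \<le> x \<and> x \<le> v \<and> v - u < d \<longrightarrow>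
    \<bar>integral {u..v} (g T) - g T x * (v - u)\<bar> \<le> \<epsilon> * (v - u)))" for T
  proof -
    obtain M where M: "0 \<le> M" "\<And>t. \<lbrakk>0 \<le> t; t \<le> real T\<rbrakk> \<Longrightarrow> \<bar>f t\<bar> \<le> M"
      using locally_bounded_measurableD[OF f, of "real T"] by auto
    show ?thesis
    proof (rule lebesgue_differentiation)
      show "g T \<in> borel_measurable lebesgue"
        unfolding g_def[abs_def] using locally_bounded_measurable_restrict[OF f, of 0 "real T"]
        by (intro borel_measurable_if_I) auto
      show "\<bar>g T x\<bar> \<le> M" for x using M by (simp add: g_def)
    qed
  qed
  then obtain N where N: "\<And>T. negligible (N T)"
    "\<And>T x \<epsilon>. \<lbrakk>x \<notin> N T; 0 < \<epsilon>\<rbrakk> \<Longrightarrow> \<exists>d>0. \<forall>u v. u \<le> x \<and> x \<le> v \<and> v - u < d \<longrightarrow>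
      \<bar>integral {u..v} (g T) - g T x * (v - u)\<bar> \<le> \<epsilon> * (v - u)"
    by metis
  have "negligible (\<Union>T. N T)" using N(1) by (intro negligible_countable_Union) auto
  then have null: "(\<Union>T. N T) \<in> null_sets lebesgue" by (simp only: negligible_iff_null_sets)
  have der: "((\<lambda>t. integral {0..t} f) has_real_derivative f t) (at t within {0..})"
    if t: "0 \<le> t" "t \<notin> (\<Union>T. N T)" for t
    unfolding has_field_derivative_def has_derivative_within_alt
  proof (intro conjI allI impI)
    show "bounded_linear ((*) (f t))" by (rule bounded_linear_mult_right)
    fix \<epsilon> :: real assume "0 < \<epsilon>"
    \<comment> \<open>The margin 1 ensures that \<open>g T\<close> agrees with \<open>f\<close>
      between \<open>t\<close> and every nonnegative \<open>y\<close> at distance less than 1 from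
      \<open>t\<close>.\<close>
    obtain T :: nat where T: "t + 1 < real T" using reals_Archimedean2 by blast
    have "t \<notin> N T" using t by blast
    then obtain d where "d > 0"
      and d: "\<And>u v. \<lbrakk>u \<le> t; t \<le> v; v - u < d\<rbrakk> \<Longrightarrow>
        \<bar>integral {u..v} (g T) - g T t * (v - u)\<bar> \<le> \<epsilon> * (v - u)"
      using N(2)[OF _ \<open>0 < \<epsilon>\<close>] by blast
    have gT: "g T t = f t" using t T by (simp add: g_def)
    have "norm (integral {0..y} f - integral {0..t} f - f t * (y - t)) \<le> \<epsilon> * norm (y - t)"
      if y: "0 \<le> y" "norm (y - t) < min d 1" for y
    proof -
      have eq: "integral {u..v} (g T) = integral {u..v} f" if "0 \<le> u" "v \<le> real T" for u v
        using that by (intro integral_cong) (auto simp: g_def)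
      show ?thesis
      proof (cases "t \<le> y")
        case True
        then have "integral {0..y} f - integral {0..t} f = integral {t..y} (g T)"
          using t(1) y T by (subst eq) (auto simp: indefinite_integral_diff[OF f])
        then show ?thesis using d[of t y] True y gT by simp
      next
        case False
        then have "integral {0..t} f - integral {0..y} f = integral {y..t} (g T)"
          using t(1) y T by (subst eq) (auto simp: indefinite_integral_diff[OF f])
        then show ?thesis using d[of y t] False y gT by (simp add: abs_le_iff algebra_simps)
      qed
    qed
    then show "\<exists>d>0. \<forall>y\<in>{0..}. norm (y - t) < d \<longrightarrow>
        norm (integral {0..y} f - integral {0..t} f - f t * (y - t)) \<le> \<epsilon> * norm (y - t)"
      using \<open>d > 0\<close> by (intro exI[of _ "min d 1"]) auto
  qed
  have "AE t in lebesgue. t \<in> {0..} \<longrightarrow> ((\<lambda>t. integral {0..t} f) has_real_derivative f t) (at t within {0..})"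
  proof (rule AE_I'[OF null], rule subsetI, rule ccontr)
    fix t assume t: "t \<in> {t \<in> space lebesgue. \<not> (t \<in> {0..} \<longrightarrow>
        ((\<lambda>t. integral {0..t} f) has_real_derivative f t) (at t within {0..}))}" and "t \<notin> (\<Union>T. N T)"
    then show False using der[of t] by simp
  qed
  then show ?thesis by (subst AE_restrict_space_iff) auto
qed

lemma indefinite_integral_inclusion_solution:
  fixes f :: "real \<Rightarrow> real"
  assumes f: "locally_bounded_measurable f" and F: "AE t in lebesgue_on {0..}. f t \<in> F t"
  shows "inclusion_solution F (\<lambda>t. c + integral {0..t} f)"
  unfolding inclusion_solution_def
proof (intro conjI allI impI)
  fix T :: real assume "0 \<le> T"
  then obtain M where M: "\<And>t. \<lbrakk>0 \<le> t; t \<le> T\<rbrakk> \<Longrightarrow> \<bar>f t\<bar> \<le> M"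
    using locally_bounded_measurableD[OF f, of T] by metis
  show "abs_continuous_on_interval (\<lambda>t. c + integral {0..t} f) 0 T"
  proof (rule Lipschitz_imp_abs_continuous)
    fix x y assume xy: "0 \<le> x" "x \<le> y" "y \<le> T"
    have "\<bar>integral {0..y} f - integral {0..x} f\<bar> \<le> M * (y - x)"
      by (rule indefinite_integral_Lipschitz[OF f xy(1,2)]) (use M xy in auto)
    then show "\<bar>c + integral {0..y} f - (c + integral {0..x} f)\<bar> \<le> M * (y - x)" by simp
  qed
next
  show "AE t in lebesgue_on {0..}. \<exists>D\<in>F t. ((\<lambda>t. c + integral {0..t} f) has_real_derivative D) (at t within {0..})"
    using indefinite_integral_derivative[OF f] F
  proof eventually_elim
    case (elim t)
    have "((\<lambda>t. c + integral {0..t} f) has_real_derivative 0 + f t) (at t within {0..})"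
      by (intro DERIV_add DERIV_const elim(1))
    then show ?case using elim(2) by auto
  qed
qed

section \<open>Weak limits\<close>

text \<open>Almost minimisers of the \<open>L\<^sup>2\<close> norm over decreasing midpoint convex sets form a Cauchy
  sequence, by the parallelogram identity.\<close>

lemma midpoint_convex_ae_convergent:
  fixes C :: "nat \<Rightarrow> ('a \<Rightarrow> real) set"
  assumes fin: "finite_measure M" and dec: "\<And>n. C (Suc n) \<subseteq> C n"
    and ne: "\<And>n. C n \<noteq> {}"
    and meas: "\<And>n \<tau>. \<tau> \<in> C n \<Longrightarrow> \<tau> \<in> borel_measurable M"
    and bd: "\<And>n \<tau> x. \<lbrakk>\<tau> \<in> C n; x \<in> space M\<rbrakk> \<Longrightarrow> \<bar>\<tau> x\<bar> \<le> 1"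
    and mid: "\<And>n \<tau> \<tau>'. \<lbrakk>\<tau> \<in> C n; \<tau>' \<in> C n\<rbrakk> \<Longrightarrow> (\<lambda>x. (\<tau> x + \<tau>' x) / 2) \<in> C n"
  shows "\<exists>g. (\<forall>n. g n \<in> C n) \<and> (AE x in M. convergent (\<lambda>n. g n x))"
proof -
  interpret finite_measure M by (rule fin)
  define \<mu> where "\<mu> = measure M (space M)"
  have "0 \<le> \<mu>" by (simp add: \<mu>_def)
  define q where "q \<tau> = (LINT x|M. (\<tau> x)\<^sup>2)" for \<tau> :: "'a \<Rightarrow> real"
  have int: "integrable M \<tau>" "integrable M (\<lambda>x. (\<tau> x)\<^sup>2)" if "\<tau> \<in> C n" for \<tau> n
  proof -
    note [measurable] = meas[OF that]
    have "AE x in M. norm (\<tau> x) \<le> 1" "AE x in M. norm ((\<tau> x)\<^sup>2) \<le> 1"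
      using bd[OF that] by (auto intro!: AE_I2 simp: abs_square_le_1)
    then show "integrable M \<tau>" "integrable M (\<lambda>x. (\<tau> x)\<^sup>2)"
      by (auto intro!: integrable_const_bound[where B = 1])
  qed
  have q_nn: "0 \<le> q \<tau>" for \<tau> unfolding q_def by (intro integral_nonneg_AE) simp
  have q_le: "q \<tau> \<le> \<mu>" if "\<tau> \<in> C n" for \<tau> n
  proof -
    have "q \<tau> \<le> (LINT x|M. 1)" unfolding q_def
      using int[OF that] bd[OF that] by (intro integral_mono) (auto simp: abs_square_le_1)
    then show ?thesis by (simp add: \<mu>_def)
  qed
  have bdd: "bdd_below (q ` C n)" for n using q_nn by (intro bdd_belowI[of _ 0]) auto
  define d where "d n = Inf (q ` C n)" for n
  have d_le: "d n \<le> q \<tau>" if "\<tau> \<in> C n" for n \<tau>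
    unfolding d_def using that bdd by (intro cInf_lower) auto
  have d_mono: "d n \<le> d m" if "n \<le> m" for n m
  proof -
    have "C m \<subseteq> C n" using lift_Suc_antimono_le[of C n m] dec that by blast
    then show ?thesis unfolding d_def using ne bdd by (intro cInf_superset_mono image_mono) auto
  qed
  have d_bound: "d n \<le> \<mu>" for n
  proof -
    obtain \<tau> where "\<tau> \<in> C n" using ne by blast
    then show ?thesis using d_le q_le by (meson order_trans)
  qed
  have "incseq d" using d_mono by (simp add: incseq_def)
  moreover have "\<forall>n. d n \<le> \<mu>" using d_bound by simp
  ultimately obtain D where D: "d \<longlonglongrightarrow> D" and d_D': "\<forall>n. d n \<le> D"
    by (rule incseq_convergent)
  have d_D: "d n \<le> D" for n using d_D' by simp
  have "\<exists>\<tau>. \<tau> \<in> C n \<and> q \<tau> < d n + 1 / real (Suc n)" for n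
  proof -
    have "Inf (q ` C n) < d n + 1 / real (Suc n)" by (simp add: d_def)
    then show ?thesis using cInf_lessD[of "q ` C n"] ne by auto
  qed
  then obtain \<tau> where \<tau>: "\<And>n. \<tau> n \<in> C n" "\<And>n. q (\<tau> n) < d n + 1 / real (Suc n)" by metis
  define \<delta> where "\<delta> n = 2 * (D - d n) + 4 / real (Suc n)" for n
  have "(\<lambda>n. 1 / real (Suc n)) \<longlonglongrightarrow> 0" using LIMSEQ_inverse_real_of_nat
    by (simp add: inverse_eq_divide)
  then have "(\<lambda>n. 2 * (D - d n) + 4 * (1 / real (Suc n))) \<longlonglongrightarrow> 2 * (D - D) + 4 * 0"
    using D by (intro tendsto_intros)
  then have \<delta>_lim: "\<delta> \<longlonglongrightarrow> 0" by (simp add: \<delta>_def[abs_def])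
  have sub: "C m \<subseteq> C n" if "n \<le> m" for n m
    using lift_Suc_antimono_le[of C n m] dec that by blast
  have L2: "(LINT x|M. (\<tau> n x - \<tau> m x)\<^sup>2) \<le> \<delta> n" if "n \<le> m" for n m
  proof -
    define \<theta> where "\<theta> x = (\<tau> n x + \<tau> m x) / 2" for x
    have \<theta>: "\<theta> \<in> C n" unfolding \<theta>_def[abs_def] using \<tau> sub[OF that]
      by (intro mid) auto
    have "(LINT x|M. (\<tau> n x - \<tau> m x)\<^sup>2) = (LINT x|M. 2 * (\<tau> n x)\<^sup>2 + 2 * (\<tau> m x)\<^sup>2 - 4 * (\<theta> x)\<^sup>2)"
      by (intro Bochner_Integration.integral_cong) (auto simp: \<theta>_def power2_eq_square field_simps)
    also have "\<dots> = 2 * q (\<tau> n) + 2 * q (\<tau> m) - 4 * q \<theta>"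
      unfolding q_def using int(2)[OF \<tau>(1)] int(2)[OF \<theta>] by simp
    also have "\<dots> \<le> 2 * (d n + 1 / real (Suc n)) + 2 * (d m + 1 / real (Suc m)) - 4 * d n"
    proof -
      have "2 * a + 2 * b - 4 * c \<le> 2 * a' + 2 * b' - 4 * c'" if "a < a'" "b < b'" "c' \<le> c" for a b c a' b' c' :: real
        using that by linarith
      then show ?thesis using \<tau>(2)[of n] \<tau>(2)[of m] d_le[OF \<theta>] by blast
    qed
    also have "\<dots> \<le> \<delta> n"
    proof -
      have "1 / real (Suc m) \<le> 1 / real (Suc n)" using that by (intro divide_left_mono) auto
      then show ?thesis using d_D[of m] by (simp add: \<delta>_def)
    qed
    finally show ?thesis .
  qed
  \<comment> \<open>An elementary substitute for the Cauchy-Schwarz inequality: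
    \<open>\<bar>y\<bar> \<le> e + y\<^sup>2 / e\<close>, with \<open>e\<close> adjusted afterwards,
    leads from the \<open>L\<^sup>2\<close> to the \<open>L\<^sup>1\<close> distance.\<close>
  have L1: "(LINT x|M. norm (\<tau> n x - \<tau> m x)) \<le> e * \<mu> + \<delta> n / e" if "n \<le> m" "0 < e" for n m e
  proof -
    have am: "\<bar>y\<bar> \<le> e + y\<^sup>2 / e" for y :: real
    proof (cases "\<bar>y\<bar> \<le> e")
      case True then show ?thesis using \<open>0 < e\<close> by (simp add: add_increasing2)
    next
      case False
      then have "\<bar>y\<bar> * e \<le> \<bar>y\<bar> * \<bar>y\<bar>" by (intro mult_left_mono) auto
      then have "\<bar>y\<bar> \<le> y\<^sup>2 / e" using \<open>0 < e\<close>
        by (simp add: pos_le_divide_eq power2_eq_square)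
      then show ?thesis using \<open>0 < e\<close> by simp
    qed
    note [measurable] = meas[OF \<tau>(1)]
    have sq: "integrable M (\<lambda>x. (\<tau> n x - \<tau> m x)\<^sup>2)"
    proof (rule integrable_const_bound[where B = 4])
      have "\<bar>\<tau> n x - \<tau> m x\<bar> \<le> 2" if "x \<in> space M" for x
        using bd[OF \<tau>(1)[of n] that] bd[OF \<tau>(1)[of m] that] by linarith
      then have "(\<tau> n x - \<tau> m x)\<^sup>2 \<le> 2\<^sup>2" if "x \<in> space M" for x
        using that by (subst abs_le_square_iff[symmetric]) simp
      then show "AE x in M. norm ((\<tau> n x - \<tau> m x)\<^sup>2) \<le> 4" by (intro AE_I2) simp
    qed simp
    have "(LINT x|M. norm (\<tau> n x - \<tau> m x)) \<le> (LINT x|M. e + (\<tau> n x - \<tau> m x)\<^sup>2 / e)"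
      using int(1)[OF \<tau>(1)] sq am by (intro integral_mono) auto
    also have "\<dots> = e * \<mu> + (LINT x|M. (\<tau> n x - \<tau> m x)\<^sup>2) / e"
      using sq by (simp add: \<mu>_def mult.commute)
    also have "\<dots> \<le> e * \<mu> + \<delta> n / e"
      using L2[OF that(1)] that(2) by (simp add: divide_right_mono)
    finally show ?thesis .
  qed
  have cauchy: "\<exists>N. \<forall>i\<ge>N. \<forall>j\<ge>N. (LINT x|M. norm (\<tau> i x - \<tau> j x)) < e" if "0 < e" for e
  proof -
    define e' where "e' = e / (4 * (\<mu> + 1))"
    have "e' > 0" using \<open>0 \<le> \<mu>\<close> that by (simp add: e'_def)
    have "e' * \<mu> \<le> e / 4" using \<open>0 \<le> \<mu>\<close> that by (simp add: e'_def field_simps)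
    have ee: "0 < e' * e / 4" using \<open>e' > 0\<close> that by simp
    obtain N where N: "\<And>n. N \<le> n \<Longrightarrow> \<bar>\<delta> n\<bar> < e' * e / 4"
      using LIMSEQ_D[OF \<delta>_lim ee] by auto
    have *: "(LINT x|M. norm (\<tau> i x - \<tau> j x)) < e" if "N \<le> i" "i \<le> j" for i j
    proof -
      have "\<delta> i / e' < e / 4" using N[OF that(1)] \<open>e' > 0\<close>
        by (simp add: pos_divide_less_eq mult.commute)
      then show ?thesis using L1[OF that(2) \<open>e' > 0\<close>] \<open>e' * \<mu> \<le> e / 4\<close> \<open>0 < e\<close> by linarith
    qed
    have "(LINT x|M. norm (\<tau> i x - \<tau> j x)) < e" if "N \<le> i" "N \<le> j" for i j
    proof (cases "i \<le> j")
      case False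
      have "(LINT x|M. norm (\<tau> i x - \<tau> j x)) = (LINT x|M. norm (\<tau> j x - \<tau> i x))"
        by (rule Bochner_Integration.integral_cong[OF refl norm_minus_commute])
      then show ?thesis using *[of j i] that False by simp
    qed (rule *[OF that(1)])
    then show ?thesis by blast
  qed
  \<comment> \<open>The subsequence can replace the sequence: \<open>n \<le> r n\<close> and the
    sets decrease, so its \<open>n\<close>-th term is still in \<open>C n\<close>.\<close>
  obtain r where r: "strict_mono r" "AE x in M. Cauchy (\<lambda>i. \<tau> (r i) x)"
  proof (rule cauchy_L1_AE_cauchy_subseq[of M \<tau>])
    show "integrable M (\<tau> n)" for n by (rule int(1)[OF \<tau>(1)])
    show "\<exists>N. \<forall>i\<ge>N. \<forall>j\<ge>N. (LINT x|M. norm (\<tau> i x - \<tau> j x)) < e" if "0 < e" for e by (rule cauchy[OF that])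
  qed blast
  show ?thesis
  proof (intro exI conjI allI)
    show "\<tau> (r n) \<in> C n" for n using sub[OF seq_suble[OF r(1)]] \<tau>(1) by blast
    show "AE x in M. convergent (\<lambda>n. \<tau> (r n) x)" using r(2) by (simp add: Cauchy_convergent_iff)
  qed
qed

text \<open>Convergence of integrals alone says nothing about values at single times, yet eventual
  constancy of the sequence must be passed on there. The sets \<open>C N\<close> therefore record
  bounds on values and on integrals, and both kinds survive midpoints and almost everywhere limits
  of bounded functions.\<close>

lemma weak_limit_exists:
  fixes s :: "nat \<Rightarrow> real \<Rightarrow> real"
  assumes meas: "\<And>n. s n \<in> borel_measurable (lebesgue_on {0..})"
    and bd: "\<And>n t. \<bar>s n t\<bar> \<le> 1"
    and lim: "\<And>t. 0 \<le> t \<Longrightarrow> (\<lambda>n. integral {0..t} (s n)) \<longlonglongrightarrow> S t"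
  shows "\<exists>\<sigma>. \<sigma> \<in> borel_measurable (lebesgue_on {0..}) \<and> (\<forall>t. \<bar>\<sigma> t\<bar> \<le> 1) \<and>
    (\<forall>t\<ge>0. integral {0..t} \<sigma> = S t) \<and>
    (AE t in lebesgue_on {0..}. \<forall>c. (\<forall>\<^sub>F n in sequentially. s n t = c) \<longrightarrow> \<sigma> t = c)"
proof -
  let ?L = "lebesgue_on {0::real..}"
  interpret L: sigma_finite_measure ?L
  proof (rule sigma_finite_measure.intro, intro exI conjI ballI)
    show "\<Union> (range (\<lambda>n::nat. {0..real n})) = space ?L" using real_arch_simple by auto
    show "range (\<lambda>n::nat. {0..real n}) \<subseteq> sets ?L" by (auto simp: sets_restrict_space_iff)
    show "emeasure ?L a \<noteq> \<infinity>" if "a \<in> range (\<lambda>n::nat. {0..real n})" for a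
      using that by (auto simp: emeasure_restrict_space)
  qed simp
  \<comment> \<open>The \<open>L\<^sup>2\<close> argument needs a finite measure, and the half-line
    is infinite. A positive integrable density gives a finite measure whose null sets are null for
    the original one.\<close>
  obtain h where h: "h \<in> borel_measurable ?L" "integral\<^sup>N ?L h \<noteq> \<infinity>" "\<And>x. x \<in> space ?L \<Longrightarrow> 0 < h x"
    using L.Ex_finite_integrable_function by blast
  define M where "M = density ?L h"
  have "emeasure M (space ?L) = (\<integral>\<^sup>+x. h x * indicator (space ?L) x \<partial>?L)"
    unfolding M_def by (rule emeasure_density[OF h(1)]) (rule sets.top)
  also have "\<dots> = integral\<^sup>N ?L h" by (rule nn_integral_cong) simp
  finally have "emeasure M (space ?L) = integral\<^sup>N ?L h" .
  then have fin: "finite_measure M" using h(2) by (intro finite_measureI) (simp add: M_def)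
  have AE_M: "AE x in ?L. P x" if "AE x in M. P x" for P
  proof -
    have "AE x in ?L. 0 < h x \<longrightarrow> P x" using that unfolding M_def
      by (subst (asm) AE_density[OF h(1)])
    moreover have "AE x in ?L. 0 < h x" using h(3) by (rule AE_I2)
    ultimately show ?thesis by eventually_elim blast
  qed
  define I where "I t f = integral {0..t} f" for t and f :: "real \<Rightarrow> real"
  txt \<open>\<open>C N\<close> stands in for the closed convex hull of the tail of the sequence from \<open>N\<close> on.\<close>
  define C where "C N = {\<tau> \<in> borel_measurable ?L. \<forall>t\<ge>0.
      (\<forall>a b. (\<forall>k\<ge>N. a \<le> s k t \<and> s k t \<le> b) \<longrightarrow> a \<le> \<tau> t \<and> \<tau> t \<le> b) \<and>
      (\<forall>a b. (\<forall>k\<ge>N. a \<le> I t (s k) \<and> I t (s k) \<le> b) \<longrightarrow> a \<le> I t \<tau> \<and> I t \<tau> \<le> b)}" for N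
  have C_meas: "\<tau> \<in> borel_measurable ?L" if "\<tau> \<in> C N" for \<tau> N using that
    by (simp add: C_def)
  have C_val: "a \<le> \<tau> t \<and> \<tau> t \<le> b"
    if "\<tau> \<in> C N" "0 \<le> t" "\<And>k. N \<le> k \<Longrightarrow> a \<le> s k t \<and> s k t \<le> b" for \<tau> N t a b
    using that unfolding C_def by blast
  have C_int: "a \<le> I t \<tau> \<and> I t \<tau> \<le> b"
    if "\<tau> \<in> C N" "0 \<le> t" "\<And>k. N \<le> k \<Longrightarrow> a \<le> I t (s k) \<and> I t (s k) \<le> b" for \<tau> N t a b
    using that unfolding C_def by blast
  have C_bd: "\<bar>\<tau> t\<bar> \<le> 1" if "\<tau> \<in> C N" "0 \<le> t" for \<tau> N t
  proof -
    have "-1 \<le> \<tau> t \<and> \<tau> t \<le> 1"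
      by (rule C_val[OF that]) (use bd in \<open>simp add: abs_le_iff minus_le_iff\<close>)
    then show ?thesis by linarith
  qed
  have sub_meas: "f \<in> borel_measurable (lebesgue_on {0..t})" if "f \<in> borel_measurable ?L" for f :: "real \<Rightarrow> real" and t
    using that by (rule measurable_restrict_mono) auto
  have C_integrable: "\<tau> integrable_on {0..t}" if "\<tau> \<in> C N" for \<tau> N t
    by (rule bounded_measurable_integrable_on[OF sub_meas[OF C_meas[OF that]]]) (rule C_bd[OF that], simp)
  obtain g where g: "\<And>n. g n \<in> C n" and conv: "AE x in M. convergent (\<lambda>n. g n x)"
  proof -
    have "\<exists>g. (\<forall>n. g n \<in> C n) \<and> (AE x in M. convergent (\<lambda>n. g n x))"
    proof (rule midpoint_convex_ae_convergent[OF fin])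
      show "C (Suc n) \<subseteq> C n" for n
      proof
        fix \<tau> assume \<tau>: "\<tau> \<in> C (Suc n)"
        then show "\<tau> \<in> C n" unfolding C_def by (simp (no_asm_use)) (meson Suc_leD)
      qed
      show "C n \<noteq> {}" for n
      proof -
        have "s n \<in> C n" unfolding C_def using meas by blast
        then show ?thesis by blast
      qed
      show "\<tau> \<in> borel_measurable M" if "\<tau> \<in> C n" for n \<tau> using C_meas[OF that]
        by (simp add: M_def)
      show "\<bar>\<tau> x\<bar> \<le> 1" if "\<tau> \<in> C n" "x \<in> space M" for n \<tau> x
        using C_bd[OF that(1)] that(2) by (simp add: M_def)
      show "(\<lambda>x. (\<tau> x + \<tau>' x) / 2) \<in> C n" if \<tau>: "\<tau> \<in> C n"
        and \<tau>': "\<tau>' \<in> C n" for n \<tau> \<tau>'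
      proof -
        have It: "I t (\<lambda>x. (\<tau> x + \<tau>' x) / 2) = (I t \<tau> + I t \<tau>') / 2" for t
          unfolding I_def using C_integrable[OF \<tau>, of t] C_integrable[OF \<tau>', of t]
          by (simp add: Henstock_Kurzweil_Integration.integral_add)
        have "(\<lambda>x. (\<tau> x + \<tau>' x) / 2) \<in> borel_measurable ?L"
          using C_meas[OF \<tau>] C_meas[OF \<tau>'] by simp
        moreover have "a \<le> (\<tau> t + \<tau>' t) / 2 \<and> (\<tau> t + \<tau>' t) / 2 \<le> b"
          if "0 \<le> t" "\<forall>k\<ge>n. a \<le> s k t \<and> s k t \<le> b" for t a b
          using C_val[OF \<tau> that(1), of a b] C_val[OF \<tau>' that(1), of a b] that(2) by force
        moreover have "a \<le> I t (\<lambda>x. (\<tau> x + \<tau>' x) / 2) \<and> I t (\<lambda>x. (\<tau> x + \<tau>' x) / 2) \<le> b"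
          if "0 \<le> t" "\<forall>k\<ge>n. a \<le> I t (s k) \<and> I t (s k) \<le> b" for t a b
          unfolding It
          using C_int[OF \<tau> that(1), of a b] C_int[OF \<tau>' that(1), of a b] that(2) by force
        ultimately show ?thesis unfolding C_def by blast
      qed
    qed
    then show ?thesis using that by blast
  qed
  define \<sigma>0 where "\<sigma>0 t = lim (\<lambda>n. g n t)" for t
  \<comment> \<open>\<open>lim\<close> is arbitrary where the sequence diverges. Clipping gives the
    bound 1 at every time and changes nothing at nonnegative times where the sequence
    converges.\<close>
  define \<sigma> where "\<sigma> t = max (-1) (min 1 (\<sigma>0 t))" for t
  have "\<sigma>0 \<in> borel_measurable ?L"
    unfolding \<sigma>0_def[abs_def] using C_meas[OF g] by (rule borel_measurable_lim_metric)
  then have \<sigma>_meas: "\<sigma> \<in> borel_measurable ?L" unfolding \<sigma>_def[abs_def] by simp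
  have \<sigma>_bd: "\<bar>\<sigma> t\<bar> \<le> 1" for t by (auto simp: \<sigma>_def abs_le_iff)
  have "AE t in ?L. 0 \<le> t" by (rule AE_I2) simp
  then have \<sigma>_lim: "AE t in ?L. 0 \<le> t \<and> (\<lambda>n. g n t) \<longlonglongrightarrow> \<sigma> t"
    using AE_M[OF conv]
  proof eventually_elim
    case (elim t)
    then have l: "(\<lambda>n. g n t) \<longlonglongrightarrow> \<sigma>0 t"
      by (simp add: \<sigma>0_def convergent_LIMSEQ_iff)
    have "\<bar>g n t\<bar> \<le> 1" for n using C_bd[OF g elim(1)] .
    then have "\<bar>\<sigma>0 t\<bar> \<le> 1" using LIMSEQ_le_const2[OF tendsto_rabs[OF l]] by blast
    then have "\<sigma> t = \<sigma>0 t" by (simp add: \<sigma>_def abs_le_iff min_def max_def)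
    then show ?case using l elim by simp
  qed
  \<comment> \<open>Two limits of the same integrals: dominated convergence gives the integral of
    \<open>\<sigma>\<close>, membership in \<open>C n\<close> squeezes them towards
    \<open>S t\<close>.\<close>
  have \<sigma>_int: "integral {0..t} \<sigma> = S t" if t: "0 \<le> t" for t
  proof (rule LIMSEQ_unique)
    have fm: "finite_measure (lebesgue_on {0..t})"
      by (rule finite_measureI) (simp add: emeasure_restrict_space t)
    have le: "integral\<^sup>L (lebesgue_on {0..t}) f = integral {0..t} f"
      if "f \<in> borel_measurable ?L" "\<And>x. 0 \<le> x \<Longrightarrow> \<bar>f x\<bar> \<le> 1" for f :: "real \<Rightarrow> real"
    proof (rule lebesgue_integral_eq_integral)
      show "integrable (lebesgue_on {0..t}) f"
      proof (rule finite_measure.integrable_const_bound[OF fm, where B = 1])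
        show "AE x in lebesgue_on {0..t}. norm (f x) \<le> 1" by (rule AE_I2) (simp add: that(2))
      qed (rule sub_meas[OF that(1)])
    qed simp
    have "(\<lambda>n. integral\<^sup>L (lebesgue_on {0..t}) (g n)) \<longlonglongrightarrow> integral\<^sup>L (lebesgue_on {0..t}) \<sigma>"
    proof (rule integral_dominated_convergence[where w = "\<lambda>_. 1"])
      show "AE x in lebesgue_on {0..t}. (\<lambda>n. g n x) \<longlonglongrightarrow> \<sigma> x"
      proof -
        have "AE x in lebesgue. x \<in> {0..} \<longrightarrow> 0 \<le> x \<and> (\<lambda>n. g n x) \<longlonglongrightarrow> \<sigma> x"
          using \<sigma>_lim by (subst (asm) AE_restrict_space_iff) simp_all
        then have "AE x in lebesgue. x \<in> {0..t} \<longrightarrow> (\<lambda>n. g n x) \<longlonglongrightarrow> \<sigma> x"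
          by eventually_elim simp
        then show ?thesis by (subst AE_restrict_space_iff) simp_all
      qed
      show "AE x in lebesgue_on {0..t}. norm (g n x) \<le> 1" for n
        by (rule AE_I2) (simp add: C_bd[OF g])
      show "integrable (lebesgue_on {0..t}) (\<lambda>_. 1 :: real)"
        by (rule finite_measure.integrable_const[OF fm])
    qed (rule sub_meas[OF \<sigma>_meas], rule sub_meas[OF C_meas[OF g]])
    then show "(\<lambda>n. I t (g n)) \<longlonglongrightarrow> integral {0..t} \<sigma>"
      using le[OF C_meas[OF g] C_bd[OF g]] le[OF \<sigma>_meas \<sigma>_bd] by (simp add: I_def)
    show "(\<lambda>n. I t (g n)) \<longlonglongrightarrow> S t"
    proof (rule LIMSEQ_I)
      fix r :: real assume "0 < r"
      then have "0 < r / 2" by simp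
      then obtain N where N: "\<And>k. N \<le> k \<Longrightarrow> norm (I t (s k) - S t) < r / 2"
        using LIMSEQ_D[OF lim[OF t]] unfolding I_def by meson
      have "norm (I t (g n) - S t) < r" if "N \<le> n" for n
      proof -
        have "S t - r / 2 \<le> I t (g n) \<and> I t (g n) \<le> S t + r / 2"
        proof (rule C_int[OF g t])
          show "S t - r / 2 \<le> I t (s k) \<and> I t (s k) \<le> S t + r / 2" if "n \<le> k" for k
          proof -
            have "\<bar>I t (s k) - S t\<bar> < r / 2" using N[of k] that \<open>N \<le> n\<close> by simp
            then show ?thesis by linarith
          qed
        qed
        then have "\<bar>I t (g n) - S t\<bar> \<le> r / 2" by linarith
        then show ?thesis using \<open>0 < r\<close> by simp
      qed
      then show "\<exists>no. \<forall>n\<ge>no. norm (I t (g n) - S t) < r" by blast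
    qed
  qed
  have "AE t in ?L. \<forall>c. (\<forall>\<^sub>F n in sequentially. s n t = c) \<longrightarrow> \<sigma> t = c"
    using \<sigma>_lim
  proof eventually_elim
    case (elim t)
    show ?case
    proof (intro allI impI)
      fix c assume "\<forall>\<^sub>F n in sequentially. s n t = c"
      then obtain N where N: "\<And>n. N \<le> n \<Longrightarrow> s n t = c"
        by (auto simp: eventually_sequentially)
      have "g n t = c" if "N \<le> n" for n
        using C_val[OF g, of t n c c] elim N that by force
      then have "(\<lambda>n. g n t) \<longlonglongrightarrow> c"
        by (intro tendsto_eventually) (auto simp: eventually_sequentially)
      then show "\<sigma> t = c" using elim LIMSEQ_unique by blast
    qed
  qed
  then show ?thesis using \<sigma>_meas \<sigma>_bd \<sigma>_int by blast
qed

section \<open>Euler polygons of one block\<close>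

lemma locally_bounded_measurableI:
  fixes f :: "real \<Rightarrow> real"
  assumes "f \<in> borel_measurable (lebesgue_on {0..})"
    and "\<And>T. 0 \<le> T \<Longrightarrow> \<exists>M. \<forall>t. 0 \<le> t \<and> t \<le> T \<longrightarrow> \<bar>f t\<bar> \<le> M"
  shows "locally_bounded_measurable f"
  unfolding locally_bounded_measurable_def
proof (intro conjI allI impI)
  fix T :: real assume "0 \<le> T"
  then obtain M where "\<forall>t. 0 \<le> t \<and> t \<le> T \<longrightarrow> \<bar>f t\<bar> \<le> M"
    using assms(2) by blast
  then show "bounded (f ` {0..T})" unfolding bounded_iff by (intro exI[of _ M]) auto
qed (rule assms(1))

lemma locally_bounded_measurable_measurable:
  "locally_bounded_measurable f \<Longrightarrow> f \<in> borel_measurable (lebesgue_on {0..})"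
  by (simp add: locally_bounded_measurable_def)

lemma locally_bounded_measurable_add:
  fixes f g :: "real \<Rightarrow> real"
  assumes f: "locally_bounded_measurable f" and g: "locally_bounded_measurable g"
  shows "locally_bounded_measurable (\<lambda>t. f t + g t)"
proof (rule locally_bounded_measurableI)
  show "(\<lambda>t. f t + g t) \<in> borel_measurable (lebesgue_on {0..})"
    using assms[THEN locally_bounded_measurable_measurable] by simp
  fix T :: real assume "0 \<le> T"
  obtain M where M: "\<And>t. \<lbrakk>0 \<le> t; t \<le> T\<rbrakk> \<Longrightarrow> \<bar>f t\<bar> \<le> M" using locally_bounded_measurableD[OF f \<open>0 \<le> T\<close>] by blast
  obtain M' where M': "\<And>t. \<lbrakk>0 \<le> t; t \<le> T\<rbrakk> \<Longrightarrow> \<bar>g t\<bar> \<le> M'" using locally_bounded_measurableD[OF g \<open>0 \<le> T\<close>] by blast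
  have "\<bar>f t + g t\<bar> \<le> M + M'" if "0 \<le> t \<and> t \<le> T" for t
    using M[of t] M'[of t] that by linarith
  then show "\<exists>M. \<forall>t. 0 \<le> t \<and> t \<le> T \<longrightarrow> \<bar>f t + g t\<bar> \<le> M" by blast
qed

lemma locally_bounded_measurable_cmult:
  fixes f :: "real \<Rightarrow> real"
  assumes f: "locally_bounded_measurable f"
  shows "locally_bounded_measurable (\<lambda>t. c * f t)"
proof (rule locally_bounded_measurableI)
  show "(\<lambda>t. c * f t) \<in> borel_measurable (lebesgue_on {0..})"
    using assms[THEN locally_bounded_measurable_measurable] by simp
  fix T :: real assume "0 \<le> T"
  obtain M where M: "\<And>t. \<lbrakk>0 \<le> t; t \<le> T\<rbrakk> \<Longrightarrow> \<bar>f t\<bar> \<le> M" using locally_bounded_measurableD[OF f \<open>0 \<le> T\<close>] by blast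
  have "\<bar>c * f t\<bar> \<le> \<bar>c\<bar> * M" if "0 \<le> t \<and> t \<le> T" for t
    using M[of t] that by (simp add: abs_mult mult_left_mono)
  then show "\<exists>M. \<forall>t. 0 \<le> t \<and> t \<le> T \<longrightarrow> \<bar>c * f t\<bar> \<le> M" by blast
qed

lemma locally_bounded_measurable_diff:
  fixes f g :: "real \<Rightarrow> real"
  assumes f: "locally_bounded_measurable f" and g: "locally_bounded_measurable g"
  shows "locally_bounded_measurable (\<lambda>t. f t - g t)"
  using locally_bounded_measurable_add[OF f locally_bounded_measurable_cmult[OF g, of "-1"]] by simp

lemma locally_bounded_measurable_const:
  "locally_bounded_measurable (\<lambda>_. c :: real)"
  by (rule locally_bounded_measurableI) auto

lemma continuous_on_locally_bounded_measurable:
  fixes f :: "real \<Rightarrow> real"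
  assumes "continuous_on {0..} f"
  shows "locally_bounded_measurable f"
  unfolding locally_bounded_measurable_def
proof (intro conjI allI impI)
  show "f \<in> borel_measurable (lebesgue_on {0..})"
    by (rule continuous_imp_measurable_on_sets_lebesgue[OF assms]) simp
  show "bounded (f ` {0..T})" for T
    by (intro compact_imp_bounded compact_continuous_image continuous_on_subset[OF assms]) auto
qed

lemma abs_signed_powr_le:
  assumes "0 \<le> p" "p \<le> 1"
  shows "\<bar>signed_powr a p\<bar> \<le> 1 + \<bar>a\<bar>"
proof (cases "a = 0")
  case False
  have "\<bar>a\<bar> powr p \<le> (1 + \<bar>a\<bar>) powr p" using assms by (intro powr_mono2) auto
  also have "\<dots> \<le> (1 + \<bar>a\<bar>) powr 1" using assms by (intro powr_mono) auto
  finally show ?thesis using False by (simp add: abs_signed_powr)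
qed (simp add: signed_powr_def)

lemma locally_bounded_measurable_signed_powr:
  fixes f :: "real \<Rightarrow> real"
  assumes f: "locally_bounded_measurable f" and p: "0 \<le> p" "p \<le> 1"
  shows "locally_bounded_measurable (\<lambda>t. signed_powr (f t) p)"
proof (rule locally_bounded_measurableI)
  have "f \<in> borel_measurable (lebesgue_on {0..})" by (rule locally_bounded_measurable_measurable[OF f])
  moreover have "(\<lambda>a. signed_powr a p) \<in> borel_measurable borel"
    unfolding signed_powr_def sgn_if by measurable
  ultimately show "(\<lambda>t. signed_powr (f t) p) \<in> borel_measurable (lebesgue_on {0..})"
    by (rule measurable_compose)
  fix T :: real assume "0 \<le> T"
  obtain M where M: "\<And>t. \<lbrakk>0 \<le> t; t \<le> T\<rbrakk> \<Longrightarrow> \<bar>f t\<bar> \<le> M" using locally_bounded_measurableD[OF f \<open>0 \<le> T\<close>] by blast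
  have "\<bar>signed_powr (f t) p\<bar> \<le> 1 + M" if "0 \<le> t \<and> t \<le> T" for t
    using abs_signed_powr_le[OF p, of "f t"] M[of t] that by linarith
  then show "\<exists>M. \<forall>t. 0 \<le> t \<and> t \<le> T \<longrightarrow> \<bar>signed_powr (f t) p\<bar> \<le> M" by blast
qed

text \<open>A single block with all else already known: \<open>g j\<close> collects the nonlinearity
  evaluated along an earlier block and the signal \<open>wh\<close>, so the block is linear apart
  from its injections.\<close>

locale observer_block =
  fixes n :: nat and g :: "nat \<Rightarrow> real \<Rightarrow> real" and y :: "real \<Rightarrow> real"
    and c x0 :: "nat \<Rightarrow> real"
  assumes n: "1 \<le> n" and g: "\<And>j. j \<in> {1..n} \<Longrightarrow> locally_bounded_measurable (g j)"
    and y: "locally_bounded_measurable y" and c: "0 < c n"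
begin

definition pw :: "nat \<Rightarrow> real" where "pw j = (real n - real j) / real n"

text \<open>For \<open>j = n\<close> the exponent is \<open>0\<close> and \<open>signed_powr a 0 = sgn a\<close>, a selection of \<open>sign_set a\<close>.\<close>

definition H :: "nat \<Rightarrow> real \<Rightarrow> (nat \<Rightarrow> real) \<Rightarrow> real" where
  "H j t x = (if j < n then x (Suc j) else 0) + g j t - c j * signed_powr (x 1 - y t) (pw j)"

lemma pw: "j \<in> {1..n} \<Longrightarrow> 0 \<le> pw j" "j \<in> {1..n} \<Longrightarrow> pw j \<le> 1" "j \<in> {1..<n} \<Longrightarrow> 0 < pw j" "pw n = 0"
  using n by (auto simp: pw_def field_simps)

lemma H_locally_bounded_measurable:
  assumes x: "\<And>i. i \<in> {1..n} \<Longrightarrow> locally_bounded_measurable (\<lambda>t. x t i)"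
    and j: "j \<in> {1..n}"
  shows "locally_bounded_measurable (\<lambda>t. H j t (x t))"
proof -
  have "locally_bounded_measurable (\<lambda>t. if j < n then x t (Suc j) else 0)"
    using x[of "Suc j"] locally_bounded_measurable_const[of 0] by (cases "j < n") auto
  moreover have "locally_bounded_measurable (\<lambda>t. signed_powr (x t 1 - y t) (pw j))"
    by (intro locally_bounded_measurable_signed_powr locally_bounded_measurable_diff x y pw(1)[OF j] pw(2)[OF j]) (use n in auto)
  ultimately show ?thesis unfolding H_def
    by (intro locally_bounded_measurable_diff locally_bounded_measurable_add locally_bounded_measurable_cmult g[OF j])
qed

text \<open>Injection exponents at most 1 leave a field of linear growth, so no polygon can escape
  in finite time.\<close>

lemma H_growth:
  assumes "0 \<le> T"
  shows "\<exists>K\<ge>0. \<forall>t x j. 0 \<le> t \<and> t \<le> T \<and> j \<in> {1..n} \<longrightarrow> \<bar>H j t x\<bar> \<le> K * (1 + (\<Sum>i=1..n. \<bar>x i\<bar>))"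
proof -
  have "\<exists>M. \<forall>t. 0 \<le> t \<and> t \<le> T \<longrightarrow> \<bar>g j t\<bar> \<le> M" if "j \<in> {1..n}" for j
    using locally_bounded_measurableD[OF g[OF that] \<open>0 \<le> T\<close>] by metis
  then obtain G where G: "\<And>j t. \<lbrakk>j \<in> {1..n}; 0 \<le> t; t \<le> T\<rbrakk> \<Longrightarrow> \<bar>g j t\<bar> \<le> G j" by metis
  obtain Y where Y: "0 \<le> Y" "\<And>t. \<lbrakk>0 \<le> t; t \<le> T\<rbrakk> \<Longrightarrow> \<bar>y t\<bar> \<le> Y"
    using locally_bounded_measurableD[OF y \<open>0 \<le> T\<close>] by metis
  define K where "K = 1 + (\<Sum>j=1..n. \<bar>G j\<bar>) + (\<Sum>j=1..n. \<bar>c j\<bar>) * (1 + Y)"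
  have nn: "0 \<le> (\<Sum>j=1..n. \<bar>G j\<bar>)" "0 \<le> (\<Sum>j=1..n. \<bar>c j\<bar>)"
    by (intro sum_nonneg; simp)+
  then have "0 \<le> K" using Y(1) by (simp add: K_def)
  moreover have "\<bar>H j t x\<bar> \<le> K * (1 + (\<Sum>i=1..n. \<bar>x i\<bar>))" if t: "0 \<le> t" "t \<le> T" and j: "j \<in> {1..n}" for t x j
  proof -
    define s where "s = (\<Sum>i=1..n. \<bar>x i\<bar>)"
    have s: "\<bar>x i\<bar> \<le> s" if "i \<in> {1..n}" for i
      unfolding s_def using that by (intro member_le_sum) auto
    have "0 \<le> s" unfolding s_def by (intro sum_nonneg) simp
    have 1: "\<bar>if j < n then x (Suc j) else 0\<bar> \<le> s"
      using s[of "Suc j"] \<open>0 \<le> s\<close> j by auto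
    have 2: "\<bar>g j t\<bar> \<le> (\<Sum>j=1..n. \<bar>G j\<bar>)"
    proof -
      have "\<bar>G j\<bar> \<le> (\<Sum>j=1..n. \<bar>G j\<bar>)" using j by (intro member_le_sum) auto
      then show ?thesis using G[OF j t] by linarith
    qed
    have 3: "\<bar>c j * signed_powr (x 1 - y t) (pw j)\<bar> \<le> (\<Sum>j=1..n. \<bar>c j\<bar>) * (1 + (s + Y))"
      unfolding abs_mult
    proof (rule mult_mono)
      show "\<bar>c j\<bar> \<le> (\<Sum>j=1..n. \<bar>c j\<bar>)" using j by (intro member_le_sum) auto
      show "\<bar>signed_powr (x 1 - y t) (pw j)\<bar> \<le> 1 + (s + Y)"
        using abs_signed_powr_le[OF pw(1)[OF j] pw(2)[OF j], of "x 1 - y t"] s[of 1] n Y(2)[OF t] by auto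
    qed (use nn in auto)
    have "\<bar>H j t x\<bar> \<le> s + (\<Sum>j=1..n. \<bar>G j\<bar>) + (\<Sum>j=1..n. \<bar>c j\<bar>) * (1 + (s + Y))"
      unfolding H_def using 1 2 3 by linarith
    also have "\<dots> \<le> K * (1 + s)"
    proof -
      have "0 \<le> (\<Sum>j=1..n. \<bar>G j\<bar>) * s" "0 \<le> (\<Sum>j=1..n. \<bar>c j\<bar>) * (Y * s)"
        using nn \<open>0 \<le> s\<close> Y(1) by simp_all
      then show ?thesis by (simp add: K_def algebra_simps)
    qed
    finally show ?thesis by (simp add: s_def)
  qed
  ultimately show ?thesis by blast
qed

text \<open>Only the state is frozen during a step, while time is integrated: \<open>g\<close> and
  \<open>y\<close> are merely measurable, so their samples at grid points would carry no
  information.\<close>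

primrec euler :: "real \<Rightarrow> nat \<Rightarrow> nat \<Rightarrow> real" where
  "euler h 0 = x0"
| "euler h (Suc k) = (\<lambda>j. euler h k j + integral {real k * h..real (Suc k) * h} (\<lambda>s. H j s (euler h k)))"

definition euler_step :: "real \<Rightarrow> real \<Rightarrow> nat \<Rightarrow> real" where
  "euler_step h t = euler h (nat \<lfloor>t / h\<rfloor>)"

definition euler_path :: "real \<Rightarrow> real \<Rightarrow> nat \<Rightarrow> real" where
  "euler_path h t j = x0 j + integral {0..t} (\<lambda>s. H j s (euler_step h s))"

lemma euler_step_locally_bounded_measurable:
  assumes "0 < h"
  shows "locally_bounded_measurable (\<lambda>t. euler_step h t i)"
proof (rule locally_bounded_measurableI)
  have "(\<lambda>t::real. nat \<lfloor>t / h\<rfloor>) \<in> measurable borel (count_space UNIV)"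
    by measurable
  then have "(\<lambda>t. euler h (nat \<lfloor>t / h\<rfloor>) i) \<in> borel_measurable borel"
    by (rule measurable_compose[where g = "\<lambda>k. euler h k i"]) simp
  then have "(\<lambda>t. euler_step h t i) \<in> borel_measurable lborel" by (simp add: euler_step_def)
  then show "(\<lambda>t. euler_step h t i) \<in> borel_measurable (lebesgue_on {0..})"
    by (intro measurable_restrict_space1 measurable_completion)
  fix T :: real assume "0 \<le> T"
  define M where "M = (\<Sum>k\<le>nat \<lfloor>T / h\<rfloor>. \<bar>euler h k i\<bar>)"
  have "\<bar>euler_step h t i\<bar> \<le> M" if "0 \<le> t \<and> t \<le> T" for t
  proof -
    have "nat \<lfloor>t / h\<rfloor> \<le> nat \<lfloor>T / h\<rfloor>" using that assms
      by (intro nat_mono floor_mono divide_right_mono) auto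
    then show ?thesis unfolding euler_step_def M_def
      by (intro member_le_sum[of _ _ "\<lambda>k. \<bar>euler h k i\<bar>"]) auto
  qed
  then show "\<exists>M. \<forall>t. 0 \<le> t \<and> t \<le> T \<longrightarrow> \<bar>euler_step h t i\<bar> \<le> M" by blast
qed

lemma H_euler_step:
  "0 < h \<Longrightarrow> j \<in> {1..n} \<Longrightarrow> locally_bounded_measurable (\<lambda>s. H j s (euler_step h s))"
  by (intro H_locally_bounded_measurable euler_step_locally_bounded_measurable)

lemma euler_path_grid:
  assumes h: "0 < h" and j: "j \<in> {1..n}"
  shows "euler_path h (real k * h) j = euler h k j"
proof (induction k)
  case 0
  then show ?case by (simp add: euler_path_def)
next
  case (Suc k)
  have "integral {real k * h..real (Suc k) * h} (\<lambda>s. H j s (euler_step h s))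
      = integral {real k * h..real (Suc k) * h} (\<lambda>s. H j s (euler h k))"
  \<comment> \<open>At the right end point alone \<open>euler_step\<close> has already jumped to the
    next node.\<close>
  proof (rule integral_spike[of "{real (Suc k) * h}"])
    fix s assume s: "s \<in> {real k * h..real (Suc k) * h} - {real (Suc k) * h}"
    then have "real k \<le> s / h" "s / h < real k + 1"
      using h by (auto simp: pos_le_divide_eq pos_divide_less_eq algebra_simps)
    then have "\<lfloor>s / h\<rfloor> = int k" by linarith
    then show "H j s (euler h k) = H j s (euler_step h s)" by (simp add: euler_step_def)
  qed simp
  moreover have "integral {0..real (Suc k) * h} (\<lambda>s. H j s (euler_step h s)) - integral {0..real k * h} (\<lambda>s. H j s (euler_step h s))
      = integral {real k * h..real (Suc k) * h} (\<lambda>s. H j s (euler_step h s))"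
    using h by (intro indefinite_integral_diff H_euler_step j) (auto simp: mult_right_mono)
  ultimately show ?case using Suc by (simp add: euler_path_def)
qed

text \<open>Discrete Gronwall: one step multiplies the left-hand side by at most
  \<open>1 + n * K * h\<close>, which is at most \<open>exp (n * K * h)\<close>.\<close>

lemma euler_bound:
  assumes h: "0 < h" and K: "0 \<le> K" and "real k * h \<le> T"
    and growth: "\<And>t x j. \<lbrakk>0 \<le> t; t \<le> T; j \<in> {1..n}\<rbrakk> \<Longrightarrow> \<bar>H j t x\<bar> \<le> K * (1 + (\<Sum>i=1..n. \<bar>x i\<bar>))"
  shows "1 + (\<Sum>i=1..n. \<bar>euler h k i\<bar>) \<le> (1 + (\<Sum>i=1..n. \<bar>x0 i\<bar>)) * exp (real n * K * (real k * h))"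
  using assms(3)
proof (induction k)
  case (Suc k)
  define S where "S = 1 + (\<Sum>i=1..n. \<bar>euler h k i\<bar>)"
  have "0 \<le> S" unfolding S_def by (intro add_nonneg_nonneg sum_nonneg) auto
  have kh: "real k * h \<le> T" using Suc.prems h by (simp add: algebra_simps)
  have each: "\<bar>euler h (Suc k) i\<bar> \<le> \<bar>euler h k i\<bar> + K * S * h" if i: "i \<in> {1..n}" for i
  proof -
    have lbm: "locally_bounded_measurable (\<lambda>s. H i s (euler h k))"
      by (rule H_locally_bounded_measurable[OF locally_bounded_measurable_const i])
    have "\<bar>integral {0..real (Suc k) * h} (\<lambda>s. H i s (euler h k)) - integral {0..real k * h} (\<lambda>s. H i s (euler h k))\<bar>
        \<le> (K * S) * (real (Suc k) * h - real k * h)"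
    proof (rule indefinite_integral_Lipschitz[OF lbm])
      show "\<bar>H i t (euler h k)\<bar> \<le> K * S" if "real k * h \<le> t" "t \<le> real (Suc k) * h" for t
        unfolding S_def
      proof (rule growth)
        have "0 \<le> real k * h" using h by simp
        then show "0 \<le> t" using that(1) by linarith
        show "t \<le> T" using that(2) Suc.prems by linarith
      qed (rule i)
    qed (use h in \<open>auto simp: mult_right_mono\<close>)
    moreover have "integral {0..real (Suc k) * h} (\<lambda>s. H i s (euler h k)) - integral {0..real k * h} (\<lambda>s. H i s (euler h k))
      = integral {real k * h..real (Suc k) * h} (\<lambda>s. H i s (euler h k))"
      using h by (intro indefinite_integral_diff lbm) (auto simp: mult_right_mono)
    ultimately show ?thesis by (simp add: algebra_simps)
  qed
  have "1 + (\<Sum>i=1..n. \<bar>euler h (Suc k) i\<bar>) \<le> 1 + (\<Sum>i=1..n. \<bar>euler h k i\<bar> + K * S * h)"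
    using each by (intro add_left_mono sum_mono)
  also have "\<dots> = S * (1 + real n * K * h)" by (simp add: S_def sum.distrib algebra_simps)
  also have "\<dots> \<le> S * exp (real n * K * h)"
    using \<open>0 \<le> S\<close> by (intro mult_left_mono exp_ge_add_one_self)
  also have "\<dots> \<le> ((1 + (\<Sum>i=1..n. \<bar>x0 i\<bar>)) * exp (real n * K * (real k * h))) * exp (real n * K * h)"
    unfolding S_def using Suc.IH[OF kh] by (intro mult_right_mono) auto
  also have "\<dots> = (1 + (\<Sum>i=1..n. \<bar>x0 i\<bar>)) * exp (real n * K * (real (Suc k) * h))"
    by (simp add: mult_exp_exp algebra_simps)
  finally show ?case .
qed simp

definition euler_estimate :: "real \<Rightarrow> real \<Rightarrow> bool" where
  "euler_estimate T Q \<longleftrightarrow> 0 \<le> Q \<and>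
    (\<forall>h t j. 0 < h \<and> 0 \<le> t \<and> t \<le> T \<and> j \<in> {1..n} \<longrightarrow> \<bar>H j t (euler_step h t)\<bar> \<le> Q) \<and>
    (\<forall>h t j. 0 < h \<and> 0 \<le> t \<and> t \<le> T \<and> j \<in> {1..n} \<longrightarrow> \<bar>euler_path h t j - euler_step h t j\<bar> \<le> Q * h) \<and>
    (\<forall>h s t j. 0 < h \<and> 0 \<le> s \<and> s \<le> t \<and> t \<le> T \<and> j \<in> {1..n} \<longrightarrow>
      \<bar>euler_path h t j - euler_path h s j\<bar> \<le> Q * (t - s))"

lemma euler_estimateD:
  assumes "euler_estimate T Q"
  shows "0 \<le> Q"
    and "\<lbrakk>0 < h; 0 \<le> t; t \<le> T; j \<in> {1..n}\<rbrakk> \<Longrightarrow> \<bar>H j t (euler_step h t)\<bar> \<le> Q"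
    and "\<lbrakk>0 < h; 0 \<le> t; t \<le> T; j \<in> {1..n}\<rbrakk> \<Longrightarrow> \<bar>euler_path h t j - euler_step h t j\<bar> \<le> Q * h"
    and "\<lbrakk>0 < h; 0 \<le> s; s \<le> t; t \<le> T; j \<in> {1..n}\<rbrakk> \<Longrightarrow> \<bar>euler_path h t j - euler_path h s j\<bar> \<le> Q * (t - s)"
proof -
  note * = assms[unfolded euler_estimate_def]
  show "0 \<le> Q" by (rule *[THEN conjunct1])
  show "\<lbrakk>0 < h; 0 \<le> t; t \<le> T; j \<in> {1..n}\<rbrakk> \<Longrightarrow> \<bar>H j t (euler_step h t)\<bar> \<le> Q"
    by (rule *[THEN conjunct2, THEN conjunct1, rule_format]) (intro conjI)
  show "\<lbrakk>0 < h; 0 \<le> t; t \<le> T; j \<in> {1..n}\<rbrakk> \<Longrightarrow> \<bar>euler_path h t j - euler_step h t j\<bar> \<le> Q * h"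
    by (rule *[THEN conjunct2, THEN conjunct2, THEN conjunct1, rule_format]) (intro conjI)
  show "\<lbrakk>0 < h; 0 \<le> s; s \<le> t; t \<le> T; j \<in> {1..n}\<rbrakk> \<Longrightarrow> \<bar>euler_path h t j - euler_path h s j\<bar> \<le> Q * (t - s)"
    by (rule *[THEN conjunct2, THEN conjunct2, THEN conjunct2, rule_format]) (intro conjI)
qed

text \<open>\<open>Q\<close> depends on the horizon \<open>T\<close> but not on the step size, as
  the compactness argument requires.\<close>

lemma euler_estimates:
  assumes T: "0 \<le> T"
  shows "\<exists>Q. euler_estimate T Q"
proof -
  obtain K where K: "0 \<le> K"
    and growth: "\<And>t x j. \<lbrakk>0 \<le> t; t \<le> T; j \<in> {1..n}\<rbrakk> \<Longrightarrow> \<bar>H j t x\<bar> \<le> K * (1 + (\<Sum>i=1..n. \<bar>x i\<bar>))"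
    using H_growth[OF T] by metis
  define S0 where "S0 = 1 + (\<Sum>i=1..n. \<bar>x0 i\<bar>)"
  have "0 \<le> S0" unfolding S0_def by (intro add_nonneg_nonneg sum_nonneg) auto
  define Q where "Q = K * (S0 * exp (real n * K * T))"
  have "0 \<le> Q" using K \<open>0 \<le> S0\<close> by (simp add: Q_def)
  have grid: "real (nat \<lfloor>t / h\<rfloor>) * h \<le> t" "t \<le> real (nat \<lfloor>t / h\<rfloor>) * h + h" if "0 < h" "0 \<le> t" for t h :: real
  proof -
    have "0 \<le> t / h" using that by simp
    then have "real (nat \<lfloor>t / h\<rfloor>) \<le> t / h" "t / h \<le> real (nat \<lfloor>t / h\<rfloor>) + 1" by (simp_all add: of_nat_floor)
    moreover have "real k * h \<le> t \<and> t \<le> real k * h + h" if "real k \<le> t / h" "t / h \<le> real k + 1" for k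
      using that \<open>0 < h\<close> by (simp add: pos_le_divide_eq pos_divide_le_eq algebra_simps)
    ultimately show "real (nat \<lfloor>t / h\<rfloor>) * h \<le> t" "t \<le> real (nat \<lfloor>t / h\<rfloor>) * h + h"
      by blast+
  qed
  have HQ: "\<bar>H j t (euler_step h t)\<bar> \<le> Q" if "0 < h" "0 \<le> t" "t \<le> T" "j \<in> {1..n}" for h t j
  proof -
    let ?k = "nat \<lfloor>t / h\<rfloor>"
    have kT: "real ?k * h \<le> T" using grid(1)[OF that(1,2)] that by linarith
    have "1 + (\<Sum>i=1..n. \<bar>euler h ?k i\<bar>) \<le> S0 * exp (real n * K * (real ?k * h))"
      unfolding S0_def by (rule euler_bound[OF that(1) K kT growth])
    also have "\<dots> \<le> S0 * exp (real n * K * T)"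
      using kT K \<open>0 \<le> S0\<close> by (intro mult_left_mono) (auto intro: mult_left_mono)
    finally have "1 + (\<Sum>i=1..n. \<bar>euler_step h t i\<bar>) \<le> S0 * exp (real n * K * T)"
      by (simp add: euler_step_def)
    then have "K * (1 + (\<Sum>i=1..n. \<bar>euler_step h t i\<bar>)) \<le> Q" unfolding Q_def using K
      by (rule mult_left_mono)
    then show ?thesis using growth[OF that(2-4), of "euler_step h t"] by linarith
  qed
  have lip: "\<bar>euler_path h t j - euler_path h s j\<bar> \<le> Q * (t - s)"
    if "0 < h" "0 \<le> s" "s \<le> t" "t \<le> T" "j \<in> {1..n}" for h s t j
  proof -
    have "\<bar>integral {0..t} (\<lambda>s. H j s (euler_step h s)) - integral {0..s} (\<lambda>s. H j s (euler_step h s))\<bar> \<le> Q * (t - s)"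
    proof (rule indefinite_integral_Lipschitz[OF H_euler_step[OF that(1,5)] that(2,3)])
      show "\<bar>H j u (euler_step h u)\<bar> \<le> Q" if "s \<le> u" "u \<le> t" for u
        using that \<open>0 \<le> s\<close> \<open>t \<le> T\<close>
          by (intro HQ[OF \<open>0 < h\<close> _ _ \<open>j \<in> {1..n}\<close>]) linarith+
    qed
    then show ?thesis by (simp add: euler_path_def)
  qed
  have close: "\<bar>euler_path h t j - euler_step h t j\<bar> \<le> Q * h" if "0 < h" "0 \<le> t" "t \<le> T" "j \<in> {1..n}" for h t j
  proof -
    let ?k = "nat \<lfloor>t / h\<rfloor>"
    have "\<bar>euler_path h t j - euler_path h (real ?k * h) j\<bar> \<le> Q * (t - real ?k * h)"
      by (rule lip[OF that(1) _ grid(1)[OF that(1,2)] that(3,4)]) (use that in simp)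
    also have "\<dots> \<le> Q * h" using grid(2)[OF that(1,2)] \<open>0 \<le> Q\<close>
      by (intro mult_left_mono) auto
    also have "euler_path h (real ?k * h) j = euler_step h t j"
      unfolding euler_path_grid[OF that(1,4)] euler_step_def ..
    finally show ?thesis .
  qed
  have "euler_estimate T Q" unfolding euler_estimate_def
    by (intro conjI allI impI; (elim conjE)?) (rule \<open>0 \<le> Q\<close> HQ close lip; assumption)+
  then show ?thesis by blast
qed

lemma H_n: "H n t x = g n t - c n * sgn (x 1 - y t)"
  by (simp add: H_def pw(4) signed_powr_zero_right)

text \<open>Arzela-Ascoli by hand: a diagonal subsequence converges at all nonnegative rational
  times, and the common Lipschitz constants extend this to the other times. Division by
  \<open>B\<close> gives all values the common bound 1 needed for the diagonal extraction, although
  the polygons have no bound uniform in time.\<close>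

lemma euler_convergent_subsequence:
  "\<exists>r :: nat \<Rightarrow> nat. strict_mono r \<and>
     (\<forall>t\<ge>0. \<forall>j\<in>{1..n}. convergent (\<lambda>m. euler_path (1 / real (Suc (r m))) t j))"
proof -
  have "\<exists>Q. \<forall>T\<ge>0. euler_estimate T (Q T)" using euler_estimates by metis
  then obtain Q where PQ: "\<And>T. 0 \<le> T \<Longrightarrow> euler_estimate T (Q T)" by blast
  note Q = euler_estimateD(1)[OF PQ] euler_estimateD(4)[OF PQ]
  define B where "B t j = 1 + \<bar>x0 j\<bar> + Q t * t" for t j
  define S where "S = {(j, q). j \<in> {1..n} \<and> q \<in> \<rat> \<and> (0::real) \<le> q}"
  have B: "0 < B t j" if "0 \<le> t" for t j
  proof -
    have "0 \<le> Q t * t" using Q(1)[OF that] that by simp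
    then show ?thesis by (simp add: B_def)
  qed
  define f where "f m = (\<lambda>(j, t). euler_path (1 / real (Suc m)) t j / B t j)" for m :: nat
  have "S \<subseteq> {1..n} \<times> \<rat>" by (auto simp: S_def)
  then have cs: "countable S"
    by (rule countable_subset) (simp add: countable_SIGMA countable_rat countable_finite)
  have nb: "norm (f m x) \<le> 1" if xS: "x \<in> S" for m x
  proof -
    obtain j t where x: "x = (j, t)" "j \<in> {1..n}" "0 \<le> t" using xS by (auto simp: S_def)
    have "\<bar>euler_path (1 / real (Suc m)) t j - euler_path (1 / real (Suc m)) 0 j\<bar> \<le> Q t * (t - 0)"
      using x by (intro Q(2)) auto
    then have "\<bar>euler_path (1 / real (Suc m)) t j\<bar> \<le> B t j" by (simp add: B_def euler_path_def)
    then show ?thesis using B[OF x(3), of j] by (simp add: f_def x)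
  qed
  obtain r :: "nat \<Rightarrow> nat" where r: "strict_mono r" "\<And>x. x \<in> S \<Longrightarrow> \<exists>l. (\<lambda>m. f (r m) x) \<longlonglongrightarrow> l"
    by (rule function_convergent_subsequence[OF cs nb]) (assumption, rule that)
  define p where "p m t j = euler_path (1 / real (Suc (r m))) t j" for m t j
  have rat: "convergent (\<lambda>m. p m q j)" if "j \<in> {1..n}" "q \<in> \<rat>" "0 \<le> q" for q j
  proof -
    have "(j, q) \<in> S" using that by (simp add: S_def)
    then obtain l where "(\<lambda>m. f (r m) (j, q)) \<longlonglongrightarrow> l" using r(2) by blast
    then have "(\<lambda>m. f (r m) (j, q) * B q j) \<longlonglongrightarrow> l * B q j"
      by (rule tendsto_mult_right)
    then show ?thesis using B[OF that(3), of j] by (auto simp: f_def p_def convergent_def)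
  qed
  have "convergent (\<lambda>m. p m t j)" if t: "0 \<le> t" and j: "j \<in> {1..n}" for t j
  proof (rule Cauchy_convergent, rule metric_CauchyI)
    fix \<epsilon> :: real assume "0 < \<epsilon>"
    \<comment> \<open>A Lipschitz constant on \<open>{0..t + 1}\<close>, which contains the rational
      \<open>q\<close> chosen to the right of \<open>t\<close>; the added 1 makes it
      positive.\<close>
    define K where "K = Q (t + 1) + 1"
    have "0 < K" using Q(1)[of "t + 1"] t by (simp add: K_def)
    then have "0 < min 1 (\<epsilon> / (3 * K))" using \<open>0 < \<epsilon>\<close> by simp
    then obtain q where q: "q \<in> \<rat>" "t < q" "q < t + min 1 (\<epsilon> / (3 * K))"
      using Rats_dense_in_real[of t "t + min 1 (\<epsilon> / (3 * K))"] by auto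
    have close: "\<bar>p m q j - p m t j\<bar> < \<epsilon> / 3" for m
    proof -
      have "\<bar>p m q j - p m t j\<bar> \<le> Q (t + 1) * (q - t)"
        unfolding p_def using t q j by (intro Q(2)) auto
      also have "\<dots> \<le> K * (q - t)" using q by (intro mult_right_mono) (auto simp: K_def)
      also have "\<dots> < K * (\<epsilon> / (3 * K))" using q \<open>0 < K\<close>
        by (intro mult_strict_left_mono) auto
      also have "\<dots> = \<epsilon> / 3" using \<open>0 < K\<close> by simp
      finally show ?thesis .
    qed
    have "Cauchy (\<lambda>m. p m q j)" using rat[OF j q(1)] q(2) t by (simp add: Cauchy_convergent_iff)
    then obtain M where M: "\<And>m m'. \<lbrakk>M \<le> m; M \<le> m'\<rbrakk> \<Longrightarrow> dist (p m q j) (p m' q j) < \<epsilon> / 3"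
      using \<open>0 < \<epsilon>\<close> unfolding Cauchy_def by (meson divide_pos_pos zero_less_numeral)
    have "dist (p m t j) (p m' t j) < \<epsilon>" if "M \<le> m" "M \<le> m'" for m m'
      using M[OF that] close[of m] close[of m'] unfolding dist_real_def by linarith
    then show "\<exists>M. \<forall>m\<ge>M. \<forall>m'\<ge>M. dist (p m t j) (p m' t j) < \<epsilon>"
      by blast
  qed
  then show ?thesis using r(1) unfolding p_def by blast
qed

text \<open>For \<open>j < n\<close> the exponent \<open>pw j\<close> is positive, the field is
  continuous in the state, and dominated convergence yields the integral equation of the limit. For
  \<open>j = n\<close> the field contains \<open>sgn\<close>, and the equation is read backwards:
  convergence of the last component forces convergence of the integrals of the signs, and
  \<open>weak_limit_exists\<close> supplies an integrand.\<close>

lemma block_solution_exists: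
  "\<exists>X. \<forall>j\<in>{1..n}. X 0 j = x0 j \<and> inclusion_solution
     (\<lambda>t. if j < n then {X t (Suc j) + g j t - c j * signed_powr (X t 1 - y t) (pw j)}
           else (\<lambda>\<sigma>. g n t - c n * \<sigma>) ` sign_set (X t 1 - y t)) (\<lambda>t. X t j)"
proof -
  obtain r :: "nat \<Rightarrow> nat" where "strict_mono r"
    and conv: "\<forall>t\<ge>0. \<forall>j\<in>{1..n}. convergent (\<lambda>m. euler_path (1 / real (Suc (r m))) t j)"
    using euler_convergent_subsequence by blast
  define h where "h m = 1 / real (Suc (r m))" for m
  have h: "0 < h m" for m by (simp add: h_def)
  have "(\<lambda>k. 1 / real (Suc k)) \<longlonglongrightarrow> 0" using LIMSEQ_inverse_real_of_nat
    by (simp add: inverse_eq_divide)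
  then have h_lim: "h \<longlonglongrightarrow> 0"
    using LIMSEQ_subseq_LIMSEQ[OF _ \<open>strict_mono r\<close>] by (auto simp: o_def h_def[abs_def])
  define \<xi> where "\<xi> m = euler_step (h m)" for m
  define x where "x t j = lim (\<lambda>m. \<xi> m t j)" for t j
  have path_lim: "(\<lambda>m. euler_path (h m) t j) \<longlonglongrightarrow> x t j"
    and \<xi>_lim: "(\<lambda>m. \<xi> m t j) \<longlonglongrightarrow> x t j"
    if t: "0 \<le> t" and j: "j \<in> {1..n}" for t j
  proof -
    obtain Q where Q: "euler_estimate t Q" using euler_estimates[OF t] by blast
    obtain l where l: "(\<lambda>m. euler_path (h m) t j) \<longlonglongrightarrow> l"
      using conv t j unfolding h_def convergent_def by blast
    have "(\<lambda>m. Q * h m) \<longlonglongrightarrow> Q * 0" by (intro tendsto_intros h_lim)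
    then have "(\<lambda>m. Q * h m) \<longlonglongrightarrow> 0" by simp
    then have "(\<lambda>m. euler_path (h m) t j - \<xi> m t j) \<longlonglongrightarrow> 0"
      by (rule Lim_null_comparison[rotated])
        (use euler_estimateD(3)[OF Q h t _ j] in \<open>simp add: \<xi>_def\<close>)
    from tendsto_diff[OF l this] have "(\<lambda>m. \<xi> m t j) \<longlonglongrightarrow> l" by simp
    then have "x t j = l" unfolding x_def by (rule limI)
    then show "(\<lambda>m. euler_path (h m) t j) \<longlonglongrightarrow> x t j" "(\<lambda>m. \<xi> m t j) \<longlonglongrightarrow> x t j"
      using l \<open>(\<lambda>m. \<xi> m t j) \<longlonglongrightarrow> l\<close> by simp_all
  qed
  have \<xi>_lbm: "locally_bounded_measurable (\<lambda>t. \<xi> m t i)" for m i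
    unfolding \<xi>_def by (rule euler_step_locally_bounded_measurable[OF h])
  have x_lbm: "locally_bounded_measurable (\<lambda>t. x t j)" if j: "j \<in> {1..n}" for j
  proof (rule locally_bounded_measurableI)
    show "(\<lambda>t. x t j) \<in> borel_measurable (lebesgue_on {0..})"
      unfolding x_def by (intro borel_measurable_lim_metric locally_bounded_measurable_measurable \<xi>_lbm)
    fix T :: real assume T: "0 \<le> T"
    obtain Q where Q: "euler_estimate T Q" using euler_estimates[OF T] by blast
    have "\<bar>x t j\<bar> \<le> \<bar>x0 j\<bar> + Q * T" if t: "0 \<le> t" "t \<le> T" for t
    proof (rule LIMSEQ_le_const2[OF tendsto_rabs[OF path_lim[OF t(1) j]]])
      have "\<bar>euler_path (h m) t j\<bar> \<le> \<bar>x0 j\<bar> + Q * T" for m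
      proof -
        have "\<bar>euler_path (h m) t j - euler_path (h m) 0 j\<bar> \<le> Q * (t - 0)"
          by (rule euler_estimateD(4)[OF Q h _ t j]) simp
        also have "Q * (t - 0) \<le> Q * T" using t euler_estimateD(1)[OF Q] by (intro mult_left_mono) auto
        finally show ?thesis by (simp add: euler_path_def)
      qed
      then show "\<exists>N. \<forall>m\<ge>N. \<bar>euler_path (h m) t j\<bar> \<le> \<bar>x0 j\<bar> + Q * T" by blast
    qed
    then show "\<exists>M. \<forall>t. 0 \<le> t \<and> t \<le> T \<longrightarrow> \<bar>x t j\<bar> \<le> M" by blast
  qed
  have H_\<xi>_lbm: "locally_bounded_measurable (\<lambda>s. H j s (\<xi> m s))" if "j \<in> {1..n}" for j m
    unfolding \<xi>_def by (rule H_euler_step[OF h that])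
  have int_lim: "(\<lambda>m. integral {0..t} (\<lambda>s. H j s (\<xi> m s))) \<longlonglongrightarrow> x t j - x0 j"
    if "0 \<le> t" "j \<in> {1..n}" for t j
    using tendsto_diff[OF path_lim[OF that] tendsto_const[of "x0 j"]] by (simp add: euler_path_def \<xi>_def)
  have inner: "x t j = x0 j + integral {0..t} (\<lambda>s. H j s (x s))" if t: "0 \<le> t"
    and j: "j \<in> {1..<n}" for t j
  proof -
    have j': "j \<in> {1..n}" "Suc j \<in> {1..n}" using j by auto
    obtain Q where Q: "euler_estimate t Q" using euler_estimates[OF t] by blast
    have "(\<lambda>m. integral {0..t} (\<lambda>s. H j s (\<xi> m s))) \<longlonglongrightarrow> integral {0..t} (\<lambda>s. H j s (x s))"
    proof (rule dominated_convergence(2))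
      show "(\<lambda>s. H j s (\<xi> m s)) integrable_on {0..t}" for m
        by (rule locally_bounded_measurable_integrable_on[OF H_\<xi>_lbm[OF j'(1)]]) simp
      show "(\<lambda>_. Q) integrable_on {0..t}" by (rule integrable_const_ivl)
      show "norm (H j s (\<xi> m s)) \<le> Q" if "s \<in> {0..t}" for m s
        using euler_estimateD(2)[OF Q h _ _ j'(1)] that by (simp add: \<xi>_def)
      show "(\<lambda>m. H j s (\<xi> m s)) \<longlonglongrightarrow> H j s (x s)" if "s \<in> {0..t}" for s
      proof -
        have s: "0 \<le> s" using that by simp
        have "1 \<in> {1..n}" using n by simp
        have "continuous_on UNIV (\<lambda>a. signed_powr a (pw j))"
          by (intro continuous_on_signed_powr continuous_on_id pw(3)[OF j])
        then have "isCont (\<lambda>a. signed_powr a (pw j)) (x s 1 - y s)"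
          by (simp add: continuous_on_eq_continuous_at)
        then have "(\<lambda>m. signed_powr (\<xi> m s 1 - y s) (pw j)) \<longlonglongrightarrow> signed_powr (x s 1 - y s) (pw j)"
          by (rule isCont_tendsto_compose) (intro tendsto_diff \<xi>_lim[OF s \<open>1 \<in> {1..n}\<close>] tendsto_const)
        then show ?thesis
          using j \<xi>_lim[OF s j'(2)] unfolding H_def by (auto intro!: tendsto_intros)
      qed
    qed
    then have "integral {0..t} (\<lambda>s. H j s (x s)) = x t j - x0 j"
      using int_lim[OF t j'(1)] by (rule LIMSEQ_unique)
    then show ?thesis by simp
  qed
  have n': "n \<in> {1..n}" "1 \<in> {1..n}" using n by simp_all
  define s where "s m t = sgn (\<xi> m t 1 - y t)" for m t
  define S where "S t = (integral {0..t} (g n) - (x t n - x0 n)) / c n" for t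
  have s_meas: "s m \<in> borel_measurable (lebesgue_on {0..})" for m
  proof -
    have "(\<lambda>t. \<xi> m t 1 - y t) \<in> borel_measurable (lebesgue_on {0..})"
      by (intro locally_bounded_measurable_measurable locally_bounded_measurable_diff \<xi>_lbm y)
    moreover have "(sgn :: real \<Rightarrow> real) \<in> borel_measurable borel"
      unfolding sgn_if[abs_def] by measurable
    ultimately show ?thesis unfolding s_def by (rule measurable_compose)
  qed
  have s_bd: "\<bar>s m t\<bar> \<le> 1" for m t by (simp add: s_def sgn_if)
  have s_lim: "(\<lambda>m. integral {0..t} (s m)) \<longlonglongrightarrow> S t" if t: "0 \<le> t" for t
  proof -
    have "integral {0..t} (s m) = (integral {0..t} (g n) - integral {0..t} (\<lambda>s. H n s (\<xi> m s))) / c n" for m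
    proof -
      have s_eq: "s m = (\<lambda>u. (g n u - H n u (\<xi> m u)) / c n)"
        using c by (auto simp: s_def H_n)
      show ?thesis unfolding s_eq
        using locally_bounded_measurable_integrable_on[OF g[OF n'(1)], of 0 t]
          locally_bounded_measurable_integrable_on[OF H_\<xi>_lbm[OF n'(1)], of 0 m t]
        by (simp add: Henstock_Kurzweil_Integration.integral_diff)
    qed
    then show ?thesis unfolding S_def
      using c by (simp only:) (intro tendsto_intros int_lim t n'(1); simp)
  qed
  obtain \<sigma> where \<sigma>_meas: "\<sigma> \<in> borel_measurable (lebesgue_on {0..})"
    and \<sigma>_bd: "\<forall>t. \<bar>\<sigma> t\<bar> \<le> 1"
    and \<sigma>_int: "\<forall>t\<ge>0. integral {0..t} \<sigma> = S t"
    and \<sigma>_eq: "AE t in lebesgue_on {0..}. \<forall>c. (\<forall>\<^sub>F m in sequentially. s m t = c) \<longrightarrow> \<sigma> t = c"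
    using weak_limit_exists[OF s_meas s_bd s_lim] by blast
  have \<sigma>_lbm: "locally_bounded_measurable \<sigma>"
    by (rule locally_bounded_measurableI[OF \<sigma>_meas]) (use \<sigma>_bd in blast)
  define f where "f j t = (if j < n then H j t (x t) else g n t - c n * \<sigma> t)" for j t
  have f_lbm: "locally_bounded_measurable (f j)" if "j \<in> {1..n}" for j
  proof (cases "j < n")
    case True
    then have "f j = (\<lambda>t. H j t (x t))" by (simp add: f_def[abs_def])
    then show ?thesis using H_locally_bounded_measurable[OF x_lbm that] by simp
  next
    case False
    then have "f j = (\<lambda>t. g n t - c n * \<sigma> t)" by (simp add: f_def[abs_def])
    then show ?thesis
      using locally_bounded_measurable_diff[OF g[OF n'(1)] locally_bounded_measurable_cmult[OF \<sigma>_lbm]] by simp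
  qed
  \<comment> \<open>\<open>x\<close> is a pointwise limit, \<open>X\<close> a family of primitives
    to which the differentiation theorem applies. They agree at nonnegative times.\<close>
  define X where "X t j = x0 j + integral {0..t} (f j)" for t j
  have X: "X t j = x t j" if t: "0 \<le> t" and j: "j \<in> {1..n}" for t j
  proof (cases "j < n")
    case True
    then show ?thesis using inner[OF t, of j] j by (simp add: X_def f_def[abs_def])
  next
    case False
    then have [simp]: "j = n" using j by simp
    have "integral {0..t} (\<lambda>u. g n u - c n * \<sigma> u) = integral {0..t} (g n) - integral {0..t} (\<lambda>u. c n * \<sigma> u)"
      by (rule Henstock_Kurzweil_Integration.integral_diff[OF
            locally_bounded_measurable_integrable_on[OF g[OF n'(1)]]
            integrable_on_mult_right[OF locally_bounded_measurable_integrable_on[OF \<sigma>_lbm]]]) simp_all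
    then have "integral {0..t} (f n) = integral {0..t} (g n) - c n * S t"
      using \<sigma>_int[rule_format, OF t] by (simp add: f_def[abs_def])
    then show ?thesis using c by (simp add: X_def S_def)
  qed
  have sgn_ev: "\<forall>\<^sub>F m in sequentially. s m t = sgn (X t 1 - y t)" if t: "0 \<le> t"
    and ne: "X t 1 \<noteq> y t" for t
  proof -
    have lim: "(\<lambda>m. \<xi> m t 1 - y t) \<longlonglongrightarrow> X t 1 - y t"
      unfolding X[OF t n'(2)] by (intro tendsto_diff \<xi>_lim[OF t n'(2)] tendsto_const)
    show ?thesis
    proof (cases "0 < X t 1 - y t")
      case True
      show ?thesis using order_tendstoD(1)[OF lim True]
        by eventually_elim (use True in \<open>simp add: s_def\<close>)
    next
      case False
      then have neg: "X t 1 - y t < 0" using ne by simp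
      show ?thesis using order_tendstoD(2)[OF lim neg]
        by eventually_elim (use neg in \<open>simp add: s_def\<close>)
    qed
  qed
  have "AE t in lebesgue_on {0..}. 0 \<le> t" by (rule AE_I2) simp
  then have \<sigma>_in: "AE t in lebesgue_on {0..}. 0 \<le> t \<and> \<sigma> t \<in> sign_set (X t 1 - y t)"
    using \<sigma>_eq
  proof eventually_elim
    case (elim t)
    show ?case
    proof (cases "X t 1 = y t")
      case True
      have "\<bar>\<sigma> t\<bar> \<le> 1" using \<sigma>_bd by blast
      then have "- 1 \<le> \<sigma> t \<and> \<sigma> t \<le> 1" by linarith
      then show ?thesis using True elim(1) by (simp add: sign_set_def)
    next
      case False
      then have "\<sigma> t = sgn (X t 1 - y t)" using elim(2) sgn_ev[OF elim(1) False] by blast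
      then show ?thesis using elim(1) sgn_in_sign_set by simp
    qed
  qed
  show ?thesis
  proof (intro exI[of _ X] ballI conjI)
    fix j assume j: "j \<in> {1..n}"
    show "X 0 j = x0 j" by (simp add: X_def)
    show "inclusion_solution
     (\<lambda>t. if j < n then {X t (Suc j) + g j t - c j * signed_powr (X t 1 - y t) (pw j)}
           else (\<lambda>\<sigma>. g n t - c n * \<sigma>) ` sign_set (X t 1 - y t)) (\<lambda>t. X t j)"
      unfolding X_def[of _ j]
    proof (rule indefinite_integral_inclusion_solution[OF f_lbm[OF j]])
      show "AE t in lebesgue_on {0..}. f j t \<in>
        (if j < n then {X t (Suc j) + g j t - c j * signed_powr (X t 1 - y t) (pw j)}
           else (\<lambda>\<sigma>. g n t - c n * \<sigma>) ` sign_set (X t 1 - y t))"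
        using \<sigma>_in
      proof eventually_elim
        case (elim t)
        show ?case
        proof (cases "j < n")
          case True
          then have "Suc j \<in> {1..n}" by simp
          then show ?thesis using True elim X[of t "Suc j"] X[OF _ n'(2), of t] by (simp add: f_def H_def)
        next
          case False
          then show ?thesis using elim by (auto simp: f_def intro!: imageI)
        qed
      qed
    qed
  qed
qed

end

section \<open>The observer\<close>

lemma abs_le_L2_set:
  assumes "finite A" "i \<in> A"
  shows "\<bar>x i\<bar> \<le> L2_set x A"
proof -
  have "(x i)\<^sup>2 \<le> (\<Sum>i\<in>A. (x i)\<^sup>2)" using assms by (intro member_le_sum) auto
  then have "sqrt ((x i)\<^sup>2) \<le> L2_set x A" unfolding L2_set_def by (rule real_sqrt_le_mono)
  then show ?thesis by simp
qed

lemma inclusion_solution_continuous_on: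
  assumes "inclusion_solution F f"
  shows "continuous_on {0..} f"
  unfolding continuous_on_eq_continuous_within
proof
  fix x :: real assume x: "x \<in> {0..}"
  have "abs_continuous_on_interval f 0 (x + 1)" using assms x by (simp add: inclusion_solution_def)
  then have "continuous_on {0..x + 1} f" by (rule abs_continuous_imp_continuous_on)
  then have "continuous (at x within {0..x + 1}) f" using x by (simp add: continuous_on_eq_continuous_within)
  moreover have "at x within {0..} = at x within {0..x + 1}"
    by (rule at_within_nhd[of x "{..<x + 1}"]) auto
  ultimately show "continuous (at x within {0..}) f" by simp
qed

lemma locally_bounded_measurable_nonlinearity:
  fixes F :: "real^'p \<Rightarrow> (nat \<Rightarrow> real) \<Rightarrow> real"
    and u :: "real \<Rightarrow> real^'p"
  assumes F: "continuous_on (UNIV \<times> ({1..j} \<rightarrow>\<^sub>E UNIV)) (\<lambda>(u, x). F u x)"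
    and u: "locally_bounded_measurable u"
    and x: "\<And>l. l \<in> {1..j} \<Longrightarrow> locally_bounded_measurable (\<lambda>t. x t l)"
  shows "locally_bounded_measurable (\<lambda>t. F (u t) (restrict (x t) {1..j}))"
proof (rule locally_bounded_measurableI)
  let ?A = "(UNIV :: (real^'p) set) \<times> ({1..j} \<rightarrow>\<^sub>E (UNIV :: real set))"
  have "(\<lambda>t. restrict (x t) {1..j}) \<in> borel_measurable (lebesgue_on {0..})"
  proof (rule measurable_coordinatewise_then_product)
    fix l
    show "(\<lambda>t. restrict (x t) {1..j} l) \<in> borel_measurable (lebesgue_on {0..})"
      using locally_bounded_measurable_measurable[OF x, of l]
        by (cases "l \<in> {1..j}") (simp_all add: restrict_def del: atLeastAtMost_iff)
  qed
  moreover have "u \<in> borel_measurable (lebesgue_on {0..})" using u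
    by (simp add: locally_bounded_measurable_def)
  ultimately have "(\<lambda>t. (u t, restrict (x t) {1..j})) \<in> borel_measurable (lebesgue_on {0..})"
    by (intro borel_measurable_Pair)
  \<comment> \<open>Continuity of \<open>F\<close> is given on \<open>?A\<close> only, so the
    composition passes through the restricted Borel space.\<close>
  then have "(\<lambda>t. (u t, restrict (x t) {1..j})) \<in> measurable (lebesgue_on {0..}) (restrict_space borel ?A)"
    by (intro measurable_restrict_space2) auto
  moreover have "(\<lambda>(u, x). F u x) \<in> borel_measurable (restrict_space borel ?A)"
    by (rule borel_measurable_continuous_on_restrict[OF F])
  ultimately have "(\<lambda>t. (\<lambda>(u, x). F u x) (u t, restrict (x t) {1..j})) \<in> borel_measurable (lebesgue_on {0..})"
    by (rule measurable_compose)
  then show "(\<lambda>t. F (u t) (restrict (x t) {1..j})) \<in> borel_measurable (lebesgue_on {0..})" by simp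
  fix T :: real assume T: "0 \<le> T"
  have "bounded (u ` {0..T})" using u T by (simp add: locally_bounded_measurable_def)
  then obtain q where q: "\<forall>y\<in>u ` {0..T}. norm y \<le> q" unfolding bounded_iff by blast
  have "\<exists>M. 0 \<le> M \<and> (\<forall>t. 0 \<le> t \<and> t \<le> T \<longrightarrow> \<bar>x t l\<bar> \<le> M)" if "l \<in> {1..j}" for l
    using locally_bounded_measurableD[OF x[OF that] T] by metis
  then obtain M where M: "\<And>l. l \<in> {1..j} \<Longrightarrow> 0 \<le> M l"
    "\<And>l t. \<lbrakk>l \<in> {1..j}; 0 \<le> t; t \<le> T\<rbrakk> \<Longrightarrow> \<bar>x t l\<bar> \<le> M l" by metis
  define c where "c = (\<Sum>l=1..j. M l)"
  obtain B where B: "\<forall>u z. norm u \<le> q \<and> (\<forall>l\<in>{1..j}. \<bar>z l\<bar> \<le> c) \<longrightarrow> \<bar>F u (restrict z {1..j})\<bar> \<le> B"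
    using bounded_on_box[OF F, of q c] by blast
  have "\<bar>F (u t) (restrict (x t) {1..j})\<bar> \<le> B" if t: "0 \<le> t \<and> t \<le> T" for t
  proof -
    have "norm (u t) \<le> q" using q t by simp
    moreover have "\<bar>x t l\<bar> \<le> c" if l: "l \<in> {1..j}" for l
    proof -
      have "M l \<le> c" unfolding c_def using M(1) l by (intro member_le_sum) auto
      then show ?thesis using M(2)[OF l, of t] t by linarith
    qed
    ultimately show ?thesis using B by blast
  qed
  then show "\<exists>M. \<forall>t. 0 \<le> t \<and> t \<le> T \<longrightarrow> \<bar>F (u t) (restrict (x t) {1..j})\<bar> \<le> M" by blast
qed

text \<open>The blocks are solved one after another: the newest block evaluates nonlinearities only
  at the states of earlier blocks, which are by then known functions of time.\<close>

lemma observer_solution_exists: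
  fixes \<Phi> :: "nat \<Rightarrow> real^'p \<Rightarrow> (nat \<Rightarrow> real) \<Rightarrow> real"
    and u :: "real \<Rightarrow> real^'p"
  assumes \<Phi>: "\<forall>i\<in>{1..m}. continuous_on (UNIV \<times> ({1..i} \<rightarrow>\<^sub>E UNIV)) (\<lambda>(u, x). \<Phi> i u x)"
    and u: "locally_bounded_measurable u" and y: "locally_bounded_measurable y"
    and wh: "\<And>j. j \<in> {1..m} \<Longrightarrow> locally_bounded_measurable (\<lambda>t. wh t j)"
    and k: "\<And>i. i \<in> {1..m} \<Longrightarrow> 0 < L i ^ i * k i i"
  shows "\<exists>Zh. observer_solution m \<Phi> k L u wh y zh Zh"
  using \<Phi> wh k
proof (induction m)
  case 0
  show ?case by (simp add: observer_solution_def)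
next
  case (Suc m)
  let ?n = "Suc m"
  have "\<exists>Zh. observer_solution m \<Phi> k L u wh y zh Zh"
    by (rule Suc.IH) (use Suc.prems in simp_all)
  then obtain Zh where Zh: "observer_solution m \<Phi> k L u wh y zh Zh" by blast
  define g where "g j t = (if j < ?n then \<Phi> j (u t) (restrict (Zh t j) {1..j}) else 0) + wh t j" for j t
  have g: "locally_bounded_measurable (g j)" if j: "j \<in> {1..?n}" for j
  proof -
    have "locally_bounded_measurable (\<lambda>t. if j < ?n then \<Phi> j (u t) (restrict (Zh t j) {1..j}) else 0)"
    proof (cases "j < ?n")
      case True
      have "locally_bounded_measurable (\<lambda>t. Zh t j l)" if "l \<in> {1..j}" for l
      proof -
        have "inclusion_solution (\<lambda>t. observer_rhs \<Phi> k L (u t) (wh t) (y t) (Zh t) j l) (\<lambda>t. Zh t j l)"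
          using Zh True j that unfolding observer_solution_def by simp
        then show ?thesis
          by (intro continuous_on_locally_bounded_measurable inclusion_solution_continuous_on)
      qed
      then have "locally_bounded_measurable (\<lambda>t. \<Phi> j (u t) (restrict (Zh t j) {1..j}))"
        using Suc.prems(1) j u by (intro locally_bounded_measurable_nonlinearity) simp_all
      then show ?thesis using True by simp
    qed (simp add: locally_bounded_measurable_const)
    then show ?thesis unfolding g_def[abs_def]
      by (intro locally_bounded_measurable_add Suc.prems(2) j)
  qed
  define c where "c j = L ?n ^ j * k ?n j" for j
  interpret observer_block ?n g y c "zh ?n"
  proof
    show "0 < c ?n" unfolding c_def using Suc.prems(3)[of ?n] by simp
  qed (use g y in simp_all)
  obtain X where X: "\<forall>j\<in>{1..?n}. X 0 j = zh ?n j \<and> inclusion_solution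
     (\<lambda>t. if j < ?n then {X t (Suc j) + g j t - c j * signed_powr (X t 1 - y t) (pw j)}
           else (\<lambda>\<sigma>. g ?n t - c ?n * \<sigma>) ` sign_set (X t 1 - y t)) (\<lambda>t. X t j)"
    using block_solution_exists by blast
  define Zh' where "Zh' t i = (if i = ?n then X t else Zh t i)" for t i
  have "observer_solution ?n \<Phi> k L u wh y zh Zh'"
    unfolding observer_solution_def
  proof (intro ballI conjI)
    fix i j assume i: "i \<in> {1..?n}" and j: "j \<in> {1..i}"
    show "Zh' 0 i j = zh i j"
      using X Zh i j by (cases "i = ?n") (simp_all add: Zh'_def observer_solution_def)
    show "inclusion_solution (\<lambda>t. observer_rhs \<Phi> k L (u t) (wh t) (y t) (Zh' t) i j) (\<lambda>t. Zh' t i j)"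
    proof (cases "i = ?n")
      case True
      have "observer_rhs \<Phi> k L (u t) (wh t) (y t) (Zh' t) i j =
         (if j < ?n then {X t (Suc j) + g j t - c j * signed_powr (X t 1 - y t) (pw j)}
           else (\<lambda>\<sigma>. g ?n t - c ?n * \<sigma>) ` sign_set (X t 1 - y t))" for t
        using True j by (simp add: observer_rhs_def Zh'_def g_def c_def pw_def add.assoc del: of_nat_Suc)
      then show ?thesis using X True j by (simp add: Zh'_def)
    next
      case False
      then have i': "i \<in> {1..m}" using i by simp
      have "observer_rhs \<Phi> k L (u t) (wh t) (y t) (Zh' t) i j = observer_rhs \<Phi> k L (u t) (wh t) (y t) (Zh t) i j" for t
        using i' j by (simp add: observer_rhs_def Zh'_def)
      then show ?thesis using Zh i' j False by (simp add: observer_solution_def Zh'_def)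
    qed
  qed
  then show ?case by blast
qed

section \<open>Bounds on the nonlinearities and the error equations of the observer\<close>

lemma nonlinearity_bounds:
  fixes \<Phi> :: "nat \<Rightarrow> real^'p \<Rightarrow> (nat \<Rightarrow> real) \<Rightarrow> real"
  assumes \<Phi>: "\<forall>i\<in>{1..m}. continuous_on (UNIV \<times> ({1..i} \<rightarrow>\<^sub>E UNIV)) (\<lambda>(u, x). \<Phi> i u x)"
    and m: "1 \<le> m" and c: "0 \<le> c" and q: "0 \<le> q"
  obtains \<omega> B where "class_K \<omega>" "\<And>j. j \<in> {1..m} \<Longrightarrow> 0 \<le> B j"
    "\<And>j u z. \<lbrakk>j \<in> {1..m}; norm u \<le> q; \<And>l. l \<in> {1..j} \<Longrightarrow> \<bar>z l\<bar> \<le> c\<rbrakk> \<Longrightarrow> \<bar>\<Phi> j u (restrict z {1..j})\<bar> \<le> B j"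
    "\<And>j u z zh \<rho>. \<lbrakk>j \<in> {1..m}; norm u \<le> q; \<And>l. l \<in> {1..j} \<Longrightarrow> \<bar>z l\<bar> \<le> c; 0 \<le> \<rho>;
      \<And>l. l \<in> {1..j} \<Longrightarrow> \<bar>zh l - z l\<bar> \<le> \<rho>\<rbrakk> \<Longrightarrow>
      \<bar>\<Phi> j u (restrict zh {1..j}) - \<Phi> j u (restrict z {1..j})\<bar> \<le> \<omega> \<rho>"
proof -
  have "\<exists>B. 0 \<le> B \<and> (\<forall>u z. norm u \<le> q \<and> (\<forall>l\<in>{1..j}. \<bar>z l\<bar> \<le> c) \<longrightarrow> \<bar>\<Phi> j u (restrict z {1..j})\<bar> \<le> B)"
    if "j \<in> {1..m}" for j
    using bounded_on_box[OF bspec[OF \<Phi> that], of q c] by blast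
  then obtain B where B: "\<forall>j\<in>{1..m}. 0 \<le> B j \<and>
      (\<forall>u z. norm u \<le> q \<and> (\<forall>l\<in>{1..j}. \<bar>z l\<bar> \<le> c) \<longrightarrow> \<bar>\<Phi> j u (restrict z {1..j})\<bar> \<le> B j)"
    by metis
  have "\<exists>\<omega>. class_K \<omega> \<and> (\<forall>u z zh \<rho>. norm u \<le> q \<and> (\<forall>l\<in>{1..j}. \<bar>z l\<bar> \<le> c) \<and> 0 \<le> \<rho> \<and>
      (\<forall>l\<in>{1..j}. \<bar>zh l - z l\<bar> \<le> \<rho>) \<longrightarrow>
      \<bar>\<Phi> j u (restrict zh {1..j}) - \<Phi> j u (restrict z {1..j})\<bar> \<le> \<omega> \<rho>)" if "j \<in> {1..m}" for j
    by (rule perturbation_modulus[OF bspec[OF \<Phi> that] c q])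
  then obtain w where w: "\<forall>j\<in>{1..m}. class_K (w j) \<and> (\<forall>u z zh \<rho>. norm u \<le> q \<and> (\<forall>l\<in>{1..j}. \<bar>z l\<bar> \<le> c) \<and> 0 \<le> \<rho> \<and>
      (\<forall>l\<in>{1..j}. \<bar>zh l - z l\<bar> \<le> \<rho>) \<longrightarrow>
      \<bar>\<Phi> j u (restrict zh {1..j}) - \<Phi> j u (restrict z {1..j})\<bar> \<le> w j \<rho>)"
    by metis
  define \<omega> where "\<omega> \<rho> = (\<Sum>j=1..m. w j \<rho>)" for \<rho>
  show ?thesis
  proof (rule that[of \<omega> B])
    show "class_K \<omega>" unfolding \<omega>_def[abs_def] using w m by (intro class_K_sum) auto
    show "0 \<le> B j" if "j \<in> {1..m}" for j using B that by blast
    show "\<bar>\<Phi> j u (restrict z {1..j})\<bar> \<le> B j"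
      if "j \<in> {1..m}" "norm u \<le> q" "\<And>l. l \<in> {1..j} \<Longrightarrow> \<bar>z l\<bar> \<le> c" for j u z
      using bspec[OF B that(1)] that(2,3) by blast
    show "\<bar>\<Phi> j u (restrict zh {1..j}) - \<Phi> j u (restrict z {1..j})\<bar> \<le> \<omega> \<rho>"
      if "j \<in> {1..m}" "norm u \<le> q" "\<And>l. l \<in> {1..j} \<Longrightarrow> \<bar>z l\<bar> \<le> c" "0 \<le> \<rho>"
        "\<And>l. l \<in> {1..j} \<Longrightarrow> \<bar>zh l - z l\<bar> \<le> \<rho>" for j u z zh \<rho>
    proof -
      have "\<bar>\<Phi> j u (restrict zh {1..j}) - \<Phi> j u (restrict z {1..j})\<bar> \<le> w j \<rho>"
        using bspec[OF w that(1)] that(2-5) by blast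
      also have "\<dots> \<le> \<omega> \<rho>" unfolding \<omega>_def
      proof (rule member_le_sum[OF that(1)])
        show "0 \<le> w i \<rho>" if "i \<in> {1..m} - {j}" for i
          using bspec[OF w, of i] that class_K_nonneg[OF _ \<open>0 \<le> \<rho>\<close>] by blast
      qed simp
      finally show ?thesis .
    qed
  qed
qed

text \<open>In its last component block \<open>n\<close> omits the next state and
  \<open>\<Phi> n\<close>; together with \<open>\<Delta>w n\<close> they form the bounded
  disturbance \<open>D n\<close>. In the components \<open>j < n\<close> the nonlinearities differ
  by at most \<open>\<omega>\<close> of the error of block \<open>j\<close>. Stopping the cascade at
  \<open>i\<close> is what restricts \<open>\<delta>\<close> to the \<open>\<Delta>w j\<close> with
  \<open>j < i\<close>.\<close>

lemma observer_error_cascade: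
  fixes \<Phi> :: "nat \<Rightarrow> real^'p \<Rightarrow> (nat \<Rightarrow> real) \<Rightarrow> real"
    and u :: "real \<Rightarrow> real^'p"
  assumes Z: "system_solution m \<Phi> u w z Z"
    and Zh: "observer_solution m \<Phi> k (\<lambda>_. 1) u wh (\<lambda>t. Z t 1 + v t) zh Zh"
    and B: "\<And>j u z. \<lbrakk>j \<in> {1..m}; norm u \<le> q; \<And>l. l \<in> {1..j} \<Longrightarrow> \<bar>z l\<bar> \<le> c\<rbrakk> \<Longrightarrow> \<bar>\<Phi> j u (restrict z {1..j})\<bar> \<le> B j"
    and \<omega>: "\<And>j u z zh \<rho>. \<lbrakk>j \<in> {1..m}; norm u \<le> q; \<And>l. l \<in> {1..j} \<Longrightarrow> \<bar>z l\<bar> \<le> c; 0 \<le> \<rho>;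
      \<And>l. l \<in> {1..j} \<Longrightarrow> \<bar>zh l - z l\<bar> \<le> \<rho>\<rbrakk> \<Longrightarrow>
      \<bar>\<Phi> j u (restrict zh {1..j}) - \<Phi> j u (restrict z {1..j})\<bar> \<le> \<omega> \<rho>"
    and i: "i \<in> {1..m}" and t: "0 \<le> t" and c: "0 \<le> c"
    and bZ: "\<And>s j. \<lbrakk>0 \<le> s; s \<le> t; j \<in> {1..m}\<rbrakk> \<Longrightarrow> \<bar>Z s j\<bar> \<le> c"
    and bu: "\<And>s. \<lbrakk>0 \<le> s; s \<le> t\<rbrakk> \<Longrightarrow> norm (u s) \<le> q"
    and bw: "\<And>s j. \<lbrakk>0 \<le> s; s \<le> t; j \<in> {1..m}\<rbrakk> \<Longrightarrow> \<bar>wh s j - w s j\<bar> \<le> wbar"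
    and dv: "\<And>s. \<lbrakk>0 \<le> s; s \<le> t\<rbrakk> \<Longrightarrow> \<bar>v s\<bar> \<le> \<delta>"
    and dw: "\<And>s j. \<lbrakk>0 \<le> s; s \<le> t; j \<in> {1..i - 1}\<rbrakk> \<Longrightarrow> \<bar>wh s j - w s j\<bar> \<le> \<delta>"
  shows "cascade_errors i k (\<lambda>i. wbar + c + B i) \<omega> \<delta> t (\<lambda>i s j. Zh s i j - Z s j)"
  unfolding cascade_errors_def
proof
  fix n assume n: "n \<in> {1..i}"
  then have n': "n \<in> {1..m}" using i by simp
  define a where "a s = Zh s n 1 - (Z s 1 + v s)" for s
  define d where "d s j = \<Phi> j (u s) (restrict (Zh s j) {1..j}) - \<Phi> j (u s) (restrict (Z s) {1..j})
      + (wh s j - w s j)" for s j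
  have sol: "chain_solution n (k n) (wbar + c + B n) 0 t a d (\<lambda>s j. Zh s n j - Z s j)"
    unfolding chain_solution_def
  proof
    fix j assume j: "j \<in> {1..n}"
    then have j': "j \<in> {1..m}" using n' by simp
    define F where "F s = {D - E | D E. D \<in> observer_rhs \<Phi> k (\<lambda>_. 1) (u s) (wh s) (Z s 1 + v s) (Zh s) n j \<and>
        E \<in> {system_rhs m \<Phi> (u s) (w s) (Z s) j}}" for s
    have "inclusion_solution F (\<lambda>s. Zh s n j - Z s j)"
    proof (rule inclusion_solution_diff)
      show "inclusion_solution (\<lambda>s. observer_rhs \<Phi> k (\<lambda>_. 1) (u s) (wh s) (Z s 1 + v s) (Zh s) n j) (\<lambda>s. Zh s n j)"
        using Zh n' j unfolding observer_solution_def by blast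
      show "inclusion_solution (\<lambda>s. {system_rhs m \<Phi> (u s) (w s) (Z s) j}) (\<lambda>s. Z s j)"
        using Z j' unfolding system_solution_def by blast
    qed (auto simp: F_def)
    then have "mv_solution 0 t F (\<lambda>s. Zh s n j - Z s j)"
      using t by (rule inclusion_solution_imp_mv_solution)
    then show "mv_solution 0 t (\<lambda>s. chain_rhs n (k n) (wbar + c + B n) (a s) (d s) (\<lambda>j. Zh s n j - Z s j) j)
        (\<lambda>s. Zh s n j - Z s j)"
    proof (rule mv_solution_subset)
      fix s assume s: "0 < s" "s < t"
      then have s': "0 \<le> s" "s \<le> t" by simp_all
      show "F s \<subseteq> chain_rhs n (k n) (wbar + c + B n) (a s) (d s) (\<lambda>j. Zh s n j - Z s j) j"
      proof (cases "j < n")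
        case True
        then have "j < m" using n' by simp
        then show ?thesis
          using True by (auto simp: F_def observer_rhs_def system_rhs_def chain_rhs_def a_def d_def)
      next
        case False
        then have jn: "j = n" using j by simp
        have "\<bar>if n < m then Z s (n + 1) else 0\<bar> \<le> c" using bZ[OF s', of "n + 1"] c by auto
        moreover have "\<bar>\<Phi> n (u s) (restrict (Z s) {1..n})\<bar> \<le> B n"
          by (rule B[OF n' bu[OF s']]) (rule bZ[OF s'], use n' in simp)
        moreover have "\<bar>wh s n - w s n\<bar> \<le> wbar" by (rule bw[OF s' n'])
        ultimately have le: "\<bar>wh s n - w s n - (if n < m then Z s (n + 1) else 0)
            - \<Phi> n (u s) (restrict (Z s) {1..n})\<bar> \<le> wbar + c + B n" by linarith
        show ?thesis
        proof
          fix x assume "x \<in> F s"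
          then obtain \<sigma> where \<sigma>: "\<sigma> \<in> sign_set (a s)"
            and x: "x = wh s n - k n n * \<sigma> - system_rhs m \<Phi> (u s) (w s) (Z s) n"
            using jn by (auto simp: F_def observer_rhs_def a_def)
          have "x = (wh s n - w s n - (if n < m then Z s (n + 1) else 0)
            - \<Phi> n (u s) (restrict (Z s) {1..n})) - k n n * \<sigma>"
            unfolding x system_rhs_def by linarith
          then have "\<exists>\<delta> \<sigma>. x = \<delta> - k n n * \<sigma> \<and> \<bar>\<delta>\<bar> \<le> wbar + c + B n \<and> \<sigma> \<in> sign_set (a s)"
            using le \<sigma> by blast
          then show "x \<in> chain_rhs n (k n) (wbar + c + B n) (a s) (d s) (\<lambda>j. Zh s n j - Z s j) j"
            using jn unfolding chain_rhs_def by simp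
        qed
      qed
    qed simp_all
  qed
  show "\<exists>a d. chain_solution n (k n) (wbar + c + B n) 0 t a d (\<lambda>s j. Zh s n j - Z s j) \<and>
      (\<forall>s\<in>{0..t}. \<bar>a s - (Zh s n 1 - Z s 1)\<bar> \<le> \<delta> \<and>
        (\<forall>j\<in>{1..<n}. \<forall>\<rho>. (\<forall>l\<in>{1..j}. \<bar>Zh s j l - Z s l\<bar> \<le> \<rho>) \<longrightarrow> \<bar>d s j\<bar> \<le> \<omega> \<rho> + \<delta>))"
  proof (rule exI[of _ a], rule exI[of _ d], intro conjI ballI allI impI)
    show "chain_solution n (k n) (wbar + c + B n) 0 t a d (\<lambda>s j. Zh s n j - Z s j)" by (rule sol)
    fix s assume "s \<in> {0..t}"
    then have s: "0 \<le> s" "s \<le> t" by simp_all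
    show "\<bar>a s - (Zh s n 1 - Z s 1)\<bar> \<le> \<delta>" using dv[OF s] by (simp add: a_def)
    fix j \<rho> assume j: "j \<in> {1..<n}"
      and \<rho>: "\<forall>l\<in>{1..j}. \<bar>Zh s j l - Z s l\<bar> \<le> \<rho>"
    have jm: "j \<in> {1..m}" using j n' by simp
    have "\<bar>Zh s j 1 - Z s 1\<bar> \<le> \<rho>" using \<rho> j by simp
    then have "0 \<le> \<rho>" by linarith
    have "\<bar>\<Phi> j (u s) (restrict (Zh s j) {1..j}) - \<Phi> j (u s) (restrict (Z s) {1..j})\<bar> \<le> \<omega> \<rho>"
    proof (rule \<omega>[OF jm bu[OF s] _ \<open>0 \<le> \<rho>\<close>])
      show "\<bar>Z s l\<bar> \<le> c" if "l \<in> {1..j}" for l using bZ[OF s, of l] that jm by simp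
      show "\<bar>Zh s j l - Z s l\<bar> \<le> \<rho>" if "l \<in> {1..j}" for l using \<rho> that by blast
    qed
    moreover have "\<bar>wh s j - w s j\<bar> \<le> \<delta>" using dw[OF s, of j] j n by auto
    ultimately show "\<bar>d s j\<bar> \<le> \<omega> \<rho> + \<delta>" unfolding d_def by linarith
  qed
qed

text \<open>A supremum of reals bounds its set only if that set is bounded above, and
  \<open>M\<close> ensures this for both suprema.\<close>

lemma error_bound_ge:
  fixes v :: "real \<Rightarrow> real" and \<Delta> :: "real \<Rightarrow> nat \<Rightarrow> real"
  assumes \<gamma>: "class_K \<gamma>" and i: "1 \<le> i" and t: "0 \<le> t" and M: "0 \<le> M"
    and v: "\<And>s. \<lbrakk>0 \<le> s; s \<le> t\<rbrakk> \<Longrightarrow> \<bar>v s\<bar> \<le> M"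
    and \<Delta>: "\<And>s j. \<lbrakk>0 \<le> s; s \<le> t; j \<in> {1..i - 1}\<rbrakk> \<Longrightarrow> \<bar>\<Delta> s j\<bar> \<le> M"
  shows "\<beta> e t \<le> error_bound \<gamma> \<gamma> \<beta> v \<Delta> e i t"
    and "\<lbrakk>0 \<le> s; s \<le> t\<rbrakk> \<Longrightarrow> \<gamma> \<bar>v s\<bar> \<le> error_bound \<gamma> \<gamma> \<beta> v \<Delta> e i t"
    and "\<lbrakk>0 \<le> s; s \<le> t; j \<in> {1..i - 1}\<rbrakk> \<Longrightarrow> \<gamma> \<bar>\<Delta> s j\<bar> \<le> error_bound \<gamma> \<gamma> \<beta> v \<Delta> e i t"
proof -
  show "\<beta> e t \<le> error_bound \<gamma> \<gamma> \<beta> v \<Delta> e i t"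
    by (simp add: error_bound_def Let_def le_max_iff_disj)
  have bv: "bdd_above ((\<lambda>s. \<gamma> \<bar>v s\<bar>) ` {0..t})"
    by (rule bdd_aboveI2[of _ _ "\<gamma> M"]) (use v in \<open>auto intro!: class_K_mono[OF \<gamma>]\<close>)
  show "\<gamma> \<bar>v s\<bar> \<le> error_bound \<gamma> \<gamma> \<beta> v \<Delta> e i t" if "0 \<le> s" "s \<le> t"
  proof -
    have "\<gamma> \<bar>v s\<bar> \<le> (SUP s\<in>{0..t}. \<gamma> \<bar>v s\<bar>)" using that
      by (intro cSUP_upper[OF _ bv]) simp
    then show ?thesis by (simp add: error_bound_def Let_def le_max_iff_disj)
  qed
  show "\<gamma> \<bar>\<Delta> s j\<bar> \<le> error_bound \<gamma> \<gamma> \<beta> v \<Delta> e i t" if s: "0 \<le> s" "s \<le> t" and j: "j \<in> {1..i - 1}"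
  proof -
    have "bdd_above ((\<lambda>(j, s). \<gamma> \<bar>\<Delta> s j\<bar>) ` ({1..i - 1} \<times> {0..t}))"
    proof (rule bdd_aboveI2[of _ _ "\<gamma> M"])
      fix x assume "x \<in> {1..i - 1} \<times> {0..t}"
      then obtain j s where "x = (j, s)" "j \<in> {1..i - 1}" "0 \<le> s" "s \<le> t" by auto
      then show "(case x of (j, s) \<Rightarrow> \<gamma> \<bar>\<Delta> s j\<bar>) \<le> \<gamma> M"
        using class_K_mono[OF \<gamma>, of "\<bar>\<Delta> s j\<bar>" M] \<Delta>[of s j] by simp
    qed
    then have "(\<lambda>(j, s). \<gamma> \<bar>\<Delta> s j\<bar>) (j, s) \<le> (SUP (j, s)\<in>{1..i - 1} \<times> {0..t}. \<gamma> \<bar>\<Delta> s j\<bar>)"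
      using s j by (intro cSUP_upper) simp_all
    moreover have "i \<noteq> 1" using j by auto
    ultimately show ?thesis by (simp add: error_bound_def Let_def le_max_iff_disj)
  qed
qed

text \<open>Converts a bound \<open>A r\<close> in force until the settling time
  \<open>\<tau> r\<close> into a class KL function: up to that time the exponential is at least
  1.\<close>

lemma class_KL_exp:
  assumes A: "class_K A" and \<tau>: "class_K \<tau>"
  shows "class_KL (\<lambda>r t. A r * exp (\<tau> r - t))"
  unfolding class_KL_def
proof (intro conjI allI impI)
  have "continuous_on {0..} A" "continuous_on {0..} \<tau>" using A \<tau> by (simp_all add: class_K_def)
  then have "continuous_on ({0..} \<times> {0..}) (\<lambda>x. A (fst x))" "continuous_on ({0..} \<times> {0..}) (\<lambda>x. \<tau> (fst x))"
    by (auto intro!: continuous_on_compose2[of "{0..}" A] continuous_on_compose2[of "{0..}" \<tau>] continuous_on_fst continuous_on_id)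
  then have "continuous_on ({0..} \<times> {0..}) (\<lambda>x. A (fst x) * exp (\<tau> (fst x) - snd x))"
    by (intro continuous_on_mult continuous_on_exp continuous_on_diff continuous_on_snd continuous_on_id)
  then show "continuous_on ({0..} \<times> {0..}) (\<lambda>(r, t). A r * exp (\<tau> r - t))"
    by (simp add: case_prod_unfold)
next
  fix t :: real assume "0 \<le> t"
  show "class_K (\<lambda>r. A r * exp (\<tau> r - t))"
    unfolding class_K_def
  proof (intro conjI)
    show "continuous_on {0..} (\<lambda>r. A r * exp (\<tau> r - t))"
      using A \<tau> by (intro continuous_on_mult continuous_on_exp continuous_on_diff continuous_on_const) (simp_all add: class_K_def)
    show "strict_mono_on {0..} (\<lambda>r. A r * exp (\<tau> r - t))"
    proof (rule strict_mono_onI)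
      fix x y :: real assume xy: "x \<in> {0..}" "y \<in> {0..}" "x < y"
      have "A x * exp (\<tau> x - t) \<le> A x * exp (\<tau> y - t)"
        using xy class_K_nonneg[OF A, of x] class_K_mono[OF \<tau>, of x y] by (intro mult_left_mono) auto
      also have "A x < A y" using A xy by (auto simp: class_K_def intro: strict_mono_onD)
      then have "A x * exp (\<tau> y - t) < A y * exp (\<tau> y - t)" by (rule mult_strict_right_mono) simp
      finally show "A x * exp (\<tau> x - t) < A y * exp (\<tau> y - t)" .
    qed
    show "A 0 * exp (\<tau> 0 - t) = 0" using A by (simp add: class_K_def)
  qed
next
  fix r :: real assume r: "0 \<le> r"
  have "A r * exp (\<tau> r - y) \<le> A r * exp (\<tau> r - x)" if "x \<le> y" for x y
    using class_K_nonneg[OF A r] that by (intro mult_left_mono) auto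
  then show "antimono_on {0..} (\<lambda>t. A r * exp (\<tau> r - t))" by (intro monotone_onI) simp
  have "((\<lambda>t. A r * exp (\<tau> r) * exp (- t)) \<longlongrightarrow> A r * exp (\<tau> r) * 0) at_top"
    by (intro tendsto_intros filterlim_compose[OF exp_at_bot] filterlim_uminus_at_bot_at_top)
  then show "((\<lambda>t. A r * exp (\<tau> r - t)) \<longlongrightarrow> 0) at_top"
    by (simp add: exp_diff exp_minus field_simps)
qed

theorem proposition5:
  fixes m :: nat
    and \<Phi> :: "nat \<Rightarrow> real^'p \<Rightarrow> (nat \<Rightarrow> real) \<Rightarrow> real"
    and zbar ubar wbar :: real
  assumes "m \<ge> 1"
    and "\<forall>i\<in>{1..m}. continuous_on (UNIV \<times> ({1..i} \<rightarrow>\<^sub>E UNIV)) (\<lambda>(u, x). \<Phi> i u x)"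
    and "zbar > 0" and "ubar > 0" and "wbar > 0"
  shows "\<exists>(k :: nat \<Rightarrow> nat \<Rightarrow> real) (L :: nat \<Rightarrow> real) \<gamma>1 \<gamma>2 \<beta>.
    (\<forall>i\<in>{1..m}. L i > 0 \<and> (\<forall>j\<in>{1..i}. k i j > 0)) \<and>
    class_K \<gamma>1 \<and> class_K \<gamma>2 \<and> class_KL \<beta> \<and>
    (\<forall>(u :: real \<Rightarrow> real^'p) (v :: real \<Rightarrow> real) (w :: real \<Rightarrow> nat \<Rightarrow> real)
        (wh :: real \<Rightarrow> nat \<Rightarrow> real) (z :: nat \<Rightarrow> real) (Z :: real \<Rightarrow> nat \<Rightarrow> real)
        (zh :: nat \<Rightarrow> nat \<Rightarrow> real).
      locally_bounded_measurable u \<and> locally_bounded_measurable v \<and>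
      (\<forall>j\<in>{1..m}. locally_bounded_measurable (\<lambda>t. w t j) \<and> locally_bounded_measurable (\<lambda>t. wh t j)) \<and>
      system_solution m \<Phi> u w z Z \<longrightarrow>
        (\<exists>Zh. observer_solution m \<Phi> k L u wh (\<lambda>t. Z t 1 + v t) zh Zh) \<and>
        (\<forall>Zh. observer_solution m \<Phi> k L u wh (\<lambda>t. Z t 1 + v t) zh Zh \<longrightarrow>
          (\<forall>i\<in>{1..m}. \<forall>t\<ge>0.
            (\<forall>s\<in>{0..t}. L2_set (Z s) {1..m} \<le> zbar \<and> norm (u s) \<le> ubar \<and>
                L2_set (\<lambda>j. wh s j - w s j) {1..m} \<le> wbar) \<longrightarrow>
            L2_set (\<lambda>j. Zh t i j - Z t j) {1..i}
              \<le> error_bound \<gamma>1 \<gamma>2 \<beta> v (\<lambda>s j. wh s j - w s j)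
                   (\<Sum>j=1..m. L2_set (\<lambda>l. zh j l - z l) {1..j}) i t) \<and>
          ((\<forall>s\<ge>0. L2_set (Z s) {1..m} \<le> zbar \<and> norm (u s) \<le> ubar) \<and>
           (\<forall>t\<ge>0. v t = 0 \<and> (\<forall>j\<in>{1..m}. wh t j - w t j = 0)) \<longrightarrow>
           (\<exists>T\<ge>0. \<forall>t\<ge>T. \<forall>i\<in>{1..m}. \<forall>j\<in>{1..i}. Zh t i j = Z t j))))"
proof -
  have zbar: "0 \<le> zbar" and ubar: "0 \<le> ubar" using assms(3,4) by simp_all
  obtain \<omega> B where \<omega>: "class_K \<omega>"
    and B_nn: "\<And>j. j \<in> {1..m} \<Longrightarrow> 0 \<le> B j"
    and B: "\<And>j u z. \<lbrakk>j \<in> {1..m}; norm u \<le> ubar; \<And>l. l \<in> {1..j} \<Longrightarrow> \<bar>z l\<bar> \<le> zbar\<rbrakk>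
      \<Longrightarrow> \<bar>\<Phi> j u (restrict z {1..j})\<bar> \<le> B j"
    and modulus: "\<And>j u z zh \<rho>. \<lbrakk>j \<in> {1..m}; norm u \<le> ubar; \<And>l. l \<in> {1..j} \<Longrightarrow> \<bar>z l\<bar> \<le> zbar; 0 \<le> \<rho>;
      \<And>l. l \<in> {1..j} \<Longrightarrow> \<bar>zh l - z l\<bar> \<le> \<rho>\<rbrakk> \<Longrightarrow>
      \<bar>\<Phi> j u (restrict zh {1..j}) - \<Phi> j u (restrict z {1..j})\<bar> \<le> \<omega> \<rho>"
  proof (rule nonlinearity_bounds[OF assms(2,1) zbar ubar], goal_cases)
    case (1 \<omega> B)
    show thesis by (rule 1(1)[of \<omega> B]) (fact 1)+
  qed
  \<comment> \<open>What the sign term of block \<open>i\<close> has to dominate: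
    \<open>\<Delta>w i\<close>, the next component of the state, and
    \<open>\<Phi> i\<close>.\<close>
  define D where "D i = wbar + zbar + B i" for i
  have "\<exists>k. (\<forall>j\<in>{1..i}. 0 < k j) \<and>
      (\<exists>\<alpha> \<gamma> \<tau>. class_K \<alpha> \<and> class_K \<gamma> \<and> class_K \<tau> \<and> iss_estimate i k (D i) \<alpha> \<gamma> \<tau>)" if i: "i \<in> {1..m}" for i
    by (rule iss_gains) (use i B_nn[OF i] assms(3,5) in \<open>simp_all add: D_def\<close>)
  then obtain k where k: "\<forall>i\<in>{1..m}. (\<forall>j\<in>{1..i}. 0 < k i j) \<and>
      (\<exists>\<alpha> \<gamma> \<tau>. class_K \<alpha> \<and> class_K \<gamma> \<and> class_K \<tau> \<and> iss_estimate i (k i) (D i) \<alpha> \<gamma> \<tau>)"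
    by metis
  \<comment> \<open>One estimate for every length \<open>i\<close> of the cascade, not for
    \<open>m\<close> alone, because the bound for block \<open>i\<close> may involve
    \<open>\<Delta>w j\<close> for \<open>j < i\<close> only. The sums below make the functions
    common to all \<open>i\<close>.\<close>
  have "\<exists>A G \<tau>. class_K A \<and> class_K G \<and> class_K \<tau> \<and> cascade_estimate i k D \<omega> A G \<tau>" if i: "i \<in> {1..m}" for i
    by (rule cascade_gains[OF _ \<omega>]) (use i k in auto)
  then have "\<exists>A G \<tau>. \<forall>i\<in>{1..m}. class_K (A i) \<and> class_K (G i) \<and> class_K (\<tau> i) \<and> cascade_estimate i k D \<omega> (A i) (G i) (\<tau> i)"
    by metis
  then obtain A G \<tau> where AG: "\<forall>i\<in>{1..m}. class_K (A i) \<and> class_K (G i) \<and> class_K (\<tau> i) \<and>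
      cascade_estimate i k D \<omega> (A i) (G i) (\<tau> i)" by blast
  define A' G' \<tau>' where "A' r = (\<Sum>i=1..m. A i r)"
    and "G' \<delta> = (\<Sum>i=1..m. G i \<delta>)"
    and "\<tau>' r = (\<Sum>i=1..m. \<tau> i r)" for r \<delta>
  have K: "class_K A'" "class_K G'" "class_K \<tau>'"
    unfolding A'_def[abs_def] G'_def[abs_def] \<tau>'_def[abs_def] using AG assms(1)
      by (auto intro!: class_K_sum)
  have le: "A i r \<le> A' r" "G i r \<le> G' r" "\<tau> i r \<le> \<tau>' r" if i: "i \<in> {1..m}"
    and r: "0 \<le> r" for i r
    unfolding A'_def G'_def \<tau>'_def using AG i r class_K_nonneg by (auto intro!: member_le_sum)
  \<comment> \<open>The factor \<open>m\<close> leads from bounds on components to the Euclidean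
    norm.\<close>
  define \<beta> where "\<beta> r t = (real m * A' r) * exp (\<tau>' r - t)" for r t
  \<comment> \<open>The 2 makes up for suprema that need not be attained: if
    \<open>\<delta> > 0\<close> is the supremum of the disturbances, some value \<open>x\<close>
    exceeds \<open>\<delta> / 2\<close>, and \<open>\<gamma> x\<close> is at least
    \<open>m * G' \<delta>\<close>.\<close>
  define \<gamma> where "\<gamma> x = real m * G' (2 * x)" for x
  have m: "0 < real m" using assms(1) by simp
  have \<gamma>: "class_K \<gamma>" unfolding \<gamma>_def[abs_def]
    by (rule class_K_cmult[OF class_K_compose[OF K(2) class_K_cmult[OF class_K_id]] m]) simp
  have \<beta>: "class_KL \<beta>" unfolding \<beta>_def[abs_def]
    by (rule class_KL_exp[OF class_K_cmult[OF K(1) m] K(3)])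
  have main: "\<bar>Zh t i j - Z t j\<bar> \<le> max (A' r) (G' \<delta>)" "\<tau>' r \<le> t \<Longrightarrow> \<bar>Zh t i j - Z t j\<bar> \<le> G' \<delta>"
    if Z: "system_solution m \<Phi> u w z Z"
      and Zh: "observer_solution m \<Phi> k (\<lambda>_. 1) u wh (\<lambda>t. Z t 1 + v t) zh Zh"
      and i: "i \<in> {1..m}" and j: "j \<in> {1..i}" and t: "0 \<le> t"
      and bZ: "\<And>s j. \<lbrakk>0 \<le> s; s \<le> t; j \<in> {1..m}\<rbrakk> \<Longrightarrow> \<bar>Z s j\<bar> \<le> zbar"
      and bu: "\<And>s. \<lbrakk>0 \<le> s; s \<le> t\<rbrakk> \<Longrightarrow> norm (u s) \<le> ubar"
      and bw: "\<And>s j. \<lbrakk>0 \<le> s; s \<le> t; j \<in> {1..m}\<rbrakk> \<Longrightarrow> \<bar>wh s j - w s j\<bar> \<le> wbar"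
      and \<delta>: "0 \<le> \<delta>"
        and dv: "\<And>s. \<lbrakk>0 \<le> s; s \<le> t\<rbrakk> \<Longrightarrow> \<bar>v s\<bar> \<le> \<delta>"
      and dw: "\<And>s j. \<lbrakk>0 \<le> s; s \<le> t; j \<in> {1..i - 1}\<rbrakk> \<Longrightarrow> \<bar>wh s j - w s j\<bar> \<le> \<delta>"
      and r: "r = (\<Sum>j=1..m. L2_set (\<lambda>l. zh j l - z l) {1..j})"
    for u :: "real \<Rightarrow> real^'p" and v w wh z Z zh Zh i j t \<delta> r
  proof -
    have rnn: "0 \<le> r" unfolding r by (intro sum_nonneg) simp
    have init: "\<bar>Zh 0 i' j' - Z 0 j'\<bar> \<le> r" if i': "i' \<in> {1..i}"
      and j': "j' \<in> {1..i'}" for i' j'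
    proof -
      have i'm: "i' \<in> {1..m}" "j' \<in> {1..m}" using i i' j' by simp_all
      have "Zh 0 i' j' = zh i' j'" using Zh i'm(1) j' unfolding observer_solution_def by blast
      moreover have "Z 0 j' = z j'" using Z i'm(2) unfolding system_solution_def by blast
      ultimately have "\<bar>Zh 0 i' j' - Z 0 j'\<bar> \<le> L2_set (\<lambda>l. zh i' l - z l) {1..i'}"
        using abs_le_L2_set[of "{1..i'}" j' "\<lambda>l. zh i' l - z l"] j' by simp
      also have "\<dots> \<le> r" unfolding r
        by (rule member_le_sum[OF i'm(1), where f = "\<lambda>j. L2_set (\<lambda>l. zh j l - z l) {1..j}"]) simp_all
      finally show ?thesis .
    qed
    have err: "cascade_errors i k D \<omega> \<delta> t (\<lambda>i s j. Zh s i j - Z s j)"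
      unfolding D_def[abs_def]
      by (rule observer_error_cascade[OF Z Zh B modulus i t zbar bZ bu bw dv dw])
    have est: "cascade_estimate i k D \<omega> (A i) (G i) (\<tau> i)" using AG i by blast
    have i1: "i \<in> {1..i}" using i by simp
    note E = cascade_estimateD[OF est t rnn \<delta> err init i1 j]
    have "\<bar>Zh t i j - Z t j\<bar> \<le> max (A i r) (G i \<delta>)" by (rule E(1))
    then show "\<bar>Zh t i j - Z t j\<bar> \<le> max (A' r) (G' \<delta>)"
      using le(1)[OF i rnn] le(2)[OF i \<delta>] by linarith
    show "\<bar>Zh t i j - Z t j\<bar> \<le> G' \<delta>" if "\<tau>' r \<le> t"
    proof -
      have "\<tau> i r \<le> t" using le(3)[OF i rnn] that by linarith
      then have "\<bar>Zh t i j - Z t j\<bar> \<le> G i \<delta>" by (rule E(2)[rotated -1])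
      then show ?thesis using le(2)[OF i \<delta>] by linarith
    qed
  qed
  show ?thesis
  \<comment> \<open>\<open>L i = 1\<close> is possible because the gains \<open>k\<close> already
    dominate \<open>D\<close>: the powers of \<open>L\<close> are absorbed in them. One function
    \<open>\<gamma>\<close> serves both kinds of disturbance.\<close>
  proof (rule exI[of _ k], rule exI[of _ "\<lambda>_. 1"], rule exI[of _ \<gamma>], rule exI[of _ \<gamma>], rule exI[of _ \<beta>],
      intro conjI allI impI; (elim conjE)?)
    show "\<forall>i\<in>{1..m}. (0::real) < 1 \<and> (\<forall>j\<in>{1..i}. 0 < k i j)" using k by simp
    show "class_K \<gamma>" "class_K \<gamma>" "class_KL \<beta>" by (rule \<gamma> \<beta>)+
  next
    fix u :: "real \<Rightarrow> real^'p" and v :: "real \<Rightarrow> real"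
      and w wh :: "real \<Rightarrow> nat \<Rightarrow> real"
      and z :: "nat \<Rightarrow> real" and Z :: "real \<Rightarrow> nat \<Rightarrow> real"
        and zh :: "nat \<Rightarrow> nat \<Rightarrow> real"
    assume u: "locally_bounded_measurable u" and v: "locally_bounded_measurable v"
      and wwh: "\<forall>j\<in>{1..m}. locally_bounded_measurable (\<lambda>t. w t j) \<and> locally_bounded_measurable (\<lambda>t. wh t j)"
      and Z: "system_solution m \<Phi> u w z Z"
    show "\<exists>Zh. observer_solution m \<Phi> k (\<lambda>_. 1) u wh (\<lambda>t. Z t 1 + v t) zh Zh"
    proof (rule observer_solution_exists[OF assms(2) u])
      have "1 \<in> {1..m}" using assms(1) by simp
      then have "inclusion_solution (\<lambda>t. {system_rhs m \<Phi> (u t) (w t) (Z t) 1}) (\<lambda>t. Z t 1)"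
        using Z unfolding system_solution_def by blast
      then have "locally_bounded_measurable (\<lambda>t. Z t 1)"
        by (intro continuous_on_locally_bounded_measurable inclusion_solution_continuous_on)
      then show "locally_bounded_measurable (\<lambda>t. Z t 1 + v t)" using v
        by (rule locally_bounded_measurable_add)
      show "locally_bounded_measurable (\<lambda>t. wh t j)" if "j \<in> {1..m}" for j using wwh that by blast
      show "0 < 1 ^ i * k i i" if "i \<in> {1..m}" for i using k that by auto
    qed
  next
    fix u :: "real \<Rightarrow> real^'p" and v :: "real \<Rightarrow> real"
      and w wh :: "real \<Rightarrow> nat \<Rightarrow> real"
      and z :: "nat \<Rightarrow> real" and Z :: "real \<Rightarrow> nat \<Rightarrow> real"
        and zh :: "nat \<Rightarrow> nat \<Rightarrow> real"
        and Zh :: "real \<Rightarrow> nat \<Rightarrow> nat \<Rightarrow> real"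
    assume u: "locally_bounded_measurable u" and v: "locally_bounded_measurable v"
      and wwh: "\<forall>j\<in>{1..m}. locally_bounded_measurable (\<lambda>t. w t j) \<and> locally_bounded_measurable (\<lambda>t. wh t j)"
      and Z: "system_solution m \<Phi> u w z Z"
      and Zh: "observer_solution m \<Phi> k (\<lambda>_. 1) u wh (\<lambda>t. Z t 1 + v t) zh Zh"
    define r where "r = (\<Sum>j=1..m. L2_set (\<lambda>l. zh j l - z l) {1..j})"
    have rnn: "0 \<le> r" unfolding r_def by (intro sum_nonneg) simp
    show "\<forall>i\<in>{1..m}. \<forall>t\<ge>0. (\<forall>s\<in>{0..t}. L2_set (Z s) {1..m} \<le> zbar \<and> norm (u s) \<le> ubar \<and>
          L2_set (\<lambda>j. wh s j - w s j) {1..m} \<le> wbar) \<longrightarrow>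
        L2_set (\<lambda>j. Zh t i j - Z t j) {1..i} \<le> error_bound \<gamma> \<gamma> \<beta> v (\<lambda>s j. wh s j - w s j)
           (\<Sum>j=1..m. L2_set (\<lambda>l. zh j l - z l) {1..j}) i t"
    proof (intro ballI allI impI)
      fix i and t :: real
      assume i: "i \<in> {1..m}" and t: "0 \<le> t"
        and bd: "\<forall>s\<in>{0..t}. L2_set (Z s) {1..m} \<le> zbar \<and> norm (u s) \<le> ubar \<and>
          L2_set (\<lambda>j. wh s j - w s j) {1..m} \<le> wbar"
      have bZ: "\<bar>Z s j\<bar> \<le> zbar"
        and bw: "\<bar>wh s j - w s j\<bar> \<le> wbar" if "0 \<le> s" "s \<le> t" "j \<in> {1..m}" for s j
        using abs_le_L2_set[of "{1..m}" j "Z s"] abs_le_L2_set[of "{1..m}" j "\<lambda>j. wh s j - w s j"]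
          bspec[OF bd, of s] that by simp_all
      have bu: "norm (u s) \<le> ubar" if "0 \<le> s" "s \<le> t" for s using bspec[OF bd, of s] that by simp
      obtain Mv where Mv: "0 \<le> Mv" "\<And>s. \<lbrakk>0 \<le> s; s \<le> t\<rbrakk> \<Longrightarrow> \<bar>v s\<bar> \<le> Mv"
        using locally_bounded_measurableD[OF v t] by blast
      define M where "M = max Mv wbar"
      have M: "0 \<le> M" using Mv by (simp add: M_def)
      have vM: "\<bar>v s\<bar> \<le> M" if "0 \<le> s" "s \<le> t" for s using Mv(2)[OF that]
        by (simp add: M_def)
      have wM: "\<bar>wh s j - w s j\<bar> \<le> M" if "0 \<le> s" "s \<le> t" "j \<in> {1..i - 1}" for s j
      proof -
        have "j \<in> {1..m}" using that(3) i by auto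
        from bw[OF that(1,2) this] show ?thesis by (simp add: M_def le_max_iff_disj)
      qed
      \<comment> \<open>All disturbances that block \<open>i\<close> may feel, merged into a single
        level \<open>\<delta>\<close> as the cascade estimate expects.\<close>
      define V where "V = (\<lambda>s. \<bar>v s\<bar>) ` {0..t} \<union> (\<lambda>(s, j). \<bar>wh s j - w s j\<bar>) ` ({0..t} \<times> {1..i - 1})"
      define \<delta> where "\<delta> = Sup V"
      have V_bdd: "bdd_above V" using vM wM by (intro bdd_aboveI[of _ M]) (auto simp: V_def)
      have V_ne: "\<bar>v 0\<bar> \<in> V" using t by (auto simp: V_def)
      have V_le: "x \<le> \<delta>" if "x \<in> V" for x unfolding \<delta>_def using that V_bdd
        by (rule cSup_upper)
      have \<delta>: "0 \<le> \<delta>" using V_le[OF V_ne] by linarith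
      have dv: "\<bar>v s\<bar> \<le> \<delta>" if "0 \<le> s" "s \<le> t" for s
        by (rule V_le) (use that in \<open>auto simp: V_def\<close>)
      have dw: "\<bar>wh s j - w s j\<bar> \<le> \<delta>" if "0 \<le> s" "s \<le> t" "j \<in> {1..i - 1}" for s j
        by (rule V_le) (use that in \<open>auto simp: V_def intro!: image_eqI[of _ _ "(s, j)"]\<close>)
      let ?e = "error_bound \<gamma> \<gamma> \<beta> v (\<lambda>s j. wh s j - w s j) r i t"
      have "1 \<le> i" using i by simp
      have \<beta>_le: "\<beta> r t \<le> ?e"
        by (rule error_bound_ge(1)[OF \<gamma> \<open>1 \<le> i\<close> t M]) (rule vM wM; assumption)+
      have v_le: "\<gamma> \<bar>v s\<bar> \<le> ?e" if "0 \<le> s" "s \<le> t" for s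
        by (rule error_bound_ge(2)[OF \<gamma> \<open>1 \<le> i\<close> t M]) (rule vM wM that; assumption)+
      have w_le: "\<gamma> \<bar>wh s j - w s j\<bar> \<le> ?e" if "0 \<le> s" "s \<le> t" "j \<in> {1..i - 1}" for s j
        by (rule error_bound_ge(3)[OF \<gamma> \<open>1 \<le> i\<close> t M, where \<Delta> = "\<lambda>s j. wh s j - w s j"])
          (rule vM wM that; assumption)+
      have \<beta>_nn: "0 \<le> \<beta> r t" using class_K_nonneg[OF K(1) rnn] by (simp add: \<beta>_def)
      have G_le: "real m * G' \<delta> \<le> ?e"
      proof (cases "\<delta> = 0")
        case True
        then show ?thesis using \<beta>_le \<beta>_nn class_K_zero[OF K(2)] by simp
      next
        case False
        then have "\<delta> / 2 < Sup V" using \<delta> by (simp add: \<delta>_def)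
        then obtain x where x: "x \<in> V" "\<delta> / 2 < x" using less_cSupD[of V "\<delta> / 2"] V_ne
          by blast
        have "G' \<delta> \<le> G' (2 * x)" using x(2) \<delta> by (intro class_K_mono[OF K(2)]) simp_all
        then have "real m * G' \<delta> \<le> \<gamma> x" unfolding \<gamma>_def
          by (intro mult_left_mono) simp_all
        also have "\<gamma> x \<le> ?e"
          using x(1) unfolding V_def
        proof (elim UnE imageE)
          fix s assume "x = \<bar>v s\<bar>" "s \<in> {0..t}"
          then show ?thesis using v_le[of s] by simp
        next
          fix p assume p: "x = (case p of (s, j) \<Rightarrow> \<bar>wh s j - w s j\<bar>)" "p \<in> {0..t} \<times> {1..i - 1}"
          obtain s j where sj: "p = (s, j)" by (cases p)
          then show ?thesis using w_le[of s j] p by simp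
        qed
        finally show ?thesis .
      qed
      have each: "real m * \<bar>Zh t i j - Z t j\<bar> \<le> ?e" if j: "j \<in> {1..i}" for j
      \<comment> \<open>After the settling time the estimate no longer mentions \<open>r\<close>;
        before it, the exponential in \<open>\<beta>\<close> is at least 1 and
        \<open>\<beta> r t\<close> covers the initial error.\<close>
      proof (cases "\<tau>' r \<le> t")
        case True
        have "\<bar>Zh t i j - Z t j\<bar> \<le> G' \<delta>"
          by (rule main(2)[OF Z Zh i j t bZ bu bw \<delta> dv dw r_def True])
        then have "real m * \<bar>Zh t i j - Z t j\<bar> \<le> real m * G' \<delta>"
          by (intro mult_left_mono) simp_all
        then show ?thesis using G_le by linarith
      next
        case False
        have "\<bar>Zh t i j - Z t j\<bar> \<le> max (A' r) (G' \<delta>)"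
          by (rule main(1)[OF Z Zh i j t bZ bu bw \<delta> dv dw r_def])
        then have "real m * \<bar>Zh t i j - Z t j\<bar> \<le> real m * max (A' r) (G' \<delta>)"
          by (intro mult_left_mono) simp_all
        also have "\<dots> = max (real m * A' r) (real m * G' \<delta>)" by (simp add: max_mult_distrib_left)
        also have "\<dots> \<le> ?e"
        proof -
          have "1 \<le> exp (\<tau>' r - t)" using False by simp
          moreover have "0 \<le> real m * A' r" using class_K_nonneg[OF K(1) rnn] by simp
          ultimately have "real m * A' r \<le> \<beta> r t"
            using mult_left_mono[of 1 "exp (\<tau>' r - t)" "real m * A' r"] by (simp add: \<beta>_def)
          then show ?thesis using G_le \<beta>_le by simp
        qed
        finally show ?thesis .
      qed
      have "L2_set (\<lambda>j. Zh t i j - Z t j) {1..i} \<le> (\<Sum>j\<in>{1..i}. \<bar>Zh t i j - Z t j\<bar>)" by (rule L2_set_le_sum_abs)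
      also have "\<dots> \<le> (\<Sum>j\<in>{1..i}. ?e / real m)"
        using each m by (intro sum_mono) (simp add: pos_le_divide_eq mult.commute)
      also have "\<dots> = real i * (?e / real m)" by simp
      also have "\<dots> \<le> real m * (?e / real m)"
        using i m \<beta>_le \<beta>_nn by (intro mult_right_mono) auto
      also have "\<dots> = ?e" using m by simp
      finally show "L2_set (\<lambda>j. Zh t i j - Z t j) {1..i} \<le> error_bound \<gamma> \<gamma> \<beta> v (\<lambda>s j. wh s j - w s j)
           (\<Sum>j=1..m. L2_set (\<lambda>l. zh j l - z l) {1..j}) i t" unfolding r_def .
    qed
    assume bd: "\<forall>s\<ge>0. L2_set (Z s) {1..m} \<le> zbar \<and> norm (u s) \<le> ubar"
      and zero: "\<forall>t\<ge>0. v t = 0 \<and> (\<forall>j\<in>{1..m}. wh t j - w t j = 0)"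
    show "\<exists>T\<ge>0. \<forall>t\<ge>T. \<forall>i\<in>{1..m}. \<forall>j\<in>{1..i}. Zh t i j = Z t j"
    proof (intro exI[of _ "\<tau>' r"] conjI allI impI ballI)
      show "0 \<le> \<tau>' r" by (rule class_K_nonneg[OF K(3) rnn])
      fix t i j assume t: "\<tau>' r \<le> t" and i: "i \<in> {1..m}" and j: "j \<in> {1..i}"
      have t0: "0 \<le> t" using t \<open>0 \<le> \<tau>' r\<close> by linarith
      have bZ: "\<bar>Z s j\<bar> \<le> zbar" if "0 \<le> s" "j \<in> {1..m}" for s j
        using abs_le_L2_set[of "{1..m}" j "Z s"] bd[rule_format, OF that(1)] that(2) by simp
      \<comment> \<open>Past the settling time only the disturbance term is left, and it is
        \<open>G' 0 = 0\<close>. The time obtained depends on the initial errors alone.\<close>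
      have "\<bar>Zh t i j - Z t j\<bar> \<le> G' 0"
      proof (rule main(2)[OF Z Zh i j t0 bZ _ _ order_refl _ _ r_def t])
        show "norm (u s) \<le> ubar" if "0 \<le> s" for s using bd that by blast
        show "\<bar>wh s j - w s j\<bar> \<le> wbar" if "0 \<le> s" "j \<in> {1..m}" for s j
          using zero that assms(5) by simp
        show "\<bar>v s\<bar> \<le> 0" if "0 \<le> s" for s using zero that by simp
        show "\<bar>wh s j - w s j\<bar> \<le> 0" if "0 \<le> s" "j \<in> {1..i - 1}" for s j
        proof -
          have "j \<in> {1..m}" using that i by auto
          then show ?thesis using zero that by simp
        qed
      qed simp_all
      then show "Zh t i j = Z t j" using class_K_zero[OF K(2)] by simp
    qed
  qed
qed

end
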